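(* Let $K$ be a field and let $I\subseteq K[x_1,\dots,x_n]$ be a matroidal ideal such that $\mathrm{supp}(I)=\{x_1,\dots,x_n\}$. Then $I$ is Cohen-Macaulay if and only if it is a set-theoretic complete intersection.
   Context: $R=K[x_1,\dots,x_n]$ is the polynomial ring in $n\ge 1$ variables over a field $K$. For a monomial $u=x_1^{a_1}\cdots x_n^{a_n}$, $\mathrm{supp}(u)=\{x_i : a_i\neq 0\}$. For a monomial ideal $I$, $G(I)$ is its unique minimal set of monomial generators and $\mathrm{supp}(I)=\bigcup_{u\in G(I)}\mathrm{supp}(u)$. A monomial ideal $I$ is matroidal if every member of $G(I)$ is square-free and the following exchange condition holds: for any $u=x_1^{a_1}\cdots x_n^{a_n}$, $v=x_1^{b_1}\cdots x_n^{b_n}$ in $G(I)$, if $a_i>b_i$ for some $i$, then there is some $j$ with $a_j<b_j$ such that $x_ju/x_i\in G(I)$. "$I$ is Cohen-Macaulay" means that the quotient ring $R/I$ is Cohen-Macaulay. The arithmetical rank $\mathrm{ara}\,I$ is the minimal number $m$ such that there are $f_1,\dots,f_m\in R$ with $\sqrt{(f_1,\dots,f_m)}=\sqrt{I}$. $I$ is a set-theoretic complete intersection if $\mathrm{ara}\,I$ equals the height of $I$. *)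

theory Defs
  imports "HOL-Library.Poly_Mapping" "HOL-Library.Extended_Nat" "HOL-Algebra.Algebra"
begin

section \<open>Commutative algebra\<close>

text \<open>A chain of length \<open>k\<close> consists of \<open>k + 1\<close> strictly increasing prime ideals. The suprema
  and infima below are taken in \<^typ>\<open>enat\<close>.\<close>

definition prime_chain :: "('a, 'm) ring_scheme \<Rightarrow> 'a set list \<Rightarrow> bool" where
  "prime_chain A ps \<longleftrightarrow> ps \<noteq> [] \<and> (\<forall>P\<in>set ps. primeideal P A) \<and> sorted_wrt (\<subset>) ps"

definition krull_dim :: "('a, 'm) ring_scheme \<Rightarrow> enat" where
  "krull_dim A = Sup {enat (length ps - 1) | ps. prime_chain A ps}"

definition prime_height :: "('a, 'm) ring_scheme \<Rightarrow> 'a set \<Rightarrow> enat" where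
  "prime_height A P = Sup {enat (length ps - 1) | ps. prime_chain A ps \<and> last ps = P}"

definition ideal_height :: "('a, 'm) ring_scheme \<Rightarrow> 'a set \<Rightarrow> enat" where
  "ideal_height A I = Inf {prime_height A P | P. primeideal P A \<and> I \<subseteq> P}"

definition radical :: "('a, 'm) ring_scheme \<Rightarrow> 'a set \<Rightarrow> 'a set" where
  "radical A I = {a \<in> carrier A. \<exists>k::nat. a [^]\<^bsub>A\<^esub> k \<in> I}"

definition arith_rank :: "('a, 'm) ring_scheme \<Rightarrow> 'a set \<Rightarrow> enat" where
  "arith_rank A I = Inf {enat (length fs) | fs.
     set fs \<subseteq> carrier A \<and> radical A (Idl\<^bsub>A\<^esub> (set fs)) = radical A I}"

definition set_theoretic_complete_intersection :: "('a, 'm) ring_scheme \<Rightarrow> 'a set \<Rightarrow> bool" where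
  "set_theoretic_complete_intersection A I \<longleftrightarrow> arith_rank A I = ideal_height A I"

text \<open>The localization of a commutative ring at a multiplicative set \<open>S\<close>: the fraction \<open>a/s\<close> is
  the equivalence class of \<open>(a, s)\<close> under \<open>(a, s) \<sim> (b, t)\<close> iff \<open>u t a = u s b\<close> for some \<open>u \<in> S\<close>. Sums and
  products are taken over all representatives; on classes these unions are single fractions.\<close>

definition loc_frac :: "('a, 'm) ring_scheme \<Rightarrow> 'a set \<Rightarrow> 'a \<Rightarrow> 'a \<Rightarrow> ('a \<times> 'a) set" where
  "loc_frac A S a s = {(b, t). b \<in> carrier A \<and> t \<in> S \<and>
     (\<exists>u\<in>S. u \<otimes>\<^bsub>A\<^esub> (t \<otimes>\<^bsub>A\<^esub> a) = u \<otimes>\<^bsub>A\<^esub> (s \<otimes>\<^bsub>A\<^esub> b))}"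

definition localization :: "('a, 'm) ring_scheme \<Rightarrow> 'a set \<Rightarrow> ('a \<times> 'a) set ring" where
  "localization A S = \<lparr>
     carrier = {loc_frac A S a s | a s. a \<in> carrier A \<and> s \<in> S},
     monoid.mult = (\<lambda>C D. \<Union>(a, s)\<in>C. \<Union>(b, t)\<in>D. loc_frac A S (a \<otimes>\<^bsub>A\<^esub> b) (s \<otimes>\<^bsub>A\<^esub> t)),
     one = loc_frac A S \<one>\<^bsub>A\<^esub> \<one>\<^bsub>A\<^esub>,
     ring.zero = loc_frac A S \<zero>\<^bsub>A\<^esub> \<one>\<^bsub>A\<^esub>,
     add = (\<lambda>C D. \<Union>(a, s)\<in>C. \<Union>(b, t)\<in>D.
       loc_frac A S (a \<otimes>\<^bsub>A\<^esub> t \<oplus>\<^bsub>A\<^esub> b \<otimes>\<^bsub>A\<^esub> s) (s \<otimes>\<^bsub>A\<^esub> t))\<rparr>"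

text \<open>\<open>x\<^sub>1, \<dots>, x\<^sub>r\<close> is regular if \<open>x\<^sub>i\<close> is a nonzerodivisor modulo \<open>(x\<^sub>1, \<dots>, x\<^sub>i\<^sub>-\<^sub>1)\<close> for all \<open>i\<close>, and
  \<open>(x\<^sub>1, \<dots>, x\<^sub>r)\<close> is a proper ideal.\<close>

definition regular_sequence :: "('a, 'm) ring_scheme \<Rightarrow> 'a list \<Rightarrow> bool" where
  "regular_sequence A xs \<longleftrightarrow> set xs \<subseteq> carrier A \<and> Idl\<^bsub>A\<^esub> (set xs) \<noteq> carrier A \<and>
     (\<forall>i<length xs. \<forall>a\<in>carrier A.
        xs ! i \<otimes>\<^bsub>A\<^esub> a \<in> Idl\<^bsub>A\<^esub> (set (take i xs)) \<longrightarrow> a \<in> Idl\<^bsub>A\<^esub> (set (take i xs)))"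

definition local_ring :: "('a, 'm) ring_scheme \<Rightarrow> bool" where
  "local_ring A \<longleftrightarrow> cring A \<and> (\<exists>!M. maximalideal M A)"

definition local_depth :: "('a, 'm) ring_scheme \<Rightarrow> enat" where
  "local_depth A = Sup {enat (length xs) | xs.
     regular_sequence A xs \<and> set xs \<subseteq> (THE M. maximalideal M A)}"

definition local_cohen_macaulay :: "('a, 'm) ring_scheme \<Rightarrow> bool" where
  "local_cohen_macaulay A \<longleftrightarrow>
     local_ring A \<and> noetherian_ring A \<and> local_depth A = krull_dim A"

definition cohen_macaulay :: "('a, 'm) ring_scheme \<Rightarrow> bool" where
  "cohen_macaulay A \<longleftrightarrow> cring A \<and> noetherian_ring A \<and>
     (\<forall>M. maximalideal M A \<longrightarrow> local_cohen_macaulay (localization A (carrier A - M)))"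

section \<open>Monomial ideals\<close>

text \<open>\<open>K[x\<^sub>1, \<dots>, x\<^sub>n]\<close>: a monomial is identified with its exponent vector \<^typ>\<open>nat \<Rightarrow>\<^sub>0 nat\<close>, whose
  set of \<open>keys\<close> is the set of indices of the variables dividing it; a polynomial is a finitely
  supported function from monomials to \<open>K\<close>, with convolution as product.\<close>

definition monomials :: "nat \<Rightarrow> (nat \<Rightarrow>\<^sub>0 nat) set" where
  "monomials n = {u. Poly_Mapping.keys u \<subseteq> {1..n}}"

definition mpoly_ring :: "nat \<Rightarrow> ((nat \<Rightarrow>\<^sub>0 nat) \<Rightarrow>\<^sub>0 'k::field) ring" where
  "mpoly_ring n = \<lparr>
     carrier = {p. Poly_Mapping.keys p \<subseteq> monomials n},
     monoid.mult = (*), one = 1, ring.zero = 0, add = (+)\<rparr>"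

definition monom_poly :: "(nat \<Rightarrow>\<^sub>0 nat) \<Rightarrow> ((nat \<Rightarrow>\<^sub>0 nat) \<Rightarrow>\<^sub>0 'k::field)" where
  "monom_poly u = Poly_Mapping.single u 1"

definition monomial_gens :: "nat \<Rightarrow> ((nat \<Rightarrow>\<^sub>0 nat) \<Rightarrow>\<^sub>0 'k::field) set \<Rightarrow> (nat \<Rightarrow>\<^sub>0 nat) set \<Rightarrow> bool" where
  "monomial_gens n I U \<longleftrightarrow> U \<subseteq> monomials n \<and> I = Idl\<^bsub>mpoly_ring n\<^esub> (monom_poly ` U)"

definition monomial_ideal :: "nat \<Rightarrow> ((nat \<Rightarrow>\<^sub>0 nat) \<Rightarrow>\<^sub>0 'k::field) set \<Rightarrow> bool" where
  "monomial_ideal n I \<longleftrightarrow> (\<exists>U. monomial_gens n I U)"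

definition min_gens :: "nat \<Rightarrow> ((nat \<Rightarrow>\<^sub>0 nat) \<Rightarrow>\<^sub>0 'k::field) set \<Rightarrow> (nat \<Rightarrow>\<^sub>0 nat) set" where
  "min_gens n I = (THE U. monomial_gens n I U \<and> (\<forall>V. V \<subset> U \<longrightarrow> \<not> monomial_gens n I V))"

definition ideal_supp :: "nat \<Rightarrow> ((nat \<Rightarrow>\<^sub>0 nat) \<Rightarrow>\<^sub>0 'k::field) set \<Rightarrow> nat set" where
  "ideal_supp n I = (\<Union>u\<in>min_gens n I. Poly_Mapping.keys u)"

definition matroidal :: "nat \<Rightarrow> ((nat \<Rightarrow>\<^sub>0 nat) \<Rightarrow>\<^sub>0 'k::field) set \<Rightarrow> bool" where
  "matroidal n I \<longleftrightarrow> monomial_ideal n I \<and>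
     (\<forall>u\<in>min_gens n I. \<forall>i. Poly_Mapping.lookup u i \<le> 1) \<and>
     (\<forall>u\<in>min_gens n I. \<forall>v\<in>min_gens n I. \<forall>i.
        Poly_Mapping.lookup u i > Poly_Mapping.lookup v i \<longrightarrow>
        (\<exists>j. Poly_Mapping.lookup u j < Poly_Mapping.lookup v j \<and>
           Poly_Mapping.single j 1 + (u - Poly_Mapping.single i 1) \<in> min_gens n I))"

end

theory Submission
  imports Defs
begin

text \<open>
  Let \<open>d\<close> be the common degree of the generators of \<open>I\<close>. Their supports are the bases of a matroid without loops
  on \<open>E = {1..n}\<close>, and the primes minimal over \<open>I\<close> are the primes \<open>(x\<^sub>i : i \<notin> H)\<close> for the hyperplanes \<open>H\<close>, the
  maximal sets that contain no basis. Hence \<open>ht I = n - s\<close>, where \<open>s\<close> is the largest size of a set that contains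
  no basis. Both properties turn out to be equivalent to the matroid being uniform, that is, to \<open>I\<close> being
  generated by all squarefree monomials of degree \<open>d\<close>.

  Let the matroid be uniform; then \<open>s = d - 1\<close>. The elementary symmetric polynomials of degrees \<open>d, \<dots>, n\<close>
  generate \<open>I\<close> up to radical: if a prime contains them and \<open>C\<close> is the set of variables outside that prime,
  then \<open>|C| \<ge> d\<close> is impossible, because all terms of the elementary symmetric polynomial of degree \<open>|C|\<close> but one
  lie in the prime (\<open>esym_radical\<close>). For the Cohen-Macaulay property, colons and sums with single variables
  break \<open>R/I\<close> into pieces \<open>R/(x\<^sub>i : i \<notin> G)\<close> with \<open>|G| = d - 1\<close>. At a prime \<open>m\<close> whose residue ring has a
  transcendence basis \<open>T\<close> of variables, every piece has a regular sequence of length \<open>d - 1 - |T|\<close>, prime avoidance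
  makes the sequences equal, and \<open>weakly_regular_colon\<close> assembles the pieces. The bound on chains of primes
  (\<open>chain_length_bound\<close>) says that no longer chain exists. The variables \<open>T\<close> take the place of the
  Nullstellensatz: at a maximal ideal \<open>T\<close> is empty, but this never has to be known.

  Let the matroid not be uniform. Then (\<open>nonuniform_configuration\<close>) there are hyperplanes \<open>H\<close>, \<open>H'\<close> with
  \<open>|H| = s\<close>, a flat \<open>F\<close> inside both with \<open>|F| \<le> s - 2\<close>, and an independent set in \<open>F\<close>, with monomial \<open>c\<close>, such that
  \<open>c x\<^sub>i x\<^sub>j \<in> I\<close> for \<open>i \<notin> H\<close> and \<open>j \<in> H - F\<close>. So near the generic point of \<open>V(x\<^sub>i : i \<notin> F)\<close> the set
  \<open>V(I)\<close> falls into two closed parts which meet in codimension at least two only. Hartshorne's argument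
  (\<open>hartshorne\<close>) excludes this for an ideal with a regular sequence of length \<open>s\<close> modulo it
  (\<open>nonuniform_no_regular_seq\<close>). If \<open>R/I\<close> is Cohen-Macaulay, such a sequence exists modulo \<open>I\<close> at the
  origin, since \<open>dim R/I = s\<close>. If \<open>I\<close> and \<open>(f\<^sub>1, \<dots>, f\<^sub>m)\<close> have the same radical and \<open>m \<le> n - s\<close>, prime
  avoidance replaces the \<open>f\<^sub>i\<close> at the origin by a regular sequence that generates the same ideal
  (\<open>regular_generators\<close>); so a sequence of length \<open>n - m\<close> is left modulo \<open>(f\<^sub>1, \<dots>, f\<^sub>m)\<close>, and the chain bound
  forces \<open>m = n - s\<close>. This also shows that the arithmetical rank is at least the height (\<open>few_generators\<close>).
\<close>

section \<open>Associated primes and regular sequences\<close>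

context cring
begin

lemma ideal_sub: "ideal J R \<Longrightarrow> J \<subseteq> carrier R"
  by (simp add: additive_subgroup.a_subset ideal_def)

lemma ideal_carr: "ideal J R \<Longrightarrow> a \<in> J \<Longrightarrow> a \<in> carrier R"
  by (rule ideal.Icarr)

lemma ideal_add: "ideal J R \<Longrightarrow> a \<in> J \<Longrightarrow> b \<in> J \<Longrightarrow> a \<oplus> b \<in> J"
  by (simp add: additive_subgroup.a_closed ideal_def)

lemma ideal_zero: "ideal J R \<Longrightarrow> \<zero> \<in> J"
  by (simp add: additive_subgroup.zero_closed ideal_def)

lemma ideal_mult: "ideal J R \<Longrightarrow> a \<in> J \<Longrightarrow> c \<in> carrier R \<Longrightarrow> c \<otimes> a \<in> J"
  by (simp add: ideal.I_l_closed)

lemma ideal_mult': "ideal J R \<Longrightarrow> a \<in> J \<Longrightarrow> c \<in> carrier R \<Longrightarrow> a \<otimes> c \<in> J"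
  by (simp add: ideal.I_r_closed)

lemma ideal_neg: "ideal J R \<Longrightarrow> a \<in> J \<Longrightarrow> \<ominus> a \<in> J"
  by (simp add: additive_subgroup.a_inv_closed ideal_def)

lemma ideal_minus: "ideal J R \<Longrightarrow> a \<in> J \<Longrightarrow> b \<in> J \<Longrightarrow> a \<ominus> b \<in> J"
  unfolding a_minus_def by (simp add: ideal_add ideal_neg)

lemma ideal_add_cancel: 
  assumes "ideal J R" "a \<in> carrier R" "b \<in> J" shows "a \<oplus> b \<in> J \<longleftrightarrow> a \<in> J"
proof
  assume "a \<oplus> b \<in> J"
  hence "(a \<oplus> b) \<ominus> b \<in> J" using assms by (simp add: ideal_minus)
  moreover have "(a \<oplus> b) \<ominus> b = a" using assms ideal_carr[of J b] by algebra
  ultimately show "a \<in> J" by simp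
qed (use assms ideal_add in blast)

lemma ideal_minus_cancel: 
  assumes "ideal J R" "a \<in> carrier R" "b \<in> J" shows "a \<ominus> b \<in> J \<longleftrightarrow> a \<in> J"
  unfolding a_minus_def using ideal_add_cancel[of J a "\<ominus> b"] assms ideal_neg by auto

lemma make_ideal:
  assumes "J \<subseteq> carrier R" "\<zero> \<in> J" "\<And>a b. a \<in> J \<Longrightarrow> b \<in> J \<Longrightarrow> a \<oplus> b \<in> J"
    "\<And>a c. a \<in> J \<Longrightarrow> c \<in> carrier R \<Longrightarrow> c \<otimes> a \<in> J"
  shows "ideal J R"
proof (rule idealI)
  show "ring R" by (rule ring_axioms)
  show "subgroup J (add_monoid R)"
  proof (rule add.subgroupI)
    show "J \<subseteq> carrier R" "J \<noteq> {}" using assms by auto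
    fix a assume a: "a \<in> J"
    have "\<ominus> a = (\<ominus> \<one>) \<otimes> a" using a assms(1) by (metis l_minus l_one one_closed subsetD)
    thus "\<ominus> a \<in> J" using assms(4)[OF a, of "\<ominus> \<one>"] by simp
  next
    fix a b assume "a \<in> J" "b \<in> J" thus "a \<oplus> b \<in> J" by (rule assms(3))
  qed
  show "x \<otimes> a \<in> J" "a \<otimes> x \<in> J" if "a \<in> J" "x \<in> carrier R" for a x
    using assms(4)[OF that] that assms(1) m_comm by (auto simp: subset_iff)
qed

definition colon where "colon J u = {a \<in> carrier R. a \<otimes> u \<in> J}"

lemma colon_ideal: assumes "ideal J R" "u \<in> carrier R" shows "ideal (colon J u) R"
proof (rule make_ideal)
  show "\<zero> \<in> colon J u" using assms by (simp add: colon_def ideal_zero)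
  fix a b assume "a \<in> colon J u" "b \<in> colon J u"
  thus "a \<oplus> b \<in> colon J u" using assms by (simp add: colon_def l_distr ideal_add)
next
  fix a c assume "a \<in> colon J u" "c \<in> carrier R"
  thus "c \<otimes> a \<in> colon J u" using assms by (simp add: colon_def m_assoc ideal_mult)
qed (auto simp: colon_def)

lemma colon_sup: "ideal J R \<Longrightarrow> u \<in> carrier R \<Longrightarrow> J \<subseteq> colon J u"
  unfolding colon_def using ideal_mult' ideal_carr by blast

definition assoc_prime where
  "assoc_prime J Q \<longleftrightarrow> primeideal Q R \<and> (\<exists>u\<in>carrier R. Q = colon J u)"

lemma assoc_prime_sup: "ideal J R \<Longrightarrow> assoc_prime J Q \<Longrightarrow> J \<subseteq> Q"
  unfolding assoc_prime_def using colon_sup by blast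

lemma prime_ideal: "primeideal Q R \<Longrightarrow> ideal Q R"
  by (simp add: primeideal_def)

lemma prime_one: "primeideal Q R \<Longrightarrow> \<one> \<notin> Q"
  using ideal.one_imp_carrier primeideal.I_notcarr prime_ideal by metis

lemma prime_mult: "primeideal Q R \<Longrightarrow> a \<in> carrier R \<Longrightarrow> b \<in> carrier R \<Longrightarrow> a \<otimes> b \<in> Q \<longleftrightarrow> a \<in> Q \<or> b \<in> Q"
  using primeideal.I_prime ideal_mult ideal_mult' prime_ideal by metis

lemma prime_pow: "primeideal Q R \<Longrightarrow> a \<in> carrier R \<Longrightarrow> a [^] (k::nat) \<in> Q \<Longrightarrow> a \<in> Q"
proof (induction k)
  case (Suc k) thus ?case using prime_mult[of Q "a [^] k" a] by auto
qed (simp add: prime_one)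

lemma make_prime:
  assumes "ideal Q R" "\<one> \<notin> Q" "\<And>a b. a \<in> carrier R \<Longrightarrow> b \<in> carrier R \<Longrightarrow> a \<otimes> b \<in> Q \<Longrightarrow> a \<notin> Q \<Longrightarrow> b \<in> Q"
  shows "primeideal Q R"
proof (rule primeidealI[OF assms(1) is_cring])
  show "carrier R \<noteq> Q" using assms(2) one_closed by metis
qed (metis assms(3))

text \<open>All statements on a module \<open>R/J\<close> are phrased in terms of the ideal \<open>J\<close> of \<open>R\<close>, so that passing from \<open>R/J\<close> to
  \<open>R/(J + (y))\<close> does not change the ring.\<close>

definition nzd where "nzd J y \<longleftrightarrow> (\<forall>a\<in>carrier R. y \<otimes> a \<in> J \<longrightarrow> a \<in> J)"

definition adjoin where "adjoin J y = {j \<oplus> b \<otimes> y | j b. j \<in> J \<and> b \<in> carrier R}"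

lemma adjoin_ideal: assumes J: "ideal J R" and y: "y \<in> carrier R" shows "ideal (adjoin J y) R"
proof (rule make_ideal)
  show "adjoin J y \<subseteq> carrier R" using y ideal_carr[OF J] by (auto simp: adjoin_def)
  have "\<zero> = \<zero> \<oplus> \<zero> \<otimes> y" using y by simp
  thus "\<zero> \<in> adjoin J y" unfolding adjoin_def using ideal_zero[OF J] by blast
  fix a b assume "a \<in> adjoin J y" "b \<in> adjoin J y"
  then obtain j c j' c' where *: "a = j \<oplus> c \<otimes> y" "b = j' \<oplus> c' \<otimes> y" 
     "j \<in> J" "j' \<in> J" "c \<in> carrier R" "c' \<in> carrier R" by (auto simp: adjoin_def)
  have "a \<oplus> b = (j \<oplus> j') \<oplus> (c \<oplus> c') \<otimes> y" unfolding * using *(3-) ideal_carr[OF J] y by algebra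
  thus "a \<oplus> b \<in> adjoin J y" using * ideal_add[OF J] unfolding adjoin_def by blast
next
  fix a d assume "a \<in> adjoin J y" and d: "d \<in> carrier R"
  then obtain j c where *: "a = j \<oplus> c \<otimes> y" "j \<in> J" "c \<in> carrier R" by (auto simp: adjoin_def)
  have "d \<otimes> a = (d \<otimes> j) \<oplus> (d \<otimes> c) \<otimes> y" unfolding * using *(2-) ideal_carr[OF J] y d by algebra
  thus "d \<otimes> a \<in> adjoin J y" using * ideal_mult[OF J] d unfolding adjoin_def by blast
qed

lemma adjoin_sup: assumes J: "ideal J R" and y: "y \<in> carrier R" shows "J \<subseteq> adjoin J y"
proof
  fix j assume j: "j \<in> J"
  have "j = j \<oplus> \<zero> \<otimes> y" using y ideal_carr[OF J j] by simp
  thus "j \<in> adjoin J y" using j unfolding adjoin_def by blast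
qed

lemma adjoin_gen: assumes J: "ideal J R" and y: "y \<in> carrier R" shows "y \<in> adjoin J y"
proof -
  have "y = \<zero> \<oplus> \<one> \<otimes> y" using y by simp
  thus ?thesis using ideal_zero[OF J] unfolding adjoin_def by blast
qed

lemma adjoin_min: "ideal K R \<Longrightarrow> J \<subseteq> K \<Longrightarrow> y \<in> K \<Longrightarrow> adjoin J y \<subseteq> K"
  unfolding adjoin_def using ideal_add ideal_mult by blast

lemma adjoin_comm: assumes "ideal J R" "x \<in> carrier R" "y \<in> carrier R"
  shows "adjoin (adjoin J x) y = adjoin (adjoin J y) x"
proof -
  have "adjoin (adjoin J x) y \<subseteq> adjoin (adjoin J y) x" if "x \<in> carrier R" "y \<in> carrier R" for x y
    using assms(1) that
    by (meson adjoin_gen adjoin_ideal adjoin_min adjoin_sup subset_trans subsetD)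
  thus ?thesis using assms by blast
qed

lemma adjoin_Idl: assumes "S \<subseteq> carrier R" "y \<in> carrier R" shows "adjoin (Idl S) y = Idl (insert y S)"
proof
  have i: "ideal (Idl S) R" "ideal (Idl (insert y S)) R" using assms by (auto intro: genideal_ideal)
  have "S \<subseteq> Idl (insert y S)" "y \<in> Idl (insert y S)" using genideal_self[of "insert y S"] assms by auto
  thus "adjoin (Idl S) y \<subseteq> Idl (insert y S)" using adjoin_min[OF i(2)] genideal_minimal[OF i(2)] by blast
  show "Idl (insert y S) \<subseteq> adjoin (Idl S) y"
    using genideal_minimal[OF adjoin_ideal[OF i(1) assms(2)]] adjoin_gen[OF i(1) assms(2)] adjoin_sup[OF i(1) assms(2)]
      genideal_self[OF assms(1)] by blast
qed

text \<open>Regular sequences on \<open>R/J\<close> without properness of the ideal that they generate together with \<open>J\<close>: inside the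
  maximal ideal properness is automatic, and inductions may pass through the unit ideal.\<close>

primrec weakly_regular :: "'a set \<Rightarrow> 'a list \<Rightarrow> bool" where
  "weakly_regular J [] = True"
| "weakly_regular J (y # ys) = (nzd J y \<and> weakly_regular (adjoin J y) ys)"

definition has_regular_seq where "has_regular_seq m J r \<longleftrightarrow> (\<exists>ys. length ys = r \<and> set ys \<subseteq> m \<and> weakly_regular J ys)"

lemma has_regular_seq_0: "has_regular_seq m J 0" by (auto simp: has_regular_seq_def)

lemma has_regular_seq_Suc: "has_regular_seq m J (Suc r) \<longleftrightarrow> (\<exists>y\<in>m. nzd J y \<and> has_regular_seq m (adjoin J y) r)"
proof
  assume "has_regular_seq m J (Suc r)"
  then obtain ys where "length ys = Suc r" "set ys \<subseteq> m" "weakly_regular J ys" by (auto simp: has_regular_seq_def)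
  thus "\<exists>y\<in>m. nzd J y \<and> has_regular_seq m (adjoin J y) r" unfolding has_regular_seq_def by (cases ys) auto
next
  assume "\<exists>y\<in>m. nzd J y \<and> has_regular_seq m (adjoin J y) r"
  then obtain y ys where "y \<in> m" "nzd J y" "length ys = r" "set ys \<subseteq> m" "weakly_regular (adjoin J y) ys"
    by (auto simp: has_regular_seq_def)
  thus "has_regular_seq m J (Suc r)" unfolding has_regular_seq_def by (intro exI[of _ "y # ys"]) auto
qed

lemma has_regular_seq_le: "has_regular_seq m J r \<Longrightarrow> k \<le> r \<Longrightarrow> has_regular_seq m J k"
proof (induction k arbitrary: J r)
  case (Suc k)
  then obtain r' where r: "r = Suc r'" by (cases r) auto
  thus ?case using Suc by (auto simp: has_regular_seq_Suc)
qed (rule has_regular_seq_0)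

text \<open>With \<open>y u = j + v x\<close>, multiplication by \<open>v\<close> modulo \<open>J + (y)\<close> mirrors multiplication by \<open>u\<close> modulo
  \<open>J + (x)\<close>. This is the symmetry behind the fact that all maximal regular sequences in \<open>m\<close> have one length.\<close>

lemma nzd_exchange:
  assumes J: "ideal J R" and x: "x \<in> carrier R" and y: "y \<in> m" and m: "m \<subseteq> carrier R"
    and nx: "nzd J x" and ny: "nzd J y"
    and u: "u \<in> carrier R" "u \<notin> adjoin J x" "\<And>a. a \<in> m \<Longrightarrow> a \<otimes> u \<in> adjoin J x"
  shows "\<exists>v\<in>carrier R. v \<notin> adjoin J y \<and> (\<forall>a\<in>m. a \<otimes> v \<in> adjoin J y)"
proof -
  have yc: "y \<in> carrier R" using y m by auto
  obtain j v where jv: "y \<otimes> u = j \<oplus> v \<otimes> x" "j \<in> J" "v \<in> carrier R" using u(3)[OF y] by (auto simp: adjoin_def)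
  have jc: "j \<in> carrier R" using jv ideal_carr[OF J] by auto
  have "v \<notin> adjoin J y"
  proof
    assume "v \<in> adjoin J y"
    then obtain j' w where w: "v = j' \<oplus> w \<otimes> y" "j' \<in> J" "w \<in> carrier R" by (auto simp: adjoin_def)
    have j'c: "j' \<in> carrier R" using w ideal_carr[OF J] by auto
    have "y \<otimes> (u \<ominus> w \<otimes> x) = y \<otimes> u \<ominus> y \<otimes> (w \<otimes> x)" using yc u w x by algebra
    also have "\<dots> = j \<oplus> j' \<otimes> x" unfolding jv w using jc j'c yc x w(3) by algebra
    finally have "y \<otimes> (u \<ominus> w \<otimes> x) \<in> J" using ideal_add[OF J jv(2)] ideal_mult'[OF J w(2) x] by simp
    hence "u \<ominus> w \<otimes> x \<in> J" using ny u w x unfolding nzd_def by auto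
    moreover have "u = (u \<ominus> w \<otimes> x) \<oplus> w \<otimes> x" using u w x by algebra
    ultimately have "u \<in> adjoin J x" unfolding adjoin_def using w by blast
    thus False using u by simp
  qed
  moreover have "a \<otimes> v \<in> adjoin J y" if a: "a \<in> m" for a
  proof -
    have ac: "a \<in> carrier R" using a m by auto
    obtain j1 b where b: "a \<otimes> u = j1 \<oplus> b \<otimes> x" "j1 \<in> J" "b \<in> carrier R" using u(3)[OF a] by (auto simp: adjoin_def)
    have j1c: "j1 \<in> carrier R" using b ideal_carr[OF J] by auto
    have "x \<otimes> (a \<otimes> v \<ominus> b \<otimes> y) = a \<otimes> (j \<oplus> v \<otimes> x) \<ominus> a \<otimes> j \<ominus> b \<otimes> y \<otimes> x" using ac x b(3) jv(3) yc jc by algebra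
    also have "\<dots> = y \<otimes> (a \<otimes> u) \<ominus> a \<otimes> j \<ominus> b \<otimes> y \<otimes> x" unfolding jv(1)[symmetric] using ac yc u(1) jc b(3) x by algebra
    also have "\<dots> = y \<otimes> j1 \<ominus> a \<otimes> j" unfolding b(1) using ac yc jc b(3) x j1c by algebra
    finally have "x \<otimes> (a \<otimes> v \<ominus> b \<otimes> y) \<in> J" 
      using ideal_minus[OF J ideal_mult[OF J b(2) yc] ideal_mult[OF J jv(2) ac]] by simp
    hence "a \<otimes> v \<ominus> b \<otimes> y \<in> J" using nx ac jv(3) b yc unfolding nzd_def by auto
    moreover have "a \<otimes> v = (a \<otimes> v \<ominus> b \<otimes> y) \<oplus> b \<otimes> y" using ac jv(3) b(3) yc by algebra
    ultimately show ?thesis unfolding adjoin_def using b(3) by blast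
  qed
  ultimately show ?thesis using jv(3) by blast
qed

text \<open>The classical proof that a regular sequence may be permuted needs Nakayama's lemma. It is avoided by asking that
  \<open>z\<close> be a nonzerodivisor modulo \<open>J\<close> as well, which prime avoidance can always arrange.\<close>

lemma nzd_swap:
  assumes J: "ideal J R" and x: "x \<in> carrier R" and z: "z \<in> carrier R"
    and nx: "nzd J x" and nz: "nzd (adjoin J x) z" and nz0: "nzd J z"
  shows "nzd (adjoin J z) x"
  unfolding nzd_def
proof (intro ballI impI)
  fix a assume a: "a \<in> carrier R" "x \<otimes> a \<in> adjoin J z"
  then obtain j b where b: "x \<otimes> a = j \<oplus> b \<otimes> z" "j \<in> J" "b \<in> carrier R" by (auto simp: adjoin_def)
  have jc: "j \<in> carrier R" using b ideal_carr[OF J] by auto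
  have "z \<otimes> b = x \<otimes> a \<ominus> j" unfolding b(1) using jc b(3) z by algebra
  also have "\<dots> = \<ominus> j \<oplus> a \<otimes> x" using a x jc by algebra
  finally have "z \<otimes> b \<in> adjoin J x" unfolding adjoin_def using a ideal_neg[OF J b(2)] by blast
  hence "b \<in> adjoin J x" using nz b unfolding nzd_def by auto
  then obtain j' c where c: "b = j' \<oplus> c \<otimes> x" "j' \<in> J" "c \<in> carrier R" by (auto simp: adjoin_def)
  have j'c: "j' \<in> carrier R" using c ideal_carr[OF J] by auto
  have "x \<otimes> (a \<ominus> c \<otimes> z) = x \<otimes> a \<ominus> x \<otimes> (c \<otimes> z)" using a x c z by algebra
  also have "\<dots> = j \<oplus> j' \<otimes> z" unfolding b(1) c(1) using jc j'c c(3) x z by algebra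
  finally have "x \<otimes> (a \<ominus> c \<otimes> z) \<in> J" using ideal_add[OF J b(2) ideal_mult'[OF J c(2) z]] by simp
  hence "a \<ominus> c \<otimes> z \<in> J" using nx a c z unfolding nzd_def by auto
  moreover have "a = (a \<ominus> c \<otimes> z) \<oplus> c \<otimes> z" using a c z by algebra
  ultimately show "a \<in> adjoin J z" unfolding adjoin_def using c(3) by blast
qed

text \<open>The exact sequence \<open>0 \<rightarrow> R/(J : z) \<rightarrow> R/J \<rightarrow> R/(J + (z)) \<rightarrow> 0\<close>, with \<open>z\<close> as first map: a sequence that is
  regular on both ends is regular in the middle, and the sequence stays exact modulo each of its members.\<close>

lemma weakly_regular_colon:
  assumes "ideal J R" "z \<in> carrier R" "set ys \<subseteq> carrier R" "weakly_regular (colon J z) ys" "weakly_regular (adjoin J z) ys"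
  shows "weakly_regular J ys"
  using assms
proof (induction ys arbitrary: J)
  case (Cons y ys)
  note J = Cons.prems(1) and z = Cons.prems(2)
  have y: "y \<in> carrier R" using Cons.prems by auto
  have n1: "nzd (colon J z) y" and n2: "nzd (adjoin J z) y" using Cons.prems by auto
  have "nzd J y" unfolding nzd_def
  proof (intro ballI impI)
    fix a assume a: "a \<in> carrier R" "y \<otimes> a \<in> J"
    hence "a \<in> adjoin J z" using n2 adjoin_sup[OF J z] unfolding nzd_def by blast
    then obtain j b where b: "a = j \<oplus> b \<otimes> z" "j \<in> J" "b \<in> carrier R" by (auto simp: adjoin_def)
    have jc: "j \<in> carrier R" using b ideal_carr[OF J] by auto
    have "y \<otimes> b \<otimes> z = y \<otimes> a \<ominus> y \<otimes> j" unfolding b(1) using y z b jc by algebra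
    also have "\<dots> \<in> J" by (rule ideal_minus[OF J a(2) ideal_mult[OF J b(2) y]])
    finally have "y \<otimes> b \<in> colon J z" using y b by (simp add: colon_def)
    hence "b \<in> colon J z" using n1 b unfolding nzd_def by blast
    thus "a \<in> J" unfolding b(1) using b ideal_add[OF J] by (auto simp: colon_def)
  qed
  moreover have "weakly_regular (adjoin J y) ys"
  proof (rule Cons.IH)
    have "colon (adjoin J y) z = adjoin (colon J z) y"
    proof (intro equalityI subsetI)
      fix a assume "a \<in> colon (adjoin J y) z"
      hence a: "a \<in> carrier R" "a \<otimes> z \<in> adjoin J y" by (auto simp: colon_def)
      then obtain j b where b: "a \<otimes> z = j \<oplus> b \<otimes> y" "j \<in> J" "b \<in> carrier R" by (auto simp: adjoin_def)
      have jc: "j \<in> carrier R" using b ideal_carr[OF J] by auto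
      have "y \<otimes> b = a \<otimes> z \<ominus> j" unfolding b(1) using y b jc by algebra
      also have "\<dots> = \<ominus> j \<oplus> a \<otimes> z" using a z jc by algebra
      finally have "y \<otimes> b \<in> adjoin J z" unfolding adjoin_def using ideal_neg[OF J b(2)] a by blast
      hence "b \<in> adjoin J z" using n2 b unfolding nzd_def by auto
      then obtain j' c where c: "b = j' \<oplus> c \<otimes> z" "j' \<in> J" "c \<in> carrier R" by (auto simp: adjoin_def)
      have j'c: "j' \<in> carrier R" using c ideal_carr[OF J] by auto
      have "(a \<ominus> c \<otimes> y) \<otimes> z = a \<otimes> z \<ominus> c \<otimes> y \<otimes> z" using a c y z by algebra
      also have "\<dots> = j \<oplus> j' \<otimes> y" unfolding b(1) c(1) using jc j'c c(3) y z by algebra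
      finally have "(a \<ominus> c \<otimes> y) \<otimes> z \<in> J" using ideal_add[OF J b(2) ideal_mult'[OF J c(2) y]] by simp
      hence "a \<ominus> c \<otimes> y \<in> colon J z" using a c y by (simp add: colon_def)
      moreover have "a = (a \<ominus> c \<otimes> y) \<oplus> c \<otimes> y" using a c y by algebra
      ultimately show "a \<in> adjoin (colon J z) y" unfolding adjoin_def using c(3) by blast
    next
      fix a assume "a \<in> adjoin (colon J z) y"
      then obtain j b where b: "a = j \<oplus> b \<otimes> y" "j \<in> carrier R" "j \<otimes> z \<in> J" "b \<in> carrier R"
        by (auto simp: adjoin_def colon_def)
      have "a \<otimes> z = j \<otimes> z \<oplus> (b \<otimes> z) \<otimes> y" unfolding b(1) using b y z by algebra
      hence "a \<otimes> z \<in> adjoin J y" unfolding adjoin_def using b z by blast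
      thus "a \<in> colon (adjoin J y) z" using b y by (simp add: colon_def)
    qed
    thus "weakly_regular (colon (adjoin J y) z) ys" using Cons.prems by simp
    show "weakly_regular (adjoin (adjoin J y) z) ys" using Cons.prems adjoin_comm[OF J z y] by simp
  qed (use Cons.prems adjoin_ideal[OF J y] in auto)
  ultimately show ?case by simp
qed auto

end

locale noeth_cring = cring R + noetherian_ring R for R (structure)
begin

lemma ideal_max:
  assumes "S \<noteq> {}" "\<And>J. J \<in> S \<Longrightarrow> ideal J R"
  shows "\<exists>M\<in>S. \<forall>J\<in>S. M \<subseteq> J \<longrightarrow> J = M"
proof (rule subset_Zorn_nonempty[OF assms(1)])
  fix C assume C: "C \<noteq> {}" "subset.chain S C"
  hence "subset.chain {I. ideal I R} C" using assms(2) by (auto simp: subset_chain_def)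
  from ideal_chain_is_trivial[OF C(1) this] show "\<Union>C \<in> S" using C(2) by (auto simp: subset_chain_def)
qed

lemma ideal_noeth_induct [consumes 1]:
  assumes "ideal J R" "\<And>J. ideal J R \<Longrightarrow> (\<And>K. ideal K R \<Longrightarrow> J \<subset> K \<Longrightarrow> P K) \<Longrightarrow> P J"
  shows "P J"
proof (rule ccontr)
  assume "\<not> P J"
  from ideal_max[of "{J. ideal J R \<and> \<not> P J}"] this assms(1)
  obtain M where M: "ideal M R" "\<not> P M" "\<And>J. ideal J R \<Longrightarrow> \<not> P J \<Longrightarrow> M \<subseteq> J \<Longrightarrow> J = M" by blast
  from M(2) assms(2)[OF M(1)] M(3) show False by blast
qed

text \<open>An ideal which is maximal among the colons \<open>J : w\<close> with \<open>w \<notin> J\<close> is prime.\<close>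

lemma assoc_prime_exists:
  assumes J: "ideal J R" and u: "u \<in> carrier R" "u \<notin> J"
  shows "\<exists>Q. assoc_prime J Q \<and> colon J u \<subseteq> Q"
proof -
  define S where "S = {colon J w | w. w \<in> carrier R \<and> w \<notin> J \<and> colon J u \<subseteq> colon J w}"
  have "S \<noteq> {}" unfolding S_def using u by blast
  moreover have "\<And>K. K \<in> S \<Longrightarrow> ideal K R" unfolding S_def using colon_ideal[OF J] by blast
  ultimately have "\<exists>M\<in>S. \<forall>K\<in>S. M \<subseteq> K \<longrightarrow> K = M" by (rule ideal_max)
  then obtain M where M: "M \<in> S" "\<And>K. K \<in> S \<Longrightarrow> M \<subseteq> K \<Longrightarrow> K = M" by metis
  from M(1) obtain w where w: "M = colon J w" "w \<in> carrier R" "w \<notin> J" "colon J u \<subseteq> colon J w" 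
    unfolding S_def by blast
  have "primeideal M R"
  proof (rule make_prime)
    show "ideal M R" using w colon_ideal[OF J] by blast
    show "\<one> \<notin> M" using w by (simp add: colon_def)
    fix a b assume ab: "a \<in> carrier R" "b \<in> carrier R" "a \<otimes> b \<in> M" "a \<notin> M"
    have sub: "colon J w \<subseteq> colon J (a \<otimes> w)"
    proof
      fix c assume "c \<in> colon J w"
      hence c: "c \<in> carrier R" "c \<otimes> w \<in> J" by (auto simp: colon_def)
      have "c \<otimes> (a \<otimes> w) = a \<otimes> (c \<otimes> w)" using c ab w by algebra
      thus "c \<in> colon J (a \<otimes> w)" using c ab ideal_mult[OF J] by (simp add: colon_def)
    qed
    have "a \<otimes> w \<notin> J" using ab w by (simp add: colon_def)
    hence "colon J (a \<otimes> w) \<in> S" unfolding S_def using sub w(2,4) ab(1) by blast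
    hence "colon J (a \<otimes> w) = M" using M(2) sub w(1) by simp
    moreover have "b \<in> colon J (a \<otimes> w)"
    proof -
      have "b \<otimes> (a \<otimes> w) = (a \<otimes> b) \<otimes> w" using ab w by algebra
      thus ?thesis using ab w by (simp add: colon_def)
    qed
    ultimately show "b \<in> M" by simp
  qed
  thus ?thesis unfolding assoc_prime_def using w by blast
qed

text \<open>Noetherian induction. If \<open>P = J : u\<close>, then an associated prime \<open>J : v\<close> is \<open>P\<close> itself or associated to \<open>J + (u)\<close>:
  it is \<open>P\<close> as soon as some multiple of \<open>v\<close> outside \<open>J\<close> falls into \<open>J + (u)\<close>.\<close>

lemma finite_assoc_prime: "ideal J R \<Longrightarrow> finite {Q. assoc_prime J Q}"
proof (induction rule: ideal_noeth_induct)
  case (1 J)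
  note J = 1(1)
  show ?case
  proof (cases "J = carrier R")
    case True
    have "\<not> assoc_prime J Q" for Q
      unfolding assoc_prime_def True using prime_one by (auto simp: colon_def)
    thus ?thesis by simp
  next
    case False
    hence "\<one> \<notin> J" using J ideal.one_imp_carrier by blast
    then obtain P where P: "assoc_prime J P" using assoc_prime_exists[OF J one_closed] by blast
    then obtain u where u: "u \<in> carrier R" "P = colon J u" "primeideal P R" by (auto simp: assoc_prime_def)
    have uJ: "u \<notin> J" using u prime_one[OF u(3)] by (auto simp: colon_def)
    have K: "ideal (adjoin J u) R" "J \<subset> adjoin J u" using adjoin_ideal[OF J u(1)] adjoin_sup[OF J u(1)] adjoin_gen[OF J u(1)] uJ by auto
    have "{Q. assoc_prime J Q} \<subseteq> insert P {Q. assoc_prime (adjoin J u) Q}"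
    proof
      fix Q assume "Q \<in> {Q. assoc_prime J Q}"
      then obtain v where v: "v \<in> carrier R" "Q = colon J v" "primeideal Q R" by (auto simp: assoc_prime_def)
      show "Q \<in> insert P {Q. assoc_prime (adjoin J u) Q}"
      proof (cases "\<exists>w\<in>carrier R. w \<otimes> v \<in> adjoin J u \<and> w \<otimes> v \<notin> J")
        case True
        then obtain w j e where w: "w \<in> carrier R" "w \<otimes> v = j \<oplus> e \<otimes> u" "j \<in> J" "e \<in> carrier R" "w \<otimes> v \<notin> J"
          by (auto simp: adjoin_def)
        have jc: "j \<in> carrier R" using w ideal_carr[OF J] by auto
        have eP: "e \<notin> P" using w u ideal_add[OF J] by (auto simp: colon_def)
        have wQ: "w \<notin> Q" using w v by (auto simp: colon_def)
        have eq: "(c \<in> Q) = (c \<in> P)" if c: "c \<in> carrier R" for c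
        proof -
          have "c \<in> Q \<longleftrightarrow> c \<otimes> w \<in> Q" using prime_mult[OF v(3)] wQ c w by auto
          also have "\<dots> \<longleftrightarrow> c \<otimes> (w \<otimes> v) \<in> J" using c w v by (simp add: colon_def m_assoc)
          also have "c \<otimes> (w \<otimes> v) = c \<otimes> e \<otimes> u \<oplus> c \<otimes> j" unfolding w(2) using c w(4) u jc by algebra
          also have "c \<otimes> e \<otimes> u \<oplus> c \<otimes> j \<in> J \<longleftrightarrow> c \<otimes> e \<otimes> u \<in> J" 
            using ideal_add_cancel[OF J] ideal_mult[OF J w(3)] c w u by auto
          also have "\<dots> \<longleftrightarrow> c \<otimes> e \<in> P" using u c w by (simp add: colon_def)
          also have "\<dots> \<longleftrightarrow> c \<in> P" using prime_mult[OF u(3)] eP c w by auto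
          finally show ?thesis .
        qed
        have "Q = P" using eq ideal_sub[OF prime_ideal[OF v(3)]] ideal_sub[OF prime_ideal[OF u(3)]] by blast
        thus ?thesis by simp
      next
        case False
        hence "Q = colon (adjoin J u) v" unfolding v(2) colon_def using K(2) by blast
        thus ?thesis using v unfolding assoc_prime_def by blast
      qed
    qed
    thus ?thesis using 1(2)[OF K] finite_subset by blast
  qed
qed

lemma nzdI_assoc_prime:
  assumes J: "ideal J R" and y: "y \<in> carrier R" and "\<And>Q. assoc_prime J Q \<Longrightarrow> y \<notin> Q"
  shows "nzd J y"
  unfolding nzd_def
proof (intro ballI impI, rule ccontr)
  fix a assume a: "a \<in> carrier R" "y \<otimes> a \<in> J" "a \<notin> J"
  from assoc_prime_exists[OF J a(1,3)] obtain Q where "assoc_prime J Q" "colon J a \<subseteq> Q" by blast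
  moreover have "y \<in> colon J a" using a y by (simp add: colon_def)
  ultimately show False using assms(3) by blast
qed

lemma nzd_notin_assoc_prime:
  assumes "ideal J R" and "nzd J y" "assoc_prime J Q"
  shows "y \<notin> Q"
proof
  assume y: "y \<in> Q"
  obtain u where u: "u \<in> carrier R" "Q = colon J u" "primeideal Q R" using assms by (auto simp: assoc_prime_def)
  have "y \<otimes> u \<in> J" using y u by (simp add: colon_def)
  hence "u \<in> J" using assms u unfolding nzd_def by blast
  hence "\<one> \<in> Q" using u by (simp add: colon_def)
  thus False using prime_one u by blast
qed

lemma avoid_product:
  assumes "finite S" "\<And>Q'. Q' \<in> S \<Longrightarrow> ideal Q' R \<and> \<not> Q' \<subseteq> Q" "primeideal Q R"
  shows "\<exists>e\<in>carrier R. e \<notin> Q \<and> (\<forall>Q'\<in>S. e \<in> Q')"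
  using assms(1,2)
proof (induction S)
  case empty thus ?case using prime_one[OF assms(3)] by auto
next
  case (insert P S)
  then obtain e where e: "e \<in> carrier R" "e \<notin> Q" "\<forall>Q'\<in>S. e \<in> Q'" by auto
  obtain f where f: "f \<in> P" "f \<notin> Q" "ideal P R" using insert by blast
  have fc: "f \<in> carrier R" using f ideal_carr by blast
  have "f \<otimes> e \<notin> Q" using prime_mult[OF assms(3)] e f fc by auto
  moreover have "f \<otimes> e \<in> P" using f e ideal_mult' by blast
  moreover have "f \<otimes> e \<in> Q'" if "Q' \<in> S" for Q'
    using ideal_mult[of Q' e f] e(3) fc insert.prems[of Q'] that by simp
  ultimately show ?case using e(1) fc by (intro bexI[of _ "f \<otimes> e"]) auto
qed

text \<open>Induction on the number of primes. The prime that is removed is a minimal one, so that some element lies in all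
  the other primes and not in it; this element corrects a \<open>c\<close> that works for the others.\<close>

lemma prime_avoid_coset:
  assumes "finite S" "\<And>Q. Q \<in> S \<Longrightarrow> primeideal Q R" "ideal B R" "x \<in> carrier R"
    "\<And>Q. Q \<in> S \<Longrightarrow> \<not> (x \<in> Q \<and> B \<subseteq> Q)"
  shows "\<exists>c\<in>B. \<forall>Q\<in>S. x \<oplus> c \<notin> Q"
  using assms(1,2,5)
proof (induction "card S" arbitrary: S rule: less_induct)
  case less
  show ?case
  proof (cases "S = {}")
    case True thus ?thesis using ideal_zero[OF assms(3)] by blast
  next
    case False
    then obtain Q where Q: "Q \<in> S" "\<And>P. P \<in> S \<Longrightarrow> P \<subseteq> Q \<Longrightarrow> P = Q"
      using finite_has_minimal[OF less(2)] by metis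
    have pQ: "primeideal Q R" using less Q by blast
    have "card (S - {Q}) < card S" using less(2) Q(1) by (meson card_Diff1_less)
    from less(1)[OF this] less(2-4) obtain c where c: "c \<in> B" "\<forall>P\<in>S-{Q}. x \<oplus> c \<notin> P" by auto
    have cc: "c \<in> carrier R" using c ideal_carr assms by blast
    show ?thesis
    proof (cases "x \<oplus> c \<in> Q")
      case False thus ?thesis using c by blast
    next
      case True
      have "\<not> B \<subseteq> Q"
      proof
        assume "B \<subseteq> Q"
        hence "x \<in> Q" using True c(1) ideal_add_cancel[OF prime_ideal[OF pQ] assms(4)] by blast
        thus False using less(4)[OF Q(1)] \<open>B \<subseteq> Q\<close> by blast
      qed
      then obtain b where b: "b \<in> B" "b \<notin> Q" by blast
      have bc: "b \<in> carrier R" using b ideal_carr assms by blast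
      obtain e where e: "e \<in> carrier R" "e \<notin> Q" "\<forall>P\<in>S-{Q}. e \<in> P"
        using avoid_product[of "S - {Q}" Q] less(2,3) Q pQ prime_ideal by blast
      have be: "b \<otimes> e \<notin> Q" "\<forall>P\<in>S-{Q}. b \<otimes> e \<in> P" "b \<otimes> e \<in> B"
        using prime_mult[OF pQ] b bc e less(3) ideal_mult prime_ideal ideal_mult'[OF assms(3)] by auto
      have eq: "x \<oplus> (c \<oplus> b \<otimes> e) = (x \<oplus> c) \<oplus> b \<otimes> e" using assms(4) cc bc e by algebra
      have "x \<oplus> (c \<oplus> b \<otimes> e) \<notin> P" if "P \<in> S" for P
      proof (cases "P = Q")
        case True
        have "(x \<oplus> c) \<oplus> b \<otimes> e = b \<otimes> e \<oplus> (x \<oplus> c)" using assms(4) cc bc e by algebra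
        thus ?thesis unfolding eq using True be \<open>x \<oplus> c \<in> Q\<close> ideal_add_cancel[OF prime_ideal[OF pQ], of "b \<otimes> e" "x \<oplus> c"] bc e by auto
      next
        case False
        thus ?thesis unfolding eq using that be c ideal_add_cancel[OF prime_ideal[OF less(3)[OF that]], of "x \<oplus> c" "b \<otimes> e"] assms(4) cc by auto
      qed
      thus ?thesis using c be ideal_add[OF assms(3)] by blast
    qed
  qed
qed

lemma nzd_avoid_coset:
  assumes "finite JS" "\<And>J. J \<in> JS \<Longrightarrow> ideal J R" "ideal B R" "x \<in> carrier R"
    "\<And>J Q. J \<in> JS \<Longrightarrow> assoc_prime J Q \<Longrightarrow> \<not> (x \<in> Q \<and> B \<subseteq> Q)"
  shows "\<exists>c\<in>B. \<forall>J\<in>JS. nzd J (x \<oplus> c)"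
proof -
  have "\<exists>c\<in>B. \<forall>Q\<in>(\<Union>J\<in>JS. {Q. assoc_prime J Q}). x \<oplus> c \<notin> Q"
    using assms finite_assoc_prime by (intro prime_avoid_coset) (auto simp: assoc_prime_def)
  then obtain c where c: "c \<in> B" "\<And>J Q. J \<in> JS \<Longrightarrow> assoc_prime J Q \<Longrightarrow> x \<oplus> c \<notin> Q" by blast
  thus ?thesis using nzdI_assoc_prime assms ideal_carr by (metis add.m_closed)
qed

lemma nzd_avoid:
  assumes "finite JS" "\<And>J. J \<in> JS \<Longrightarrow> ideal J R" "ideal B R"
    "\<And>J Q. J \<in> JS \<Longrightarrow> assoc_prime J Q \<Longrightarrow> \<not> B \<subseteq> Q"
  shows "\<exists>c\<in>B. \<forall>J\<in>JS. nzd J c"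
proof -
  have "\<exists>c\<in>B. \<forall>J\<in>JS. nzd J (\<zero> \<oplus> c)" using assms by (intro nzd_avoid_coset) auto
  thus ?thesis using assms(3) ideal_carr by (metis l_zero)
qed

lemma assoc_prime_exchange:
  assumes J: "ideal J R" and m: "ideal m R" and x: "x \<in> m" and y: "y \<in> m"
    and nx: "nzd J x" and ny: "nzd J y" and Q: "assoc_prime (adjoin J y) Q" "m \<subseteq> Q"
  shows "\<exists>Q. assoc_prime (adjoin J x) Q \<and> m \<subseteq> Q"
proof -
  have mc: "m \<subseteq> carrier R" using m ideal_sub by blast
  have xc: "x \<in> carrier R" "y \<in> carrier R" using x y mc by auto
  obtain u where u: "u \<in> carrier R" "Q = colon (adjoin J y) u" "primeideal Q R" using Q by (auto simp: assoc_prime_def)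
  have "u \<notin> adjoin J y" using u prime_one[OF u(3)] by (auto simp: colon_def)
  moreover have "a \<otimes> u \<in> adjoin J y" if "a \<in> m" for a using that Q u by (auto simp: colon_def)
  ultimately obtain v where v: "v \<in> carrier R" "v \<notin> adjoin J x" "\<forall>a\<in>m. a \<otimes> v \<in> adjoin J x"
    using nzd_exchange[OF J xc(2) x mc ny nx u(1)] by blast
  from assoc_prime_exists[OF adjoin_ideal[OF J xc(1)] v(1,2)] v(3) mc show ?thesis unfolding colon_def by blast
qed

text \<open>Kaplansky's proof: if \<open>x\<close> starts a sequence of length \<open>r + 1\<close> modulo \<open>J\<close>, choose \<open>z\<close> as nonzerodivisor modulo
  \<open>J\<close>, \<open>J + (x)\<close> and \<open>J + (y)\<close> at once, and move from \<open>x\<close> to \<open>z\<close> and from \<open>z\<close> to \<open>y\<close>.\<close>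

lemma has_regular_seq_adjoin:
  assumes "ideal J R" "ideal m R" "has_regular_seq m J (Suc r)" "y \<in> m" "nzd J y"
  shows "has_regular_seq m (adjoin J y) r"
  using assms(1,3-)
proof (induction r arbitrary: J y)
  case (Suc r)
  note J = Suc.prems(1) and m = assms(2) and y = Suc.prems(3,4)
  obtain x where x: "x \<in> m" "nzd J x" "has_regular_seq m (adjoin J x) (Suc r)" using Suc.prems(2) unfolding has_regular_seq_Suc[of m J] by blast
  then obtain x' where x': "x' \<in> m" "nzd (adjoin J x) x'" by (auto simp: has_regular_seq_Suc)
  have xc: "x \<in> carrier R" "y \<in> carrier R" using x y ideal_carr[OF m] by auto
  have i: "ideal (adjoin J x) R" "ideal (adjoin J y) R" using adjoin_ideal[OF J] xc by auto
  have 1: "\<not> m \<subseteq> Q" if "assoc_prime (adjoin J x) Q" for Q using nzd_notin_assoc_prime[OF i(1) x'(2) that] x' by blast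
  have 2: "\<not> m \<subseteq> Q" if "assoc_prime (adjoin J y) Q" for Q
    using assoc_prime_exchange[OF J m x(1) y(1) x(2) y(2) that] 1 by blast
  have 3: "\<not> m \<subseteq> Q" if "assoc_prime J Q" for Q using nzd_notin_assoc_prime[OF J y(2) that] y by blast
  have "\<exists>c\<in>m. \<forall>K\<in>{J, adjoin J x, adjoin J y}. nzd K c"
    using i J m 1 2 3 by (intro nzd_avoid) auto
  then obtain z where z: "z \<in> m" "nzd J z" "nzd (adjoin J x) z" "nzd (adjoin J y) z" by auto
  have zc: "z \<in> carrier R" using z ideal_carr[OF m] by auto
  have iz: "ideal (adjoin J z) R" using adjoin_ideal[OF J zc] .
  have "has_regular_seq m (adjoin (adjoin J x) z) r" using Suc.IH[OF i(1) x(3) z(1,3)] .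
  hence "has_regular_seq m (adjoin (adjoin J z) x) r" using adjoin_comm[OF J xc(1) zc] by simp
  hence "has_regular_seq m (adjoin J z) (Suc r)" using nzd_swap[OF J xc(1) zc x(2) z(3) z(2)] x has_regular_seq_Suc by blast
  hence "has_regular_seq m (adjoin (adjoin J z) y) r" using Suc.IH[OF iz _ y(1)] nzd_swap[OF J xc(2) zc y(2) z(4) z(2)] by blast
  thus ?case using z adjoin_comm[OF J xc(2) zc] has_regular_seq_Suc by auto
qed (simp add: has_regular_seq_0)

text \<open>The first member can be chosen simultaneously for all ideals by prime avoidance; by \<open>has_regular_seq_adjoin\<close> it does
  not matter that it was not the first member of the given sequences.\<close>

lemma common_reg:
  assumes "finite JS" "\<And>J. J \<in> JS \<Longrightarrow> ideal J R \<and> has_regular_seq m J r" "ideal m R"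
  shows "\<exists>ys. length ys = r \<and> set ys \<subseteq> m \<and> (\<forall>J\<in>JS. weakly_regular J ys)"
  using assms(1,2)
proof (induction r arbitrary: JS)
  case (Suc r)
  have "\<exists>c\<in>m. \<forall>J\<in>JS. nzd J c"
  proof (rule nzd_avoid)
    fix J Q assume *: "J \<in> JS" "assoc_prime J Q"
    then obtain x where "x \<in> m" "nzd J x" using Suc.prems(2) has_regular_seq_Suc by blast
    thus "\<not> m \<subseteq> Q" using nzd_notin_assoc_prime Suc.prems * by blast
  qed (use Suc.prems assms(3) in auto)
  then obtain c where c: "c \<in> m" "\<forall>J\<in>JS. nzd J c" by blast
  have cc: "c \<in> carrier R" using c ideal_carr assms by blast
  have "\<exists>ys. length ys = r \<and> set ys \<subseteq> m \<and> (\<forall>K\<in>(\<lambda>J. adjoin J c) ` JS. weakly_regular K ys)"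
    using Suc.prems c cc adjoin_ideal has_regular_seq_adjoin[OF _ assms(3)] by (intro Suc.IH) auto
  then obtain ys where "length ys = r" "set ys \<subseteq> m" "\<forall>J\<in>JS. weakly_regular (adjoin J c) ys" by blast
  thus ?case using c by (intro exI[of _ "c # ys"]) auto
qed simp

end

locale local_noeth = noeth_cring R for R (structure) +
  fixes m
  assumes m_ideal: "ideal m R" and m_proper: "\<one> \<notin> m"
    and m_units: "\<And>x. x \<in> carrier R \<Longrightarrow> x \<notin> m \<Longrightarrow> x \<in> Units R"
begin

lemma m_carr: "m \<subseteq> carrier R" using ideal_sub[OF m_ideal] .

lemma unit_ideal: assumes "ideal J R" "x \<in> J" "x \<in> Units R" shows "\<one> \<in> J"
  using ideal_mult[OF assms(1,2), of "inv x"] assms(3) by simp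

lemma proper_sub_m: "ideal J R \<Longrightarrow> \<one> \<notin> J \<Longrightarrow> J \<subseteq> m"
  using unit_ideal m_units ideal_carr by blast

lemma m_maximal: "maximalideal m R"
proof (rule maximalidealI[OF m_ideal])
  show "carrier R \<noteq> m" using m_proper by auto
  fix J assume "ideal J R" "m \<subseteq> J" "J \<subseteq> carrier R"
  thus "J = m \<or> J = carrier R" using proper_sub_m ideal.one_imp_carrier by blast
qed

lemma m_unique: assumes "maximalideal M R" shows "M = m"
proof -
  interpret M: maximalideal M R by fact
  have "\<one> \<notin> M" using M.I_notcarr M.one_imp_carrier by blast
  hence "M \<subseteq> m" using proper_sub_m M.is_ideal by blast
  thus ?thesis using M.I_maximal[OF m_ideal] m_carr m_proper by auto
qed

lemma m_the: "(THE M. maximalideal M R) = m"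
  by (rule the_equality) (fact m_maximal, rule m_unique)

text \<open>Let \<open>Q = J : u\<close>. Some \<open>w \<notin> J + (x)\<close> must satisfy \<open>Q w \<subseteq> J\<close>: otherwise \<open>u\<close> can be divided by \<open>x\<close> again and again
  modulo \<open>J\<close>, which a Noetherian local ring does not allow. An associated prime of \<open>J + (x)\<close> that contains
  \<open>(J + (x)) : w\<close> then contains \<open>Q\<close> and \<open>x\<close>.\<close>

lemma assoc_prime_extend:
  assumes J: "ideal J R" and x: "x \<in> m" "nzd J x" and Q: "assoc_prime J Q"
  shows "\<exists>Q'. assoc_prime (adjoin J x) Q' \<and> Q \<subset> Q'"
proof -
  have xc: "x \<in> carrier R" using x m_carr by auto
  note aJ = adjoin_ideal[OF J xc]
  obtain u where u: "u \<in> carrier R" "Q = colon J u" "primeideal Q R" using Q by (auto simp: assoc_prime_def)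
  have uJ: "u \<notin> J" using u prime_one[OF u(3)] by (auto simp: colon_def)
  define N where "N = {a \<in> carrier R. \<forall>q\<in>Q. q \<otimes> a \<in> J}"
  have Qc: "Q \<subseteq> carrier R" using ideal_sub[OF prime_ideal[OF u(3)]] .
  have "\<exists>w\<in>N. w \<notin> adjoin J x"
  proof (rule ccontr)
    assume "\<not> ?thesis"
    hence sub: "N \<subseteq> adjoin J x" by blast
    have step: "\<exists>b\<in>N. \<exists>j\<in>J. a = j \<oplus> b \<otimes> x" if a: "a \<in> N" for a
    proof -
      obtain j b where b: "a = j \<oplus> b \<otimes> x" "j \<in> J" "b \<in> carrier R" using sub a by (auto simp: adjoin_def)
      have jc: "j \<in> carrier R" using b ideal_carr[OF J] by auto
      have "q \<otimes> b \<in> J" if q: "q \<in> Q" for q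
      proof -
        have qc: "q \<in> carrier R" using q Qc by auto
        have "x \<otimes> (q \<otimes> b) = q \<otimes> a \<ominus> q \<otimes> j" unfolding b(1) using qc xc b jc by algebra
        also have "\<dots> \<in> J" using a q by (intro ideal_minus[OF J _ ideal_mult[OF J b(2) qc]]) (simp add: N_def)
        finally show ?thesis using x qc b unfolding nzd_def by simp
      qed
      hence "b \<in> N" unfolding N_def using b(3) by simp
      thus ?thesis using b(1,2) by blast
    qed
    then obtain f g where fg: "\<And>a. a \<in> N \<Longrightarrow> f a \<in> N \<and> g a \<in> J \<and> a = g a \<oplus> f a \<otimes> x" by metis
    \<comment> \<open>the successive quotients of \<open>u\<close> by powers of \<open>x\<close>; the ideals \<open>L k\<close> that they generate with \<open>J\<close> become stationary\<close>
    define U where "U k = (f ^^ k) u" for k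
    have U0: "U 0 = u" and US: "U (Suc k) = f (U k)" for k by (auto simp: U_def)
    have UN: "U k \<in> N" for k
      by (induction k) (use u fg in \<open>auto simp: U0 US colon_def N_def\<close>)
    have Uc: "U k \<in> carrier R" for k using UN[of k] by (simp add: N_def)
    have Ustep: "U k = g (U k) \<oplus> U (Suc k) \<otimes> x" "g (U k) \<in> J" for k using fg[OF UN] by (auto simp: US)
    define L where "L k = rec_nat (adjoin J u) (\<lambda>k I. adjoin I (U (Suc k))) k" for k
    have L0: "L 0 = adjoin J u" and LS: "L (Suc k) = adjoin (L k) (U (Suc k))" for k by (auto simp: L_def)
    have Li: "ideal (L k) R" for k by (induction k) (auto simp: L0 LS adjoin_ideal J u Uc)
    have Lm: "L k \<subseteq> L (Suc k)" for k unfolding LS using adjoin_sup[OF Li Uc] .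
    have Lform: "L k \<subseteq> adjoin J (U k)" for k
    proof (induction k)
      case (Suc k)
      have a: "ideal (adjoin J (U (Suc k))) R" using adjoin_ideal[OF J Uc] .
      have "U k \<in> adjoin J (U (Suc k))" 
      proof -
        have "U k = g (U k) \<oplus> x \<otimes> U (Suc k)" using Ustep(1)[of k] m_comm[OF xc Uc[of "Suc k"]] by simp
        thus ?thesis using Ustep(2)[of k] xc unfolding adjoin_def by blast
      qed
      hence "adjoin J (U k) \<subseteq> adjoin J (U (Suc k))" using adjoin_min[OF a] adjoin_sup[OF J Uc] by blast
      thus ?case unfolding LS using Suc adjoin_min[OF a _ adjoin_gen[OF J Uc]] by blast
    qed (simp add: L0 U0)
    have "\<exists>M\<in>range L. \<forall>K\<in>range L. M \<subseteq> K \<longrightarrow> K = M" using Li by (intro ideal_max) auto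
    then obtain M where "M \<in> range L" and M: "\<forall>K\<in>range L. M \<subseteq> K \<longrightarrow> K = M" by (rule bexE)
    then obtain k where "M = L k" by blast
    with M Lm[of k] have k: "L (Suc k) = L k" by simp
    hence "U (Suc k) \<in> adjoin J (U k)" using Lform[of k] adjoin_gen[OF Li[of k] Uc[of "Suc k"]] unfolding LS by auto
    then obtain j c where c: "U (Suc k) = j \<oplus> c \<otimes> U k" "j \<in> J" "c \<in> carrier R" by (auto simp: adjoin_def)
    have jc: "j \<in> carrier R" "g (U k) \<in> carrier R" using c Ustep ideal_carr[OF J] by auto
    have "(\<one> \<ominus> c \<otimes> x) \<otimes> U k = U k \<ominus> (c \<otimes> U k) \<otimes> x" using c Uc xc by algebra
    also have "\<dots> = (g (U k) \<oplus> U (Suc k) \<otimes> x) \<ominus> (c \<otimes> U k) \<otimes> x" using Ustep(1)[of k] by simp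
    also have "\<dots> = g (U k) \<oplus> j \<otimes> x" unfolding c(1) using jc c(3) Uc[of k] xc by algebra
    finally have in1: "(\<one> \<ominus> c \<otimes> x) \<otimes> U k \<in> J" using ideal_add[OF J Ustep(2) ideal_mult'[OF J c(2) xc]] by simp
    have cx: "\<one> \<ominus> c \<otimes> x \<in> carrier R" using c xc by simp
    have "\<one> \<ominus> c \<otimes> x \<notin> m" using ideal_minus_cancel[OF m_ideal one_closed ideal_mult[OF m_ideal x(1) c(3)]] m_proper by simp
    hence un: "\<one> \<ominus> c \<otimes> x \<in> Units R" using m_units cx by blast
    have "U k = inv (\<one> \<ominus> c \<otimes> x) \<otimes> ((\<one> \<ominus> c \<otimes> x) \<otimes> U k)" using un Uc cx by (simp add: m_assoc[symmetric])
    moreover have "inv (\<one> \<ominus> c \<otimes> x) \<otimes> ((\<one> \<ominus> c \<otimes> x) \<otimes> U k) \<in> J" using ideal_mult[OF J in1] un by simp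
    ultimately have UkJ: "U k \<in> J" by metis
    have "U i \<in> J" if "i \<le> k" for i
      using that
    proof (induction rule: inc_induct)
      case (step i)
      show ?case using ideal_add[OF J Ustep(2)[of i] ideal_mult'[OF J step.IH xc]] by (subst Ustep(1))
    qed (rule UkJ)
    from this[of 0] show False using uJ U0 by simp
  qed
  then obtain w where w: "w \<in> carrier R" "\<And>q. q \<in> Q \<Longrightarrow> q \<otimes> w \<in> J" "w \<notin> adjoin J x" unfolding N_def by blast
  from assoc_prime_exists[OF aJ w(1,3)] obtain Q' where Q': "assoc_prime (adjoin J x) Q'" "colon (adjoin J x) w \<subseteq> Q'" by blast
  have "Q \<subseteq> Q'" using Q'(2) w Qc adjoin_sup[OF J xc] by (auto simp: colon_def)
  moreover have "x \<in> Q'" using assoc_prime_sup[OF aJ Q'(1)] adjoin_gen[OF J xc] by blast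
  moreover have "x \<notin> Q" using nzd_notin_assoc_prime[OF J x(2) Q] .
  ultimately show ?thesis using Q' by blast
qed

text \<open>Depth is at most the dimension of \<open>R/Q\<close> for each associated prime \<open>Q\<close>.\<close>

lemma has_regular_seq_chain:
  assumes "ideal J R" "has_regular_seq m J r" "assoc_prime J Q"
  shows "\<exists>ps. prime_chain R ps \<and> length ps = Suc r \<and> hd ps = Q"
  using assms
proof (induction r arbitrary: J Q)
  case 0
  thus ?case by (intro exI[of _ "[Q]"]) (auto simp: prime_chain_def assoc_prime_def)
next
  case (Suc r)
  then obtain x where x: "x \<in> m" "nzd J x" "has_regular_seq m (adjoin J x) r" by (auto simp: has_regular_seq_Suc)
  have xc: "x \<in> carrier R" using x m_carr by auto
  from assoc_prime_extend[OF Suc.prems(1) x(1,2) Suc.prems(3)] obtain Q' where Q': "assoc_prime (adjoin J x) Q'" "Q \<subset> Q'" by blast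
  from Suc.IH[OF adjoin_ideal[OF Suc.prems(1) xc] x(3) Q'(1)] obtain ps where
    ps: "prime_chain R ps" "length ps = Suc r" "hd ps = Q'" by blast
  then obtain qs where qs: "ps = Q' # qs" by (cases ps) auto
  have "prime_chain R (Q # ps)" using ps(1) Q'(2) Suc.prems(3) unfolding prime_chain_def qs assoc_prime_def by auto
  thus ?case using ps by (intro exI[of _ "Q # ps"]) auto
qed

end

section \<open>Localizations and local depth\<close>

locale mult_set = cring R for R (structure) +
  fixes S
  assumes S_carr: "S \<subseteq> carrier R" and S_one: "\<one> \<in> S" and S_mult: "\<And>s t. s \<in> S \<Longrightarrow> t \<in> S \<Longrightarrow> s \<otimes> t \<in> S"
begin

abbreviation "fr \<equiv> loc_frac R S"
abbreviation "LR \<equiv> localization R S"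

lemma S_c: "s \<in> S \<Longrightarrow> s \<in> carrier R" using S_carr by auto

lemma frac_self: "a \<in> carrier R \<Longrightarrow> s \<in> S \<Longrightarrow> (a, s) \<in> fr a s"
  unfolding loc_frac_def using S_one by auto

lemma frac_mem: "(b, t) \<in> fr a s \<longleftrightarrow> b \<in> carrier R \<and> t \<in> S \<and> (\<exists>u\<in>S. u \<otimes> (t \<otimes> a) = u \<otimes> (s \<otimes> b))"
  unfolding loc_frac_def by auto

lemma frac_sub:
  assumes a: "a \<in> carrier R" "s \<in> S" and b: "(b, t) \<in> fr a s"
  shows "fr b t \<subseteq> fr a s"
proof clarify
  fix c r assume c: "(c, r) \<in> fr b t"
  obtain u where u: "u \<in> S" "u \<otimes> (t \<otimes> a) = u \<otimes> (s \<otimes> b)" "b \<in> carrier R" "t \<in> S" using b by (auto simp: frac_mem)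
  obtain v where v: "v \<in> S" "v \<otimes> (r \<otimes> b) = v \<otimes> (t \<otimes> c)" "c \<in> carrier R" "r \<in> S" using c by (auto simp: frac_mem)
  note cs = a(1) S_c[OF a(2)] u(3) S_c[OF u(4)] S_c[OF u(1)] S_c[OF v(1)] v(3) S_c[OF v(4)]
  have "(u \<otimes> v \<otimes> t) \<otimes> (r \<otimes> a) = v \<otimes> r \<otimes> (u \<otimes> (t \<otimes> a))" using cs by algebra
  also have "\<dots> = u \<otimes> s \<otimes> (v \<otimes> (r \<otimes> b))" unfolding u(2) using cs by algebra
  also have "\<dots> = (u \<otimes> v \<otimes> t) \<otimes> (s \<otimes> c)" unfolding v(2) using cs by algebra
  finally show "(c, r) \<in> fr a s" unfolding frac_mem using u v S_mult by blast
qed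

lemma frac_sym:
  assumes a: "a \<in> carrier R" "s \<in> S" and b: "(b, t) \<in> fr a s"
  shows "(a, s) \<in> fr b t"
  using b a unfolding frac_mem by metis

lemma frac_eq_mem:
  assumes a: "a \<in> carrier R" "s \<in> S" and b: "(b, t) \<in> fr a s"
  shows "fr b t = fr a s"
proof -
  have bt: "b \<in> carrier R" "t \<in> S" using b by (auto simp: frac_mem)
  show ?thesis using frac_sub[OF a b] frac_sub[OF bt frac_sym[OF a b]] by blast
qed

lemma frac_eq:
  assumes "a \<in> carrier R" "s \<in> S" "b \<in> carrier R" "t \<in> S"
  shows "fr a s = fr b t \<longleftrightarrow> (\<exists>u\<in>S. u \<otimes> (t \<otimes> a) = u \<otimes> (s \<otimes> b))"
  using frac_eq_mem[of a s b t] frac_self[of b t] assms by (metis frac_mem)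

lemma frac_eq1:
  assumes "a \<in> carrier R" "s \<in> S" "b \<in> carrier R" "t \<in> S" "t \<otimes> a = s \<otimes> b"
  shows "fr a s = fr b t"
  unfolding frac_eq[OF assms(1-4)] using assms(5) S_one by auto

lemma localization_carrier: "carrier LR = {fr a s | a s. a \<in> carrier R \<and> s \<in> S}"
  by (simp add: localization_def)

lemma frac_carr: "a \<in> carrier R \<Longrightarrow> s \<in> S \<Longrightarrow> fr a s \<in> carrier LR"
  unfolding localization_carrier by blast

lemma localization_one: "\<one>\<^bsub>LR\<^esub> = fr \<one> \<one>" by (simp add: localization_def)
lemma localization_zero: "\<zero>\<^bsub>LR\<^esub> = fr \<zero> \<one>" by (simp add: localization_def)

text \<open>The operations of the localization are unions over all representatives; they collapse as soon as the
  value does not depend on the representatives.\<close>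

lemma localization_union:
  assumes a: "a \<in> carrier R" "s \<in> S" and b: "b \<in> carrier R" "t \<in> S"
    and *: "\<And>a' s' b' t'. (a', s') \<in> fr a s \<Longrightarrow> (b', t') \<in> fr b t \<Longrightarrow> f a' s' b' t' = f a s b t"
  shows "(\<Union>(a, s)\<in>fr a s. \<Union>(b, t)\<in>fr b t. f a s b t) = f a s b t"
proof -
  have 1: "(\<Union>(b', t')\<in>fr b t. f a' s' b' t') = f a s b t" if "(a', s') \<in> fr a s" for a' s'
  proof -
    have "(\<Union>q\<in>fr b t. case q of (b', t') \<Rightarrow> f a' s' b' t') = (\<Union>q\<in>fr b t. f a s b t)"
      by (rule SUP_cong) (use that * in auto)
    thus ?thesis using frac_self[OF b] by auto
  qed
  have "(\<Union>p\<in>fr a s. case p of (a', s') \<Rightarrow> \<Union>(b', t')\<in>fr b t. f a' s' b' t') = (\<Union>p\<in>fr a s. f a s b t)"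
    by (rule SUP_cong) (use 1 in auto)
  thus ?thesis using frac_self[OF a] by auto
qed

lemma localization_mult:
  assumes a: "a \<in> carrier R" "s \<in> S" and b: "b \<in> carrier R" "t \<in> S"
  shows "fr a s \<otimes>\<^bsub>LR\<^esub> fr b t = fr (a \<otimes> b) (s \<otimes> t)"
proof -
  have "fr (a' \<otimes> b') (s' \<otimes> t') = fr (a \<otimes> b) (s \<otimes> t)" 
    if a': "(a', s') \<in> fr a s" and b': "(b', t') \<in> fr b t" for a' s' b' t'
  proof (rule frac_eq_mem)
    obtain u where u: "u \<in> S" "u \<otimes> (s' \<otimes> a) = u \<otimes> (s \<otimes> a')" "a' \<in> carrier R" "s' \<in> S" using a' by (auto simp: frac_mem)
    obtain v where v: "v \<in> S" "v \<otimes> (t' \<otimes> b) = v \<otimes> (t \<otimes> b')" "b' \<in> carrier R" "t' \<in> S" using b' by (auto simp: frac_mem)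
    note cs = a(1) S_c[OF a(2)] b(1) S_c[OF b(2)] u(3) v(3) S_c[OF u(4)] S_c[OF u(1)] S_c[OF v(1)] S_c[OF v(4)]
    have "(u \<otimes> v) \<otimes> (s' \<otimes> t' \<otimes> (a \<otimes> b)) = (u \<otimes> (s' \<otimes> a)) \<otimes> (v \<otimes> (t' \<otimes> b))" using cs by algebra
    also have "\<dots> = (u \<otimes> v) \<otimes> (s \<otimes> t \<otimes> (a' \<otimes> b'))" unfolding u(2) v(2) using cs by algebra
    finally show "(a' \<otimes> b', s' \<otimes> t') \<in> fr (a \<otimes> b) (s \<otimes> t)" unfolding frac_mem using u v S_mult m_closed by blast
  qed (use a b S_mult in auto)
  from localization_union[OF a b, where f = "\<lambda>a s b t. fr (a \<otimes> b) (s \<otimes> t)", OF this]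
  show ?thesis by (simp add: localization_def)
qed

lemma localization_add:
  assumes a: "a \<in> carrier R" "s \<in> S" and b: "b \<in> carrier R" "t \<in> S"
  shows "fr a s \<oplus>\<^bsub>LR\<^esub> fr b t = fr (a \<otimes> t \<oplus> b \<otimes> s) (s \<otimes> t)"
proof -
  have "fr (a' \<otimes> t' \<oplus> b' \<otimes> s') (s' \<otimes> t') = fr (a \<otimes> t \<oplus> b \<otimes> s) (s \<otimes> t)" 
    if a': "(a', s') \<in> fr a s" and b': "(b', t') \<in> fr b t" for a' s' b' t'
  proof (rule frac_eq_mem)
    obtain u where u: "u \<in> S" "u \<otimes> (s' \<otimes> a) = u \<otimes> (s \<otimes> a')" "a' \<in> carrier R" "s' \<in> S" using a' by (auto simp: frac_mem)
    obtain v where v: "v \<in> S" "v \<otimes> (t' \<otimes> b) = v \<otimes> (t \<otimes> b')" "b' \<in> carrier R" "t' \<in> S" using b' by (auto simp: frac_mem)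
    note cs = a(1) S_c[OF a(2)] b(1) S_c[OF b(2)] u(3) v(3) S_c[OF u(4)] S_c[OF u(1)] S_c[OF v(1)] S_c[OF v(4)]
    have "(u \<otimes> v) \<otimes> (s' \<otimes> t' \<otimes> (a \<otimes> t \<oplus> b \<otimes> s)) = v \<otimes> t' \<otimes> t \<otimes> (u \<otimes> (s' \<otimes> a)) \<oplus> u \<otimes> s' \<otimes> s \<otimes> (v \<otimes> (t' \<otimes> b))" using cs by algebra
    also have "\<dots> = (u \<otimes> v) \<otimes> (s \<otimes> t \<otimes> (a' \<otimes> t' \<oplus> b' \<otimes> s'))" unfolding u(2) v(2) using cs by algebra
    finally show "(a' \<otimes> t' \<oplus> b' \<otimes> s', s' \<otimes> t') \<in> fr (a \<otimes> t \<oplus> b \<otimes> s) (s \<otimes> t)" 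
      unfolding frac_mem using u v S_mult cs m_closed a_closed by blast
  qed (use a b S_mult S_c in auto)
  from localization_union[OF a b, where f = "\<lambda>a s b t. fr (a \<otimes> t \<oplus> b \<otimes> s) (s \<otimes> t)", OF this]
  show ?thesis by (simp add: localization_def)
qed

lemma localization_elim:
  assumes "x \<in> carrier LR" obtains a s where "x = fr a s" "a \<in> carrier R" "s \<in> S"
  using assms unfolding localization_carrier by blast

lemma localization_cring: "cring LR"
proof (rule cringI)
  show "abelian_group LR"
  proof (rule abelian_groupI)
    fix x y assume "x \<in> carrier LR" "y \<in> carrier LR"
    then obtain a s b t where e: "x = fr a s" "y = fr b t" and c: "a \<in> carrier R" "s \<in> S" "b \<in> carrier R" "t \<in> S"
      by (metis localization_elim)
    show "x \<oplus>\<^bsub>LR\<^esub> y \<in> carrier LR" unfolding e using c S_c S_mult by (simp add: localization_add frac_carr)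
    show "x \<oplus>\<^bsub>LR\<^esub> y = y \<oplus>\<^bsub>LR\<^esub> x" unfolding e using c S_c 
      by (simp add: localization_add m_comm[of s t] a_comm)
  next
    fix x y z assume "x \<in> carrier LR" "y \<in> carrier LR" "z \<in> carrier LR"
    then obtain a s b t c r where e: "x = fr a s" "y = fr b t" "z = fr c r" 
      and c: "a \<in> carrier R" "s \<in> S" "b \<in> carrier R" "t \<in> S" "c \<in> carrier R" "r \<in> S"
      by (metis localization_elim)
    note cs = c S_c[OF c(2)] S_c[OF c(4)] S_c[OF c(6)]
    have n: "(a \<otimes> t \<oplus> b \<otimes> s) \<otimes> r \<oplus> c \<otimes> (s \<otimes> t) = a \<otimes> (t \<otimes> r) \<oplus> (b \<otimes> r \<oplus> c \<otimes> t) \<otimes> s"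
      using cs by algebra
    show "x \<oplus>\<^bsub>LR\<^esub> y \<oplus>\<^bsub>LR\<^esub> z = x \<oplus>\<^bsub>LR\<^esub> (y \<oplus>\<^bsub>LR\<^esub> z)" unfolding e using cs S_mult 
      by (simp add: localization_add n m_assoc)
  next
    show "\<zero>\<^bsub>LR\<^esub> \<in> carrier LR" unfolding localization_zero using S_one by (simp add: frac_carr)
    fix x assume "x \<in> carrier LR"
    then obtain a s where e: "x = fr a s" and c: "a \<in> carrier R" "s \<in> S" by (metis localization_elim)
    note cs = c S_c[OF c(2)]
    show "\<zero>\<^bsub>LR\<^esub> \<oplus>\<^bsub>LR\<^esub> x = x" unfolding e localization_zero using cs S_one by (simp add: localization_add)
    have "fr (\<ominus> a) s \<oplus>\<^bsub>LR\<^esub> x = \<zero>\<^bsub>LR\<^esub>"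
    proof -
      have 1: "\<ominus> a \<otimes> s \<oplus> a \<otimes> s = \<zero>" using cs by algebra
      have 2: "fr \<zero> (s \<otimes> s) = fr \<zero> \<one>" using cs S_one S_mult by (intro frac_eq1) auto
      show ?thesis unfolding e localization_zero using cs S_one by (simp add: localization_add 1 2)
    qed
    thus "\<exists>y\<in>carrier LR. y \<oplus>\<^bsub>LR\<^esub> x = \<zero>\<^bsub>LR\<^esub>" using cs frac_carr by blast
  qed
  show "comm_monoid LR"
  proof (rule comm_monoidI)
    fix x y assume "x \<in> carrier LR" "y \<in> carrier LR"
    then obtain a s b t where e: "x = fr a s" "y = fr b t" and c: "a \<in> carrier R" "s \<in> S" "b \<in> carrier R" "t \<in> S"
      by (metis localization_elim)
    show "x \<otimes>\<^bsub>LR\<^esub> y \<in> carrier LR" unfolding e using c S_c S_mult by (simp add: localization_mult frac_carr)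
    show "x \<otimes>\<^bsub>LR\<^esub> y = y \<otimes>\<^bsub>LR\<^esub> x" unfolding e using c S_c 
      by (simp add: localization_mult m_comm)
  next
    fix x y z assume "x \<in> carrier LR" "y \<in> carrier LR" "z \<in> carrier LR"
    then obtain a s b t c r where e: "x = fr a s" "y = fr b t" "z = fr c r" 
      and c: "a \<in> carrier R" "s \<in> S" "b \<in> carrier R" "t \<in> S" "c \<in> carrier R" "r \<in> S"
      by (metis localization_elim)
    note cs = c S_c[OF c(2)] S_c[OF c(4)] S_c[OF c(6)]
    show "x \<otimes>\<^bsub>LR\<^esub> y \<otimes>\<^bsub>LR\<^esub> z = x \<otimes>\<^bsub>LR\<^esub> (y \<otimes>\<^bsub>LR\<^esub> z)" unfolding e using cs S_mult 
      by (simp add: localization_mult m_assoc)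
  next
    show "\<one>\<^bsub>LR\<^esub> \<in> carrier LR" unfolding localization_one using S_one by (simp add: frac_carr)
    fix x assume "x \<in> carrier LR"
    then obtain a s where e: "x = fr a s" and c: "a \<in> carrier R" "s \<in> S" by (metis localization_elim)
    note cs = c S_c[OF c(2)]
    show "\<one>\<^bsub>LR\<^esub> \<otimes>\<^bsub>LR\<^esub> x = x" unfolding e localization_one using cs S_one by (simp add: localization_mult)
  qed
  fix x y z assume "x \<in> carrier LR" "y \<in> carrier LR" "z \<in> carrier LR"
  then obtain a s b t c r where e: "x = fr a s" "y = fr b t" "z = fr c r" 
    and c: "a \<in> carrier R" "s \<in> S" "b \<in> carrier R" "t \<in> S" "c \<in> carrier R" "r \<in> S"
    by (metis localization_elim)
  note cs = c S_c[OF c(2)] S_c[OF c(4)] S_c[OF c(6)]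
  have n: "s \<otimes> r \<otimes> (t \<otimes> r) \<otimes> ((a \<otimes> t \<oplus> b \<otimes> s) \<otimes> c) = s \<otimes> t \<otimes> r \<otimes> (a \<otimes> c \<otimes> (t \<otimes> r) \<oplus> b \<otimes> c \<otimes> (s \<otimes> r))"
    using cs by algebra
  show "(x \<oplus>\<^bsub>LR\<^esub> y) \<otimes>\<^bsub>LR\<^esub> z = x \<otimes>\<^bsub>LR\<^esub> z \<oplus>\<^bsub>LR\<^esub> y \<otimes>\<^bsub>LR\<^esub> z" unfolding e using cs S_mult 
    by (simp add: localization_mult localization_add) (intro frac_eq1, auto simp: n S_mult)
qed

lemma localization_hom: "(\<lambda>a. fr a \<one>) \<in> ring_hom R LR"
  using S_one by (intro ring_hom_memI) (auto simp: frac_carr localization_mult localization_add localization_one)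

lemma frac_unit: assumes "s \<in> S" shows "fr s \<one> \<in> Units LR"
proof -
  interpret L: cring LR by (rule localization_cring)
  have "fr \<one> s \<otimes>\<^bsub>LR\<^esub> fr s \<one> = \<one>\<^bsub>LR\<^esub>" unfolding localization_one
    using assms S_one S_c[OF assms] by (simp add: localization_mult) (intro frac_eq1, auto)
  moreover have c: "fr \<one> s \<in> carrier LR" "fr s \<one> \<in> carrier LR" using assms S_one S_c[OF assms] frac_carr by auto
  moreover have "fr s \<one> \<otimes>\<^bsub>LR\<^esub> fr \<one> s = fr \<one> s \<otimes>\<^bsub>LR\<^esub> fr s \<one>" using L.m_comm c by blast
  ultimately show ?thesis unfolding Units_def by auto
qed

lemma frac_repr: assumes "a \<in> carrier R" "s \<in> S" shows "fr s \<one> \<otimes>\<^bsub>LR\<^esub> fr a s = fr a \<one>"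
  using assms S_one S_c[OF assms(2)] by (simp add: localization_mult) (intro frac_eq1, auto)

lemma frac_zero_iff: assumes "a \<in> carrier R" shows "fr a \<one> = \<zero>\<^bsub>LR\<^esub> \<longleftrightarrow> (\<exists>u\<in>S. u \<otimes> a = \<zero>)"
  unfolding localization_zero using assms S_one S_c by (subst frac_eq) auto

end

context cring
begin

lemma weakly_regular_Idl: "S \<subseteq> carrier R \<Longrightarrow> set xs \<subseteq> carrier R \<Longrightarrow> weakly_regular (Idl S) xs \<longleftrightarrow> 
   (\<forall>i<length xs. nzd (Idl (S \<union> set (take i xs))) (xs ! i))"
proof (induction xs arbitrary: S)
  case (Cons x xs)
  have "weakly_regular (Idl S) (x # xs) \<longleftrightarrow> nzd (Idl S) x \<and> weakly_regular (Idl (insert x S)) xs"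
    using adjoin_Idl Cons.prems by simp
  also have "weakly_regular (Idl (insert x S)) xs \<longleftrightarrow> (\<forall>i<length xs. nzd (Idl (insert x S \<union> set (take i xs))) (xs ! i))"
    using Cons by (intro Cons.IH) auto
  finally show ?case by (auto simp: less_Suc_eq_0_disj)
qed simp

lemma Idl_empty: "Idl {} = {\<zero>}"
proof
  have "Idl {} \<subseteq> Idl {\<zero>}" by (intro Idl_subset_ideal' subset_Idl_subset) auto
  show "Idl {} \<subseteq> {\<zero>}" by (rule genideal_minimal[OF zeroideal]) simp
  show "{\<zero>} \<subseteq> Idl {}" using ideal_zero[OF genideal_ideal[of "{}"]] by simp
qed

lemma regular_sequence_iff: "regular_sequence R xs \<longleftrightarrow> set xs \<subseteq> carrier R \<and> Idl (set xs) \<noteq> carrier R \<and> weakly_regular {\<zero>} xs"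
proof (cases "set xs \<subseteq> carrier R")
  case True
  have "weakly_regular {\<zero>} xs \<longleftrightarrow> (\<forall>i<length xs. nzd (Idl (set (take i xs))) (xs ! i))"
    using weakly_regular_Idl[of "{}" xs] True by (simp add: Idl_empty)
  thus ?thesis unfolding regular_sequence_def nzd_def by simp
qed (simp add: regular_sequence_def)

definition adjoin_list where "adjoin_list J ys = foldl adjoin J ys"

lemma adjoin_list_simps: "adjoin_list J [] = J" "adjoin_list J (y # ys) = adjoin_list (adjoin J y) ys" by (auto simp: adjoin_list_def)

lemma adjoin_list_props: "ideal J R \<Longrightarrow> set ys \<subseteq> carrier R \<Longrightarrow> ideal (adjoin_list J ys) R \<and> J \<subseteq> adjoin_list J ys \<and> set ys \<subseteq> adjoin_list J ys"
proof (induction ys arbitrary: J)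
  case (Cons y ys)
  hence y: "y \<in> carrier R" by auto
  show ?case using Cons.IH[OF adjoin_ideal[OF Cons.prems(1) y]] adjoin_sup[OF Cons.prems(1) y] adjoin_gen[OF Cons.prems(1) y] Cons.prems
    by (auto simp: adjoin_list_simps)
qed (simp add: adjoin_list_simps)

lemma adjoin_list_min: "ideal J R \<Longrightarrow> ideal K R \<Longrightarrow> J \<subseteq> K \<Longrightarrow> set ys \<subseteq> K \<Longrightarrow> adjoin_list J ys \<subseteq> K"
proof (induction ys arbitrary: J)
  case (Cons y ys)
  hence "y \<in> carrier R" using ideal_carr by auto
  thus ?case using Cons adjoin_min[of K J y] adjoin_ideal[of J y] by (auto simp: adjoin_list_simps)
qed (simp add: adjoin_list_simps)

lemma krull_dim_ge: "prime_chain R ps \<Longrightarrow> length ps = Suc r \<Longrightarrow> enat r \<le> krull_dim R"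
  unfolding krull_dim_def by (intro Sup_upper) force

end

context local_noeth
begin

text \<open>Changing \<open>f\<close> by a combination of the remaining generators does not change the ideal. No associated prime
  contains all the remaining generators, because the chains above such a prime would be too long; so the change can
  make \<open>f\<close> a nonzerodivisor. Hence the ideal has a regular sequence as generators, although \<open>fs\<close> itself need not be one.\<close>

lemma regular_generators:
  assumes "ideal J R" "has_regular_seq m J r" "set fs \<subseteq> m"
    "\<And>ps. prime_chain R ps \<Longrightarrow> J \<subseteq> hd ps \<Longrightarrow> set fs \<subseteq> hd ps \<Longrightarrow> length ps + length fs \<le> Suc r"
  shows "has_regular_seq m (adjoin_list J fs) (r - length fs)"
  using assms
proof (induction fs arbitrary: J r)
  case (Cons f fs)
  note J = Cons.prems(1)
  have fc: "f \<in> carrier R" "set fs \<subseteq> carrier R" using Cons.prems m_carr by auto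
  define B where "B = Idl (set fs)"
  have B: "ideal B R" "set fs \<subseteq> B" unfolding B_def using fc genideal_ideal genideal_self by auto
  have Bm: "B \<subseteq> m" unfolding B_def using Cons.prems(3) by (intro genideal_minimal[OF m_ideal]) auto
  have no: "\<not> (f \<in> Q \<and> B \<subseteq> Q)" if Q: "assoc_prime J Q" for Q
  proof
    assume *: "f \<in> Q \<and> B \<subseteq> Q"
    from has_regular_seq_chain[OF J Cons.prems(2) Q] obtain ps where ps: "prime_chain R ps" "length ps = Suc r" "hd ps = Q" by blast
    with Cons.prems(4)[OF ps(1)] assoc_prime_sup[OF J Q] * B(2) show False by auto
  qed
  have "\<exists>c\<in>B. \<forall>K\<in>{J}. nzd K (f \<oplus> c)" using J B(1) fc no by (intro nzd_avoid_coset) auto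
  then obtain c where c: "c \<in> B" "nzd J (f \<oplus> c)" by blast
  have cc: "c \<in> carrier R" using c B ideal_carr by blast
  have gm: "f \<oplus> c \<in> m" using Cons.prems(3) c Bm ideal_add[OF m_ideal] by auto
  have gc: "f \<oplus> c \<in> carrier R" using fc cc by simp
  show ?case
  proof (cases r)
    case (Suc r')
    note J' = adjoin_ideal[OF J gc]
    have "has_regular_seq m (adjoin_list (adjoin J (f \<oplus> c)) fs) (r' - length fs)"
    proof (rule Cons.IH[OF J'])
      show "has_regular_seq m (adjoin J (f \<oplus> c)) r'" using has_regular_seq_adjoin[OF J m_ideal _ gm c(2)] Cons.prems(2) Suc by simp
      show "set fs \<subseteq> m" using Cons.prems by simp
      fix ps assume ps: "prime_chain R ps" "adjoin J (f \<oplus> c) \<subseteq> hd ps" "set fs \<subseteq> hd ps"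
      have pr: "primeideal (hd ps) R" using ps(1) by (cases ps) (auto simp: prime_chain_def)
      have "B \<subseteq> hd ps" unfolding B_def using ps(3) by (rule genideal_minimal[OF prime_ideal[OF pr]])
      hence "f \<in> hd ps" using ideal_add_cancel[OF prime_ideal[OF pr] fc(1), of c] c(1) adjoin_gen[OF J gc] ps(2) by blast
      thus "length ps + length fs \<le> Suc r'" using Cons.prems(4)[OF ps(1)] ps adjoin_sup[OF J gc] Suc by auto
    qed
    moreover have "adjoin_list (adjoin J (f \<oplus> c)) fs = adjoin_list J (f # fs)"
    proof (rule equalityI)
      note 1 = adjoin_list_props[OF J', of fs] and 2 = adjoin_list_props[OF J, of "f # fs"]
      have i1: "ideal (adjoin_list (adjoin J (f \<oplus> c)) fs) R" and i2: "ideal (adjoin_list J (f # fs)) R" using 1 2 fc by auto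
      have "B \<subseteq> adjoin_list (adjoin J (f \<oplus> c)) fs" unfolding B_def using 1 fc by (intro genideal_minimal[OF i1]) auto
      hence "f \<in> adjoin_list (adjoin J (f \<oplus> c)) fs" using ideal_add_cancel[OF i1 fc(1), of c] c(1) adjoin_gen[OF J gc] 1 fc by blast
      thus "adjoin_list J (f # fs) \<subseteq> adjoin_list (adjoin J (f \<oplus> c)) fs" using 1 fc adjoin_sup[OF J gc] by (intro adjoin_list_min[OF J i1]) auto
      have "B \<subseteq> adjoin_list J (f # fs)" unfolding B_def using 2 fc by (intro genideal_minimal[OF i2]) auto
      hence "f \<oplus> c \<in> adjoin_list J (f # fs)" using ideal_add[OF i2] c(1) 2 fc by auto
      hence "adjoin J (f \<oplus> c) \<subseteq> adjoin_list J (f # fs)" using 2 fc by (intro adjoin_min[OF i2]) auto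
      thus "adjoin_list (adjoin J (f \<oplus> c)) fs \<subseteq> adjoin_list J (f # fs)" using 2 fc by (intro adjoin_list_min[OF J' i2]) auto
    qed
    ultimately show ?thesis using Suc by simp
  qed (simp add: has_regular_seq_0)
qed (simp add: adjoin_list_simps)

lemma m_sub_proper: assumes "S \<subseteq> m" shows "Idl S \<noteq> carrier R"
  using genideal_minimal[OF m_ideal assms] m_proper by auto

lemma depth_ge: assumes "has_regular_seq m {\<zero>} r" shows "enat r \<le> local_depth R"
proof -
  obtain ys where ys: "length ys = r" "set ys \<subseteq> m" "weakly_regular {\<zero>} ys" using assms by (auto simp: has_regular_seq_def)
  hence "regular_sequence R ys" using m_carr m_sub_proper by (auto simp: regular_sequence_iff)
  thus ?thesis unfolding local_depth_def m_the using ys by (intro Sup_upper) auto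
qed

lemma depth_geD: assumes "enat r \<le> local_depth R" shows "has_regular_seq m {\<zero>} r"
proof (rule ccontr)
  assume n: "\<not> has_regular_seq m {\<zero>} r"
  hence "r \<noteq> 0" using has_regular_seq_0 by metis
  have "local_depth R \<le> enat (r - 1)" unfolding local_depth_def m_the
  proof (rule Sup_least)
    fix e assume "e \<in> {enat (length xs) | xs. regular_sequence R xs \<and> set xs \<subseteq> m}"
    then obtain xs where xs: "e = enat (length xs)" "weakly_regular {\<zero>} xs" "set xs \<subseteq> m" by (auto simp: regular_sequence_iff)
    hence "has_regular_seq m {\<zero>} (length xs)" unfolding has_regular_seq_def by blast
    hence "length xs < r" using n has_regular_seq_le by (metis not_le)
    thus "e \<le> enat (r - 1)" using xs by simp
  qed
  hence "enat r \<le> enat (r - 1)" using assms order_trans by blast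
  thus False using \<open>r \<noteq> 0\<close> by simp
qed

lemma reg_le_dim: assumes "has_regular_seq m {\<zero>} r" shows "enat r \<le> krull_dim R"
proof -
  have "\<one> \<notin> {\<zero>}" using m_proper ideal_zero[OF m_ideal] by auto
  then obtain Q where "assoc_prime {\<zero>} Q" using assoc_prime_exists[OF zeroideal one_closed] by blast
  from has_regular_seq_chain[OF zeroideal assms this] show ?thesis using krull_dim_ge by blast
qed

lemma local_ring_R: "local_ring R"
  unfolding local_ring_def using is_cring m_maximal m_unique by blast

text \<open>\<open>depth \<le> dim\<close> holds in every Noetherian local ring, by \<open>has_regular_seq_chain\<close>.\<close>

lemma cohen_macaulayI: assumes "krull_dim R \<le> enat r" "has_regular_seq m {\<zero>} r" shows "local_cohen_macaulay R"
  unfolding local_cohen_macaulay_def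
proof (intro conjI)
  show "local_ring R" by (rule local_ring_R)
  show "noetherian_ring R" by (rule noetherian_ring_axioms)
  have "krull_dim R \<le> local_depth R" using assms depth_ge order_trans by blast
  moreover have "local_depth R \<le> krull_dim R"
  proof (cases "local_depth R")
    case (enat k)
    thus ?thesis using depth_geD[of k] reg_le_dim[of k] by simp
  next
    case infinity
    hence "has_regular_seq m {\<zero>} (Suc r)" by (intro depth_geD) simp
    hence "enat (Suc r) \<le> enat r" using reg_le_dim assms(1) order_trans by blast
    thus ?thesis by simp
  qed
  ultimately show "local_depth R = krull_dim R" by simp
qed

end

section \<open>Ideals of a localized quotient\<close>

text \<open>\<open>A\<close> plays the role of \<open>(R/I0)\<^sub>m\<close>. Only the homomorphism \<open>\<phi>\<close> and the fact that every element of \<open>A\<close> is a fraction are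
  used, so that no computation ever meets the equivalence classes.\<close>

locale localized_ring = R: cring R + A: cring A
  for R :: "('a, 'm) ring_scheme" and A :: "('b, 'n) ring_scheme" +
  fixes \<phi> :: "'a \<Rightarrow> 'b" and m :: "'a set" and I0 :: "'a set"
  assumes hom: "\<phi> \<in> ring_hom R A"
    and m_prime: "primeideal m R"
    and I0: "ideal I0 R" "I0 \<subseteq> m"
    and unit: "\<And>s. s \<in> carrier R \<Longrightarrow> s \<notin> m \<Longrightarrow> \<phi> s \<in> Units A"
    and surj: "\<And>x. x \<in> carrier A \<Longrightarrow> \<exists>r\<in>carrier R. \<exists>s\<in>carrier R - m. \<phi> s \<otimes>\<^bsub>A\<^esub> x = \<phi> r"
    and ker: "\<And>a. a \<in> carrier R \<Longrightarrow> \<phi> a = \<zero>\<^bsub>A\<^esub> \<longleftrightarrow> (\<exists>t\<in>carrier R - m. t \<otimes>\<^bsub>R\<^esub> a \<in> I0)"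
begin

lemma hom_cring: "ring_hom_cring R A \<phi>"
  by (intro ring_hom_cringI R.is_cring A.is_cring) (simp add: ring_hom_ringI2 R.ring_axioms A.ring_axioms hom)

lemma phi [simp]: 
  "a \<in> carrier R \<Longrightarrow> \<phi> a \<in> carrier A"
  "a \<in> carrier R \<Longrightarrow> b \<in> carrier R \<Longrightarrow> \<phi> (a \<otimes>\<^bsub>R\<^esub> b) = \<phi> a \<otimes>\<^bsub>A\<^esub> \<phi> b"
  "a \<in> carrier R \<Longrightarrow> b \<in> carrier R \<Longrightarrow> \<phi> (a \<oplus>\<^bsub>R\<^esub> b) = \<phi> a \<oplus>\<^bsub>A\<^esub> \<phi> b"
  "\<phi> \<one>\<^bsub>R\<^esub> = \<one>\<^bsub>A\<^esub>" "\<phi> \<zero>\<^bsub>R\<^esub> = \<zero>\<^bsub>A\<^esub>"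
  "a \<in> carrier R \<Longrightarrow> \<phi> (\<ominus>\<^bsub>R\<^esub> a) = \<ominus>\<^bsub>A\<^esub> \<phi> a"
proof -
  interpret h: ring_hom_cring R A \<phi> by (rule hom_cring)
  show "a \<in> carrier R \<Longrightarrow> \<phi> a \<in> carrier A"
  "a \<in> carrier R \<Longrightarrow> b \<in> carrier R \<Longrightarrow> \<phi> (a \<otimes>\<^bsub>R\<^esub> b) = \<phi> a \<otimes>\<^bsub>A\<^esub> \<phi> b"
  "a \<in> carrier R \<Longrightarrow> b \<in> carrier R \<Longrightarrow> \<phi> (a \<oplus>\<^bsub>R\<^esub> b) = \<phi> a \<oplus>\<^bsub>A\<^esub> \<phi> b"
  "\<phi> \<one>\<^bsub>R\<^esub> = \<one>\<^bsub>A\<^esub>" "\<phi> \<zero>\<^bsub>R\<^esub> = \<zero>\<^bsub>A\<^esub>"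
  "a \<in> carrier R \<Longrightarrow> \<phi> (\<ominus>\<^bsub>R\<^esub> a) = \<ominus>\<^bsub>A\<^esub> \<phi> a" by auto
qed

lemma phi_minus: "a \<in> carrier R \<Longrightarrow> b \<in> carrier R \<Longrightarrow> \<phi> (a \<ominus>\<^bsub>R\<^esub> b) = \<phi> a \<ominus>\<^bsub>A\<^esub> \<phi> b"
  by (simp add: a_minus_def)

definition saturated where "saturated J = {a \<in> carrier R. \<exists>t\<in>carrier R - m. t \<otimes>\<^bsub>R\<^esub> a \<in> J}"
definition extended where "extended J = {x \<in> carrier A. \<exists>s\<in>carrier R - m. \<exists>r\<in>J. \<phi> s \<otimes>\<^bsub>A\<^esub> x = \<phi> r}"
definition contracted where "contracted Q = {a \<in> carrier R. \<phi> a \<in> Q}"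

lemma extI: "x \<in> carrier A \<Longrightarrow> s \<in> carrier R - m \<Longrightarrow> r \<in> J \<Longrightarrow> \<phi> s \<otimes>\<^bsub>A\<^esub> x = \<phi> r \<Longrightarrow> x \<in> extended J"
  unfolding extended_def by blast

lemma S_mult: "s \<in> carrier R - m \<Longrightarrow> t \<in> carrier R - m \<Longrightarrow> s \<otimes>\<^bsub>R\<^esub> t \<in> carrier R - m"
  using R.prime_mult[OF m_prime] by auto

lemma S_one: "\<one>\<^bsub>R\<^esub> \<in> carrier R - m" using R.prime_one[OF m_prime] by auto

lemma unit_in: assumes Q: "ideal Q A" and s: "s \<in> carrier R - m" and x: "x \<in> carrier A"
  shows "\<phi> s \<otimes>\<^bsub>A\<^esub> x \<in> Q \<longleftrightarrow> x \<in> Q"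
proof
  assume *: "\<phi> s \<otimes>\<^bsub>A\<^esub> x \<in> Q"
  have u: "\<phi> s \<in> Units A" using unit s by auto
  have "inv\<^bsub>A\<^esub> (\<phi> s) \<otimes>\<^bsub>A\<^esub> (\<phi> s \<otimes>\<^bsub>A\<^esub> x) \<in> Q" using A.ideal_mult[OF Q *] u by simp
  moreover have "inv\<^bsub>A\<^esub> (\<phi> s) \<otimes>\<^bsub>A\<^esub> (\<phi> s \<otimes>\<^bsub>A\<^esub> x) = x" using u x s by (simp add: A.m_assoc[symmetric])
  ultimately show "x \<in> Q" by simp
qed (use s A.ideal_mult[OF Q] in auto)

lemma contracted_ideal: assumes Q: "ideal Q A" shows "ideal (contracted Q) R"
  by (rule R.make_ideal) (auto simp: contracted_def A.ideal_zero[OF Q] A.ideal_add[OF Q] A.ideal_mult[OF Q])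

lemma contracted_prime: assumes Q: "primeideal Q A" shows "primeideal (contracted Q) R"
  by (rule R.make_prime[OF contracted_ideal[OF A.prime_ideal[OF Q]]])
     (auto simp: contracted_def A.prime_one[OF Q] A.prime_mult[OF Q])

lemma contracted_I0: assumes Q: "ideal Q A" shows "I0 \<subseteq> contracted Q"
proof
  fix a assume a: "a \<in> I0"
  hence ac: "a \<in> carrier R" using R.ideal_carr I0 by blast
  have "\<one>\<^bsub>R\<^esub> \<otimes>\<^bsub>R\<^esub> a \<in> I0" using a ac by simp
  hence "\<phi> a = \<zero>\<^bsub>A\<^esub>" using ker[OF ac] S_one by blast
  thus "a \<in> contracted Q" using ac A.ideal_zero[OF Q] by (simp add: contracted_def)
qed

lemma contracted_sub_m: assumes Q: "ideal Q A" "\<one>\<^bsub>A\<^esub> \<notin> Q" shows "contracted Q \<subseteq> m"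
proof
  fix a assume a: "a \<in> contracted Q"
  show "a \<in> m"
  proof (rule ccontr)
    assume "a \<notin> m"
    hence "\<phi> a \<otimes>\<^bsub>A\<^esub> \<one>\<^bsub>A\<^esub> \<in> Q \<longleftrightarrow> \<one>\<^bsub>A\<^esub> \<in> Q" using a by (intro unit_in[OF Q(1)]) (auto simp: contracted_def)
    thus False using a Q by (simp add: contracted_def)
  qed
qed

lemma extended_ideal: assumes J: "ideal J R" shows "ideal (extended J) A"
proof (rule A.make_ideal)
  show "\<zero>\<^bsub>A\<^esub> \<in> extended J" unfolding extended_def using S_one R.ideal_zero[OF J] by (auto intro!: bexI[of _ "\<one>\<^bsub>R\<^esub>"] bexI[of _ "\<zero>\<^bsub>R\<^esub>"])
  fix x y assume "x \<in> extended J" "y \<in> extended J"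
  then obtain s r t q where *: "x \<in> carrier A" "y \<in> carrier A" "s \<in> carrier R - m" "t \<in> carrier R - m" 
    "r \<in> J" "q \<in> J" "\<phi> s \<otimes>\<^bsub>A\<^esub> x = \<phi> r" "\<phi> t \<otimes>\<^bsub>A\<^esub> y = \<phi> q" by (auto simp: extended_def)
  have c: "r \<in> carrier R" "q \<in> carrier R" "s \<in> carrier R" "t \<in> carrier R" using * R.ideal_carr[OF J] by auto
  have "\<phi> (s \<otimes>\<^bsub>R\<^esub> t) \<otimes>\<^bsub>A\<^esub> (x \<oplus>\<^bsub>A\<^esub> y) = \<phi> t \<otimes>\<^bsub>A\<^esub> (\<phi> s \<otimes>\<^bsub>A\<^esub> x) \<oplus>\<^bsub>A\<^esub> \<phi> s \<otimes>\<^bsub>A\<^esub> (\<phi> t \<otimes>\<^bsub>A\<^esub> y)"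
    unfolding phi(2)[OF c(3,4)] using *(1,2) phi(1)[OF c(3)] phi(1)[OF c(4)] by (simp add: A.r_distr A.m_ac)
  also have "\<dots> = \<phi> (t \<otimes>\<^bsub>R\<^esub> r \<oplus>\<^bsub>R\<^esub> s \<otimes>\<^bsub>R\<^esub> q)" using * c by simp
  finally show "x \<oplus>\<^bsub>A\<^esub> y \<in> extended J" 
    by (rule extI[rotated 3]) (use * c S_mult in \<open>simp_all add: R.ideal_add[OF J] R.ideal_mult[OF J]\<close>)
next
  fix x a assume "x \<in> extended J" and a: "a \<in> carrier A"
  then obtain s r where *: "x \<in> carrier A" "s \<in> carrier R - m" "r \<in> J" "\<phi> s \<otimes>\<^bsub>A\<^esub> x = \<phi> r" by (auto simp: extended_def)
  obtain t q where t: "q \<in> carrier R" "t \<in> carrier R - m" "\<phi> t \<otimes>\<^bsub>A\<^esub> a = \<phi> q" using surj[OF a] by blast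
  have c: "r \<in> carrier R" "q \<in> carrier R" "s \<in> carrier R" "t \<in> carrier R" using * t R.ideal_carr[OF J] by auto
  have "\<phi> (t \<otimes>\<^bsub>R\<^esub> s) \<otimes>\<^bsub>A\<^esub> (a \<otimes>\<^bsub>A\<^esub> x) = (\<phi> t \<otimes>\<^bsub>A\<^esub> a) \<otimes>\<^bsub>A\<^esub> (\<phi> s \<otimes>\<^bsub>A\<^esub> x)"
    unfolding phi(2)[OF c(4,3)] using *(1) a phi(1)[OF c(3)] phi(1)[OF c(4)] by (simp add: A.m_ac)
  also have "\<dots> = \<phi> (q \<otimes>\<^bsub>R\<^esub> r)" using * t c by simp
  finally show "a \<otimes>\<^bsub>A\<^esub> x \<in> extended J"
    by (rule extI[rotated 3]) (use * a t c S_mult in \<open>simp_all add: R.ideal_mult[OF J]\<close>)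
qed (auto simp: extended_def)

lemma phi_extended: "ideal J R \<Longrightarrow> r \<in> J \<Longrightarrow> \<phi> r \<in> extended J"
  by (rule extI[where s = "\<one>\<^bsub>R\<^esub>" and r = r]) (use S_one R.ideal_carr[of J r] in simp_all)

lemma extended_mono: "J \<subseteq> K \<Longrightarrow> extended J \<subseteq> extended K" unfolding extended_def by blast

lemma extended_min: assumes "ideal Q A" "J \<subseteq> contracted Q" shows "extended J \<subseteq> Q"
proof
  fix x assume "x \<in> extended J"
  then obtain s r where *: "x \<in> carrier A" "s \<in> carrier R - m" "r \<in> J" "\<phi> s \<otimes>\<^bsub>A\<^esub> x = \<phi> r" by (auto simp: extended_def)
  have "\<phi> s \<otimes>\<^bsub>A\<^esub> x \<in> Q" using * assms(2) by (auto simp: contracted_def)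
  thus "x \<in> Q" using unit_in[OF assms(1) *(2,1)] by simp
qed

lemma extended_contracted: assumes "ideal Q A" shows "extended (contracted Q) = Q"
proof
  show "extended (contracted Q) \<subseteq> Q" by (rule extended_min[OF assms]) simp
  show "Q \<subseteq> extended (contracted Q)"
  proof
    fix x assume x: "x \<in> Q"
    hence xc: "x \<in> carrier A" using A.ideal_carr assms by blast
    obtain s r where *: "r \<in> carrier R" "s \<in> carrier R - m" "\<phi> s \<otimes>\<^bsub>A\<^esub> x = \<phi> r" using surj[OF xc] by blast
    hence "\<phi> r \<in> Q" using A.ideal_mult[OF assms x, of "\<phi> s"] by auto
    thus "x \<in> extended (contracted Q)" using * xc by (intro extI[of x s r]) (auto simp: contracted_def)
  qed
qed

lemma contracted_extended: assumes J: "ideal J R" and I: "I0 \<subseteq> J" shows "contracted (extended J) = saturated J"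
proof (intro equalityI subsetI)
  fix a assume "a \<in> contracted (extended J)"
  then obtain s r where *: "a \<in> carrier R" "s \<in> carrier R - m" "r \<in> J" "\<phi> s \<otimes>\<^bsub>A\<^esub> \<phi> a = \<phi> r"
    by (auto simp: extended_def contracted_def)
  have c: "r \<in> carrier R" "s \<in> carrier R" using * R.ideal_carr[OF J] by auto
  have "\<phi> (s \<otimes>\<^bsub>R\<^esub> a \<ominus>\<^bsub>R\<^esub> r) = \<zero>\<^bsub>A\<^esub>" using * c by (simp add: phi_minus A.r_right_minus_eq)
  then obtain t where t: "t \<in> carrier R - m" "t \<otimes>\<^bsub>R\<^esub> (s \<otimes>\<^bsub>R\<^esub> a \<ominus>\<^bsub>R\<^esub> r) \<in> I0" using ker c * by auto
  have tc: "t \<in> carrier R" using t by auto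
  have "t \<otimes>\<^bsub>R\<^esub> (s \<otimes>\<^bsub>R\<^esub> a \<ominus>\<^bsub>R\<^esub> r) = (t \<otimes>\<^bsub>R\<^esub> s) \<otimes>\<^bsub>R\<^esub> a \<ominus>\<^bsub>R\<^esub> t \<otimes>\<^bsub>R\<^esub> r"
    using c tc *(1) by (simp add: a_minus_def R.r_distr R.r_minus R.m_assoc)
  hence "(t \<otimes>\<^bsub>R\<^esub> s) \<otimes>\<^bsub>R\<^esub> a \<ominus>\<^bsub>R\<^esub> t \<otimes>\<^bsub>R\<^esub> r \<in> J" using t I by auto
  hence "(t \<otimes>\<^bsub>R\<^esub> s) \<otimes>\<^bsub>R\<^esub> a \<in> J" using R.ideal_minus_cancel[OF J _ R.ideal_mult[OF J *(3) tc]] c tc * by auto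
  thus "a \<in> saturated J" unfolding saturated_def using S_mult[OF t(1) *(2)] *(1) by blast
next
  fix a assume "a \<in> saturated J"
  then obtain t where *: "a \<in> carrier R" "t \<in> carrier R - m" "t \<otimes>\<^bsub>R\<^esub> a \<in> J" by (auto simp: saturated_def)
  have "\<phi> t \<otimes>\<^bsub>A\<^esub> \<phi> a = \<phi> (t \<otimes>\<^bsub>R\<^esub> a)" using * by auto
  hence "\<phi> a \<in> extended J" by (rule extI[rotated 3]) (use * in simp_all)
  thus "a \<in> contracted (extended J)" using * by (simp add: contracted_def)
qed

lemma saturated_prime: assumes P: "primeideal P R" "P \<subseteq> m" shows "saturated P = P"
proof -
  have "a \<in> P" if "a \<in> saturated P" for a using that R.prime_mult[OF P(1)] P(2) unfolding saturated_def by blast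
  moreover have "a \<in> saturated P" if "a \<in> P" for a
  proof -
    have "a \<in> carrier R" using that R.ideal_carr R.prime_ideal P by blast
    thus ?thesis unfolding saturated_def using that S_one by (auto intro!: bexI[of _ "\<one>\<^bsub>R\<^esub>"])
  qed
  ultimately show ?thesis by blast
qed

lemma contracted_ext_prime: assumes "primeideal P R" "P \<subseteq> m" "I0 \<subseteq> P" shows "contracted (extended P) = P"
  using contracted_extended saturated_prime assms R.prime_ideal by metis

lemma extended_prime: assumes P: "primeideal P R" "P \<subseteq> m" "I0 \<subseteq> P" shows "primeideal (extended P) A"
proof (rule A.make_prime)
  show e: "ideal (extended P) A" using extended_ideal R.prime_ideal P by blast
  have c: "a \<in> carrier R \<Longrightarrow> \<phi> a \<in> extended P \<longleftrightarrow> a \<in> P" for a using contracted_ext_prime[OF P] by (auto simp: contracted_def)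
  show "\<one>\<^bsub>A\<^esub> \<notin> extended P" using c[of "\<one>\<^bsub>R\<^esub>"] R.prime_one[OF P(1)] by simp
  fix x y assume *: "x \<in> carrier A" "y \<in> carrier A" "x \<otimes>\<^bsub>A\<^esub> y \<in> extended P" "x \<notin> extended P"
  obtain s r where s: "r \<in> carrier R" "s \<in> carrier R - m" "\<phi> s \<otimes>\<^bsub>A\<^esub> x = \<phi> r" using surj[OF *(1)] by blast
  obtain t q where t: "q \<in> carrier R" "t \<in> carrier R - m" "\<phi> t \<otimes>\<^bsub>A\<^esub> y = \<phi> q" using surj[OF *(2)] by blast
  have c': "\<phi> s \<in> carrier A" "\<phi> t \<in> carrier A" using s t by auto
  have "\<phi> (r \<otimes>\<^bsub>R\<^esub> q) = (\<phi> s \<otimes>\<^bsub>A\<^esub> x) \<otimes>\<^bsub>A\<^esub> (\<phi> t \<otimes>\<^bsub>A\<^esub> y)" using s t by simp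
  also have "\<dots> = (\<phi> s \<otimes>\<^bsub>A\<^esub> \<phi> t) \<otimes>\<^bsub>A\<^esub> (x \<otimes>\<^bsub>A\<^esub> y)" using * c' by (simp add: A.m_ac)
  also have "\<dots> \<in> extended P" using A.ideal_mult[OF e *(3)] c' by simp
  finally have "r \<otimes>\<^bsub>R\<^esub> q \<in> P" using c[of "r \<otimes>\<^bsub>R\<^esub> q"] s(1) t(1) by simp
  moreover have "r \<notin> P" using c[OF s(1)] unit_in[OF e s(2) *(1)] s(3) *(4) by simp
  ultimately have "q \<in> P" using R.prime_mult[OF P(1)] s t by blast
  hence "\<phi> q \<in> extended P" using c t by blast
  thus "y \<in> extended P" using unit_in[OF e t(2) *(2)] t(3) by simp
qed

lemma extended_I0: "extended I0 = {\<zero>\<^bsub>A\<^esub>}"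
proof
  have "I0 \<subseteq> contracted {\<zero>\<^bsub>A\<^esub>}" by (rule contracted_I0[OF A.zeroideal])
  thus "extended I0 \<subseteq> {\<zero>\<^bsub>A\<^esub>}" by (rule extended_min[OF A.zeroideal])
  show "{\<zero>\<^bsub>A\<^esub>} \<subseteq> extended I0" using A.ideal_zero[OF extended_ideal[OF I0(1)]] by simp
qed

lemma extended_adjoin: assumes J: "ideal J R" and y: "y \<in> carrier R" shows "extended (R.adjoin J y) = A.adjoin (extended J) (\<phi> y)"
proof
  have e: "ideal (extended (R.adjoin J y)) A" "ideal (extended J) A" using extended_ideal R.adjoin_ideal J y by auto
  show "A.adjoin (extended J) (\<phi> y) \<subseteq> extended (R.adjoin J y)"
    using R.adjoin_gen[OF J y] R.adjoin_sup[OF J y] R.adjoin_ideal[OF J y]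
    by (intro A.adjoin_min[OF e(1)] extended_mono phi_extended)
  have a: "ideal (A.adjoin (extended J) (\<phi> y)) A" using A.adjoin_ideal[OF e(2)] y by simp
  show "extended (R.adjoin J y) \<subseteq> A.adjoin (extended J) (\<phi> y)"
  proof (rule extended_min[OF a R.adjoin_min[OF contracted_ideal[OF a]]])
    show "J \<subseteq> contracted (A.adjoin (extended J) (\<phi> y))"
      using A.adjoin_sup[OF e(2), of "\<phi> y"] phi_extended[OF J] y R.ideal_carr[OF J] by (auto simp: contracted_def)
    show "y \<in> contracted (A.adjoin (extended J) (\<phi> y))"
      using A.adjoin_gen[OF e(2), of "\<phi> y"] y by (auto simp: contracted_def)
  qed
qed

lemma extended_colon: assumes J: "ideal J R" and I: "I0 \<subseteq> J" and z: "z \<in> carrier R" 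
  shows "A.colon (extended J) (\<phi> z) = extended (R.colon J z)"
proof -
  have e: "ideal (extended J) A" using extended_ideal J by auto
  have ci: "ideal (A.colon (extended J) (\<phi> z)) A" using A.colon_ideal[OF e] z by simp
  have "contracted (A.colon (extended J) (\<phi> z)) = saturated (R.colon J z)"
  proof -
    have "a \<in> contracted (A.colon (extended J) (\<phi> z)) \<longleftrightarrow> a \<in> saturated (R.colon J z)" for a
    proof -
      have "a \<in> contracted (A.colon (extended J) (\<phi> z)) \<longleftrightarrow> a \<in> carrier R \<and> a \<otimes>\<^bsub>R\<^esub> z \<in> contracted (extended J)"
        using z by (auto simp: contracted_def A.colon_def)
      also have "\<dots> \<longleftrightarrow> a \<in> carrier R \<and> a \<otimes>\<^bsub>R\<^esub> z \<in> saturated J" using contracted_extended[OF J I] by simp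
      also have "\<dots> \<longleftrightarrow> a \<in> saturated (R.colon J z)" using z by (auto simp: saturated_def R.colon_def R.m_assoc)
      finally show ?thesis .
    qed
    thus ?thesis by blast
  qed
  also have "\<dots> = contracted (extended (R.colon J z))"
    using contracted_extended[OF R.colon_ideal[OF J z]] I R.colon_sup[OF J z] by auto
  finally have "contracted (A.colon (extended J) (\<phi> z)) = contracted (extended (R.colon J z))" .
  thus ?thesis using extended_contracted[OF ci] extended_contracted[OF extended_ideal[OF R.colon_ideal[OF J z]]] by metis
qed

lemma contracted_chain: assumes "prime_chain A ps" shows "prime_chain R (map contracted ps)" "I0 \<subseteq> hd (map contracted ps)" "last (map contracted ps) \<subseteq> m"
proof -
  have pr: "primeideal P A" if "P \<in> set ps" for P using assms that by (auto simp: prime_chain_def)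
  have ne: "ps \<noteq> []" using assms by (auto simp: prime_chain_def)
  have strict: "contracted P \<subset> contracted Q" if "P \<in> set ps" "Q \<in> set ps" "P \<subset> Q" for P Q
  proof -
    have "contracted P \<subseteq> contracted Q" using that by (auto simp: contracted_def)
    moreover have "contracted P \<noteq> contracted Q" using extended_contracted that pr A.prime_ideal by (metis psubset_eq)
    ultimately show ?thesis by blast
  qed
  have "sorted_wrt (\<subset>) ps" using assms by (auto simp: prime_chain_def)
  hence "sorted_wrt (\<subset>) (map contracted ps)" unfolding sorted_wrt_map
    by (rule sorted_wrt_mono_rel[rotated]) (use strict in auto)
  thus "prime_chain R (map contracted ps)" unfolding prime_chain_def using pr contracted_prime ne by auto
  show "I0 \<subseteq> hd (map contracted ps)" using contracted_I0[of "hd ps"] ne pr A.prime_ideal by (simp add: hd_map)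
  show "last (map contracted ps) \<subseteq> m" using contracted_sub_m[of "last ps"] ne pr A.prime_ideal A.prime_one by (simp add: last_map)
qed

lemma extended_chain: assumes "prime_chain R ps" "I0 \<subseteq> hd ps" "last ps \<subseteq> m"
  shows "prime_chain A (map extended ps)"
proof -
  have ne: "ps \<noteq> []" and pr: "\<And>P. P \<in> set ps \<Longrightarrow> primeideal P R" and so: "sorted_wrt (\<subset>) ps" using assms by (auto simp: prime_chain_def)
  have so': "sorted_wrt (\<subseteq>) ps" by (rule sorted_wrt_mono_rel[OF _ so]) auto
  have b: "I0 \<subseteq> P \<and> P \<subseteq> m" if "P \<in> set ps" for P
  proof -
    have "hd ps \<subseteq> P" using that so' ne by (cases ps) auto
    moreover have "P \<subseteq> last ps" using that so' ne 
      by (metis append_butlast_last_id in_set_conv_decomp_last last_in_set order_refl sorted_wrt_append split_list UnE set_append empty_iff empty_set set_ConsD)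
    ultimately show ?thesis using assms by blast
  qed
  have strict: "extended P \<subset> extended Q" if "P \<in> set ps" "Q \<in> set ps" "P \<subset> Q" for P Q
    using extended_mono[of P Q] contracted_ext_prime[OF pr] b that by (metis psubset_eq)
  have "sorted_wrt (\<subset>) (map extended ps)" unfolding sorted_wrt_map
    by (rule sorted_wrt_mono_rel[OF _ so]) (use strict in auto)
  thus ?thesis unfolding prime_chain_def using pr b extended_prime ne by auto
qed

text \<open>Every ideal of \<open>A\<close> is extended from its contraction, and generators of the contraction generate it.\<close>

lemma local_noeth_A: assumes "noetherian_ring R" shows "local_noeth A (extended m)"
proof -
  interpret N: noetherian_ring R by fact
  have "noetherian_ring A"
  proof (rule A.noetherian_ringI)
    fix J assume J: "ideal J A"
    obtain F where F: "F \<subseteq> carrier R" "finite F" "contracted J = Idl\<^bsub>R\<^esub> F" using N.finetely_gen[OF contracted_ideal[OF J]] by blast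
    have Fc: "\<phi> ` F \<subseteq> carrier A" using F by auto
    have i: "ideal (Idl\<^bsub>A\<^esub> (\<phi> ` F)) A" using A.genideal_ideal[OF Fc] .
    have "F \<subseteq> contracted (Idl\<^bsub>A\<^esub> (\<phi> ` F))" using A.genideal_self[OF Fc] F by (auto simp: contracted_def)
    hence "contracted J \<subseteq> contracted (Idl\<^bsub>A\<^esub> (\<phi> ` F))" unfolding F(3) by (rule R.genideal_minimal[OF contracted_ideal[OF i]])
    hence "J \<subseteq> Idl\<^bsub>A\<^esub> (\<phi> ` F)" using extended_contracted[OF J] extended_min[OF i] by blast
    moreover have "\<phi> ` F \<subseteq> J" using F R.genideal_self[OF F(1)] by (auto simp: contracted_def)
    hence "Idl\<^bsub>A\<^esub> (\<phi> ` F) \<subseteq> J" by (rule A.genideal_minimal[OF J])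
    ultimately show "\<exists>B\<subseteq>carrier A. finite B \<and> J = Idl\<^bsub>A\<^esub> B" using Fc F(2) by blast
  qed
  then interpret NA: noetherian_ring A .
  have m: "ideal m R" using R.prime_ideal m_prime .
  have c: "contracted (extended m) = m" using contracted_ext_prime m_prime I0 by blast
  show ?thesis
  proof (intro local_noeth.intro local_noeth_axioms.intro noeth_cring.intro A.is_cring NA.noetherian_ring_axioms)
    show "ideal (extended m) A" using extended_ideal[OF m] .
    show "\<one>\<^bsub>A\<^esub> \<notin> extended m" using A.prime_one extended_prime m_prime I0 by blast
    fix x assume x: "x \<in> carrier A" "x \<notin> extended m"
    obtain s r where s: "r \<in> carrier R" "s \<in> carrier R - m" "\<phi> s \<otimes>\<^bsub>A\<^esub> x = \<phi> r" using surj[OF x(1)] by blast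
    have "r \<notin> m"
    proof
      assume "r \<in> m"
      hence "x \<in> extended m" using s x by (intro extI[of x s r])
      thus False using x by simp
    qed
    hence "\<phi> r \<in> Units A" using unit s by blast
    thus "x \<in> Units A" using s x A.unit_factor[of x "\<phi> s"] A.m_comm[of x "\<phi> s"] by auto
  qed
qed

end

lemma localized_ring_quotient:
  fixes R (structure)
  assumes R: "cring R" and I0: "ideal I0 R" and M: "primeideal M (R Quot I0)"
  defines "L \<equiv> localization (R Quot I0) (carrier (R Quot I0) - M)"
  shows "localized_ring R L (\<lambda>r. loc_frac (R Quot I0) (carrier (R Quot I0) - M) (I0 +> r) \<one>\<^bsub>R Quot I0\<^esub>) {r \<in> carrier R. I0 +> r \<in> M} I0"
proof -
  interpret R: cring R by fact
  interpret I: ideal I0 R by fact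
  define B where "B = R Quot I0"
  interpret B: cring B unfolding B_def using I.quotient_is_cring[OF R] .
  have M: "primeideal M B" using M unfolding B_def .
  have pm: "x \<in> M \<or> y \<in> M" if "x \<otimes>\<^bsub>B\<^esub> y \<in> M" "x \<in> carrier B" "y \<in> carrier B" for x y using B.prime_mult[OF M] that by blast
  interpret S: mult_set B "carrier B - M"
    using B.prime_one[OF M] pm by unfold_locales auto
  let ?q = "\<lambda>r. I0 +> r"
  have qh: "?q \<in> ring_hom R B" unfolding B_def by (rule I.rcos_ring_hom)
  interpret q: ring_hom_cring R B ?q
    using qh by (intro ring_hom_cringI R.is_cring B.is_cring ring_hom_ringI2 R.ring_axioms B.ring_axioms)
  have surj: "\<exists>r\<in>carrier R. x = ?q r" if "x \<in> carrier B" for x using that unfolding B_def FactRing_def A_RCOSETS_def' by auto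
  have z: "?q r = \<zero>\<^bsub>B\<^esub> \<longleftrightarrow> r \<in> I0" if "r \<in> carrier R" for r
  proof -
    have "\<zero>\<^bsub>B\<^esub> = I0" unfolding B_def FactRing_def by (simp only: ring.simps)
    thus ?thesis using that R.a_rcos_zero[OF I0, of r] I.rcos_const_imp_mem[of r] by metis
  qed
  let ?m = "{r \<in> carrier R. ?q r \<in> M}"
  interpret L: cring S.LR by (rule S.localization_cring)
  have M0: "\<zero>\<^bsub>B\<^esub> \<in> M" using B.ideal_zero B.prime_ideal M by blast
  have Mi: "ideal M B" using B.prime_ideal M .
  have "localized_ring R S.LR (\<lambda>r. S.fr (?q r) \<one>\<^bsub>B\<^esub>) ?m I0"
  proof (intro localized_ring.intro localized_ring_axioms.intro R.is_cring L.is_cring I0)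
    have "(\<lambda>a. S.fr a \<one>\<^bsub>B\<^esub>) \<circ> ?q \<in> ring_hom R S.LR" by (rule ring_hom_trans[OF qh S.localization_hom])
    thus "(\<lambda>r. S.fr (?q r) \<one>\<^bsub>B\<^esub>) \<in> ring_hom R S.LR" by (simp add: comp_def)
    have mi: "ideal ?m R" 
      by (rule R.make_ideal) (auto simp: M0 B.ideal_add[OF Mi] B.ideal_mult[OF Mi])
    have polynomials: "primeideal ?m R"
      by (rule R.make_prime[OF mi]) (auto simp: B.prime_one[OF M] B.prime_mult[OF M])
    show "primeideal ?m R" by (rule polynomials)
    show "I0 \<subseteq> ?m" proof
      fix x assume x: "x \<in> I0"
      show "x \<in> ?m" using z[OF I.Icarr[OF x]] M0 I.Icarr[OF x] x by simp
    qed
    fix s assume s: "s \<in> carrier R" "s \<notin> ?m"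
    thus "S.fr (?q s) \<one>\<^bsub>B\<^esub> \<in> Units S.LR" by (intro S.frac_unit) auto
  next
    fix x assume "x \<in> carrier S.LR"
    then obtain a s where e: "x = S.fr a s" "a \<in> carrier B" "s \<in> carrier B - M" by (metis S.localization_elim)
    obtain a' s' where e': "a = ?q a'" "s = ?q s'" "a' \<in> carrier R" "s' \<in> carrier R" using e surj by blast
    show "\<exists>r\<in>carrier R. \<exists>s\<in>carrier R - ?m. S.fr (?q s) \<one>\<^bsub>B\<^esub> \<otimes>\<^bsub>S.LR\<^esub> x = S.fr (?q r) \<one>\<^bsub>B\<^esub>"
    proof (rule bexI[OF _ e'(3)], rule bexI)
      show "S.fr (?q s') \<one>\<^bsub>B\<^esub> \<otimes>\<^bsub>S.LR\<^esub> x = S.fr (?q a') \<one>\<^bsub>B\<^esub>" 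
        using S.frac_repr[OF e(2,3)] unfolding e(1) e'(1,2) .
      show "s' \<in> carrier R - ?m" using e(3) e'(2,4) by simp
    qed
  next
    fix a assume a: "a \<in> carrier R"
    have "S.fr (?q a) \<one>\<^bsub>B\<^esub> = \<zero>\<^bsub>S.LR\<^esub> \<longleftrightarrow> (\<exists>u\<in>carrier B - M. u \<otimes>\<^bsub>B\<^esub> ?q a = \<zero>\<^bsub>B\<^esub>)"
      using a by (intro S.frac_zero_iff) auto
    also have "\<dots> \<longleftrightarrow> (\<exists>t\<in>carrier R - ?m. t \<otimes> a \<in> I0)"
    proof
      assume "\<exists>u\<in>carrier B - M. u \<otimes>\<^bsub>B\<^esub> ?q a = \<zero>\<^bsub>B\<^esub>"
      then obtain t where t: "t \<in> carrier R" "?q t \<notin> M" "?q t \<otimes>\<^bsub>B\<^esub> ?q a = \<zero>\<^bsub>B\<^esub>" using surj by blast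
      hence "?q (t \<otimes> a) = \<zero>\<^bsub>B\<^esub>" using a by simp
      hence "t \<otimes> a \<in> I0" using z[of "t \<otimes> a"] t(1) a by simp
      moreover have "t \<in> carrier R - ?m" using t(1,2) by simp
      ultimately show "\<exists>t\<in>carrier R - ?m. t \<otimes> a \<in> I0" by (rule bexI)
    next
      assume "\<exists>t\<in>carrier R - ?m. t \<otimes> a \<in> I0"
      then obtain t where t: "t \<in> carrier R" "?q t \<notin> M" "t \<otimes> a \<in> I0" by blast
      hence "?q t \<otimes>\<^bsub>B\<^esub> ?q a = \<zero>\<^bsub>B\<^esub>" using z[of "t \<otimes> a"] a by simp
      moreover have "?q t \<in> carrier B - M" using t(1,2) by simp
      ultimately show "\<exists>u\<in>carrier B - M. u \<otimes>\<^bsub>B\<^esub> ?q a = \<zero>\<^bsub>B\<^esub>" by (rule bexI)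
    qed
    finally show "S.fr (?q a) \<one>\<^bsub>B\<^esub> = \<zero>\<^bsub>S.LR\<^esub> \<longleftrightarrow> (\<exists>t\<in>carrier R - ?m. t \<otimes> a \<in> I0)" .
  qed
  thus ?thesis unfolding L_def B_def .
qed

section \<open>Polynomial rings and coordinate primes\<close>

abbreviation "lk \<equiv> Poly_Mapping.lookup"
abbreviation "ks \<equiv> Poly_Mapping.keys"

type_synonym mon = "nat \<Rightarrow>\<^sub>0 nat"

lemma pm_induct [case_names zero single add]:
  assumes "P 0" "\<And>u c. P (Poly_Mapping.single u c)" "\<And>f g. P f \<Longrightarrow> P g \<Longrightarrow> P (f + g)"
  shows "P (f :: 'a \<Rightarrow>\<^sub>0 'b::comm_monoid_add)"
proof (induction f rule: update_induct)
  case const show ?case by (rule assms(1))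
next
  case (update f a b)
  have "Poly_Mapping.update a b f = f + Poly_Mapping.single a b"
    by (rule poly_mapping_eqI) (use update(1) in \<open>auto simp: lookup_update lookup_add lookup_single in_keys_iff\<close>)
  thus ?case using assms update by metis
qed

lemma keys_add_nat: "ks (u + v :: mon) = ks u \<union> ks v"
  by (auto simp: in_keys_iff lookup_add)

lemma lookup_mono_mult: "lk (Poly_Mapping.single w c * f) (w + u) = c * lk f u" for f :: "mon \<Rightarrow>\<^sub>0 'k::field"
  by (induction f rule: pm_induct) (auto simp: mult_single lookup_single when_def distrib_left lookup_add)

lemma keys_mono_mult: "ks (Poly_Mapping.single w c * f) \<subseteq> (\<lambda>u. w + u) ` ks f" for f :: "mon \<Rightarrow>\<^sub>0 'k::field"
  using keys_mult[of "Poly_Mapping.single w c" f] by (auto split: if_splits)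

definition pfilter :: "(mon \<Rightarrow> bool) \<Rightarrow> (mon \<Rightarrow>\<^sub>0 'k::field) \<Rightarrow> (mon \<Rightarrow>\<^sub>0 'k)" where
  "pfilter C f = Abs_poly_mapping (\<lambda>u. if C u then lk f u else 0)"

lemma lookup_pfilter: "lk (pfilter C f) u = (if C u then lk f u else 0)"
proof -
  have "finite {u. (if C u then lk f u else 0) \<noteq> 0}" by (rule finite_subset[OF _ finite_keys[of f]]) (auto simp: in_keys_iff)
  thus ?thesis unfolding pfilter_def by simp
qed

lemma keys_pfilter: "ks (pfilter C f) = {u \<in> ks f. C u}" by (auto simp: in_keys_iff lookup_pfilter split: if_splits)

lemma pfilter_split: "f = pfilter C f + pfilter (\<lambda>u. \<not> C u) f"
  by (rule poly_mapping_eqI) (simp add: lookup_add lookup_pfilter)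

text \<open>The coefficient of \<open>x\<^sub>v\<^sup>k\<close> when \<open>f\<close> is read as a polynomial in \<open>x\<^sub>v\<close>.\<close>

definition coef :: "nat \<Rightarrow> nat \<Rightarrow> (mon \<Rightarrow>\<^sub>0 'k::field) \<Rightarrow> (mon \<Rightarrow>\<^sub>0 'k)" where
  "coef v k f = Abs_poly_mapping (\<lambda>u. if lk u v = 0 then lk f (u + Poly_Mapping.single v k) else 0)"

lemma lookup_coef: "lk (coef v k f) u = (if lk u v = 0 then lk f (u + Poly_Mapping.single v k) else 0)"
proof -
  have "{u. (if lk u v = 0 then lk f (u + Poly_Mapping.single v k) else 0) \<noteq> 0} \<subseteq> (\<lambda>u. u - Poly_Mapping.single v k) ` ks f"
  proof
    fix u assume "u \<in> {u. (if lk u v = 0 then lk f (u + Poly_Mapping.single v k) else 0) \<noteq> 0}"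
    hence "u + Poly_Mapping.single v k \<in> ks f" by (auto simp: in_keys_iff split: if_splits)
    moreover have "u = (u + Poly_Mapping.single v k) - Poly_Mapping.single v k" by simp
    ultimately show "u \<in> (\<lambda>u. u - Poly_Mapping.single v k) ` ks f" by blast
  qed
  hence "finite {u. (if lk u v = 0 then lk f (u + Poly_Mapping.single v k) else 0) \<noteq> 0}"
    by (rule finite_subset) simp
  thus ?thesis unfolding coef_def by simp
qed

lemma keys_coef: "u \<in> ks (coef v k f) \<longleftrightarrow> lk u v = 0 \<and> u + Poly_Mapping.single v k \<in> ks f"
  by (auto simp: in_keys_iff lookup_coef split: if_splits)

lemma coef_add: "coef v k (f + g) = coef v k f + coef v k g"
  by (rule poly_mapping_eqI) (simp add: lookup_coef lookup_add)

lemma coef_zero: "coef v k 0 = 0"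
  by (rule poly_mapping_eqI) (simp add: lookup_coef)

lemma coef_single: "coef v k (Poly_Mapping.single b d) = (if lk b v = k then Poly_Mapping.single (b - Poly_Mapping.single v k) d else 0)"
proof (rule poly_mapping_eqI)
  fix u
  have "lk u v = 0 \<and> b = u + Poly_Mapping.single v k \<longleftrightarrow> lk b v = k \<and> b - Poly_Mapping.single v k = u"
    by (auto simp: poly_mapping_eq_iff fun_eq_iff lookup_add lookup_minus lookup_single when_def minus_poly_mapping.rep_eq)
  thus "lk (coef v k (Poly_Mapping.single b d)) u = lk (if lk b v = k then Poly_Mapping.single (b - Poly_Mapping.single v k) d else 0) u"
    by (auto simp: lookup_coef lookup_single when_def)
qed

lemma coef_mult_single: 
  "coef v K (Poly_Mapping.single a c * Poly_Mapping.single b d) = 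
   (\<Sum>j\<le>K. coef v j (Poly_Mapping.single a c) * coef v (K - j) (Poly_Mapping.single b d))"
proof -
  have e: "lk (a + b) v = K \<Longrightarrow> a + b - Poly_Mapping.single v K = (a - Poly_Mapping.single v (lk a v)) + (b - Poly_Mapping.single v (lk b v))"
    by (auto simp: poly_mapping_eq_iff fun_eq_iff lookup_add lookup_single when_def minus_poly_mapping.rep_eq)
  have "(\<Sum>j\<le>K. coef v j (Poly_Mapping.single a c) * coef v (K - j) (Poly_Mapping.single b d)) =
     (\<Sum>j\<le>K. if j = lk a v then (if lk a v + lk b v = K then Poly_Mapping.single (a + b - Poly_Mapping.single v K) (c * d) else 0) else 0)"
    by (rule sum.cong) (use e in \<open>auto simp: coef_single mult_single lookup_add\<close>)
  also have "\<dots> = coef v K (Poly_Mapping.single a c * Poly_Mapping.single b d)"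
    by (auto simp: mult_single coef_single lookup_add)
  finally show ?thesis by simp
qed

lemma coef_mult: "coef v K (f * g) = (\<Sum>j\<le>K. coef v j f * coef v (K - j) g)"
proof (induction f rule: pm_induct)
  case (single a c)
  show ?case
  proof (induction g rule: pm_induct)
    case (single b d) show ?case by (rule coef_mult_single)
  qed (simp_all add: coef_zero distrib_left coef_add sum.distrib)
qed (simp_all add: coef_zero distrib_right coef_add sum.distrib)

definition pfree :: "nat \<Rightarrow> (mon \<Rightarrow>\<^sub>0 'k::field) \<Rightarrow> bool" where "pfree v f \<longleftrightarrow> (\<forall>u\<in>ks f. lk u v = 0)"

lemma coef_free: assumes "pfree v f" shows "coef v k f = (if k = 0 then f else 0)"
proof (rule poly_mapping_eqI)
  fix u
  have 0: "lk w v \<noteq> 0 \<Longrightarrow> lk f w = 0" for w using assms unfolding pfree_def by (metis in_keys_iff)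
  have 1: "lk u v \<noteq> 0 \<Longrightarrow> lk f u = 0" by (rule 0)
  have "lk (u + Poly_Mapping.single v k) v \<noteq> 0" if "k \<noteq> 0" using that by (simp add: lookup_add)
  hence 2: "k \<noteq> 0 \<Longrightarrow> lk f (u + Poly_Mapping.single v k) = 0" using 0 by blast
  show "lk (coef v k f) u = lk (if k = 0 then f else 0) u" using 1 2 by (auto simp: lookup_coef)
qed

lemma coef_mult_free: assumes "pfree v f" shows "coef v k (f * g) = f * coef v k g"
proof -
  have "coef v k (f * g) = (\<Sum>j\<le>k. if j = 0 then f * coef v k g else 0)"
    unfolding coef_mult by (rule sum.cong) (auto simp: coef_free[OF assms])
  thus ?thesis by simp
qed

lemma coef_sum: "f = (\<Sum>k\<le>N. Poly_Mapping.single (Poly_Mapping.single v k) 1 * coef v k f)" 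
  if "\<forall>u\<in>ks f. lk u v \<le> N" for f :: "mon \<Rightarrow>\<^sub>0 'k::field"
proof (rule poly_mapping_eqI)
  fix u :: mon
  have l: "lk (Poly_Mapping.single (Poly_Mapping.single v k) 1 * coef v k f) u = (if k = lk u v then lk f u else 0)" for k
  proof (cases "k = lk u v")
    case True
    let ?w = "u - Poly_Mapping.single v k"
    have w: "u = Poly_Mapping.single v k + ?w" 
      using True by (auto simp: poly_mapping_eq_iff fun_eq_iff lookup_add lookup_single when_def minus_poly_mapping.rep_eq)
    have w0: "lk ?w v = 0" using True by (simp add: minus_poly_mapping.rep_eq)
    have "lk (Poly_Mapping.single (Poly_Mapping.single v k) 1 * coef v k f) u = lk (coef v k f) ?w"
      using lookup_mono_mult[of "Poly_Mapping.single v k" 1 "coef v k f" ?w] w by simp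
    also have "\<dots> = lk f u" using w w0 by (simp add: lookup_coef add.commute)
    finally show ?thesis using True by simp
  next
    case False
    have "u \<notin> ks (Poly_Mapping.single (Poly_Mapping.single v k) 1 * coef v k f)"
    proof
      assume "u \<in> ks (Poly_Mapping.single (Poly_Mapping.single v k) 1 * coef v k f)"
      then obtain w where "u = Poly_Mapping.single v k + w" "w \<in> ks (coef v k f)" using keys_mono_mult by blast
      thus False using False by (auto simp: keys_coef lookup_add)
    qed
    thus ?thesis using False by (simp add: in_keys_iff)
  qed
  show "lk f u = lk (\<Sum>k\<le>N. Poly_Mapping.single (Poly_Mapping.single v k) 1 * coef v k f) u"
    unfolding lookup_sum l using that by (auto simp: in_keys_iff)
qed

lemma coef_bound: fixes f :: "mon \<Rightarrow>\<^sub>0 'k::field" obtains N where "\<forall>u\<in>ks f. lk u v \<le> N"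
proof -
  have "\<forall>u\<in>ks f. lk u v \<le> Max ((\<lambda>u. lk u v) ` ks f)" by auto
  thus ?thesis using that by blast
qed

lemma coef_beyond: "\<forall>u\<in>ks f. lk u v \<le> N \<Longrightarrow> k > N \<Longrightarrow> coef v k f = 0"
proof (rule poly_mapping_eqI)
  fix u assume *: "\<forall>u\<in>ks f. lk u v \<le> N" "k > N"
  have "lk (u + Poly_Mapping.single v k) v > N" using *(2) by (simp add: lookup_add)
  hence "u + Poly_Mapping.single v k \<notin> ks f" using *(1) by force
  thus "lk (coef v k f) u = lk 0 u" by (simp add: lookup_coef in_keys_iff)
qed

lemma monomials_add: "u \<in> monomials n \<Longrightarrow> v \<in> monomials n \<Longrightarrow> u + v \<in> monomials n"
  by (auto simp: monomials_def keys_add_nat)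

lemma monomials_add_iff: "u + v \<in> monomials n \<longleftrightarrow> u \<in> monomials n \<and> v \<in> monomials n"
  by (auto simp: monomials_def keys_add_nat)

text \<open>The argument \<open>tk\<close> only fixes the type of the coefficients.\<close>

locale polynomials = fixes n :: nat and tk :: "'k::field itself"
begin
abbreviation "Rn \<equiv> (mpoly_ring n :: (mon \<Rightarrow>\<^sub>0 'k) ring)"

lemma mp_simps [simp]: "monoid.mult Rn = (*)" "one Rn = 1" "ring.zero Rn = 0" "add Rn = (+)"
  by (simp_all add: mpoly_ring_def)

lemma carrier_iff: "p \<in> carrier Rn \<longleftrightarrow> ks p \<subseteq> monomials n" by (simp add: mpoly_ring_def)

lemma carr_add: "p \<in> carrier Rn \<Longrightarrow> q \<in> carrier Rn \<Longrightarrow> p + q \<in> carrier Rn"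
  using keys_add[of p q] by (auto simp: carrier_iff)

lemma carr_mult: "p \<in> carrier Rn \<Longrightarrow> q \<in> carrier Rn \<Longrightarrow> p * q \<in> carrier Rn"
  using keys_mult[of p q] monomials_add by (fastforce simp: carrier_iff)

lemma carr_uminus: "p \<in> carrier Rn \<Longrightarrow> - p \<in> carrier Rn"
  by (auto simp: carrier_iff in_keys_iff subset_iff)

lemma carr_01: "0 \<in> carrier Rn" "1 \<in> carrier Rn" by (auto simp: carrier_iff monomials_def)

lemma cring_Rn: "cring Rn"
proof (rule cringI)
  show "abelian_group Rn"
    by (rule abelian_groupI) (auto simp: carr_add carr_01 add.assoc add.commute intro: bexI[OF _ carr_uminus])
  show "comm_monoid Rn" by (rule comm_monoidI) (auto simp: carr_mult carr_01 mult.assoc mult.commute)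
qed (simp add: distrib_right)

end

sublocale polynomials \<subseteq> R: cring Rn by (rule cring_Rn)

context polynomials
begin

lemma mp_uminus [simp]: "p \<in> carrier Rn \<Longrightarrow> \<ominus>\<^bsub>Rn\<^esub> p = - p"
  using R.minus_equality[of "- p" p] carr_uminus by simp

lemma mp_minus [simp]: "p \<in> carrier Rn \<Longrightarrow> q \<in> carrier Rn \<Longrightarrow> p \<ominus>\<^bsub>Rn\<^esub> q = p - q"
  by (simp add: a_minus_def)

lemma mp_pow [simp]: "p [^]\<^bsub>Rn\<^esub> (k::nat) = p ^ k"
  by (induction k) (auto simp: mult.commute)

lemma carr_minus: "p \<in> carrier Rn \<Longrightarrow> q \<in> carrier Rn \<Longrightarrow> p - q \<in> carrier Rn"
  using R.minus_closed[of p q] by simp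

lemma carr_pow: "p \<in> carrier Rn \<Longrightarrow> p ^ k \<in> carrier Rn"
  using R.nat_pow_closed[of p k] by simp

lemma carr_single: "u \<in> monomials n \<Longrightarrow> Poly_Mapping.single u c \<in> carrier Rn"
  by (simp add: carrier_iff)

lemma carr_sum: "(\<And>i. i \<in> A \<Longrightarrow> f i \<in> carrier Rn) \<Longrightarrow> sum f A \<in> carrier Rn"
  by (induction A rule: infinite_finite_induct) (auto simp: carr_add carr_01)

lemma id_add: "ideal J Rn \<Longrightarrow> a \<in> J \<Longrightarrow> b \<in> J \<Longrightarrow> a + b \<in> J" using R.ideal_add[of J a b] by simp
lemma id_mult: "ideal J Rn \<Longrightarrow> a \<in> J \<Longrightarrow> c \<in> carrier Rn \<Longrightarrow> c * a \<in> J" using R.ideal_mult[of J a c] by simp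
lemma id_mult': "ideal J Rn \<Longrightarrow> a \<in> J \<Longrightarrow> c \<in> carrier Rn \<Longrightarrow> a * c \<in> J" using id_mult[of J a c] by (simp add: mult.commute)
lemma id_zero: "ideal J Rn \<Longrightarrow> 0 \<in> J" using R.ideal_zero[of J] by simp
lemma id_carr: "ideal J Rn \<Longrightarrow> a \<in> J \<Longrightarrow> a \<in> carrier Rn" using R.ideal_carr .
lemma id_uminus: "ideal J Rn \<Longrightarrow> a \<in> J \<Longrightarrow> - a \<in> J" using R.ideal_neg[of J a] id_carr[of J a] by simp
lemma id_minus: "ideal J Rn \<Longrightarrow> a \<in> J \<Longrightarrow> b \<in> J \<Longrightarrow> a - b \<in> J" using id_add[of J a "- b"] id_uminus[of J b] by simp
lemma id_sum: "ideal J Rn \<Longrightarrow> (\<And>i. i \<in> A \<Longrightarrow> f i \<in> J) \<Longrightarrow> sum f A \<in> J"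
  by (induction A rule: infinite_finite_induct) (auto simp: id_add id_zero)
lemma id_add_cancel: "ideal J Rn \<Longrightarrow> a + b \<in> J \<Longrightarrow> b \<in> J \<Longrightarrow> a \<in> J" using id_minus[of J "a + b" b] by simp

lemma mk_ideal:
  assumes "J \<subseteq> carrier Rn" "0 \<in> J" "\<And>a b. a \<in> J \<Longrightarrow> b \<in> J \<Longrightarrow> a + b \<in> J"
    "\<And>a c. a \<in> J \<Longrightarrow> c \<in> carrier Rn \<Longrightarrow> c * a \<in> J"
  shows "ideal J Rn"
  using assms by (intro R.make_ideal) auto

lemma prime_mult': "primeideal Q Rn \<Longrightarrow> a \<in> carrier Rn \<Longrightarrow> b \<in> carrier Rn \<Longrightarrow> a * b \<in> Q \<longleftrightarrow> a \<in> Q \<or> b \<in> Q"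
  using R.prime_mult[of Q a b] by simp
lemma prime_one': "primeideal Q Rn \<Longrightarrow> 1 \<notin> Q" using R.prime_one[of Q] by simp

definition monomial_span where "monomial_span C = {f \<in> carrier Rn. \<forall>u\<in>ks f. C u}"

lemma monomial_span_ideal: assumes "\<And>u v. C u \<Longrightarrow> C (u + v)" shows "ideal (monomial_span C) Rn"
proof (rule mk_ideal)
  fix a b assume "a \<in> monomial_span C" "b \<in> monomial_span C" thus "a + b \<in> monomial_span C" using keys_add[of a b] carr_add by (auto simp: monomial_span_def)
next
  fix a c assume a: "a \<in> monomial_span C" and c: "c \<in> carrier Rn"
  have "C u" if u: "u \<in> ks (c * a)" for u
  proof -
    obtain p q where "u = p + q" "p \<in> ks c" "q \<in> ks a" using u keys_mult[of c a] by blast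
    thus ?thesis using a assms[of q p] by (auto simp: monomial_span_def add.commute)
  qed
  thus "c * a \<in> monomial_span C" using carr_mult a c by (auto simp: monomial_span_def)
qed (auto simp: monomial_span_def carr_01)

text \<open>The ideal generated by the variables in \<open>Z\<close>, described by its monomials.\<close>

definition coord_prime where "coord_prime Z = monomial_span (\<lambda>u. ks u \<inter> Z \<noteq> {})"

lemma coord_prime_ideal: "ideal (coord_prime Z) Rn" unfolding coord_prime_def by (rule monomial_span_ideal) (auto simp: keys_add_nat)

text \<open>Modulo the ideal each polynomial can be replaced by its part in the remaining variables, and there the product
  of nonzero polynomials is nonzero.\<close>

lemma coord_prime_prime: "primeideal (coord_prime Z) Rn"
proof (rule R.make_prime[OF coord_prime_ideal])
  show "\<one>\<^bsub>Rn\<^esub> \<notin> coord_prime Z" by (simp add: coord_prime_def monomial_span_def)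
  fix f g assume *: "f \<in> carrier Rn" "g \<in> carrier Rn" "f \<otimes>\<^bsub>Rn\<^esub> g \<in> coord_prime Z" "f \<notin> coord_prime Z"
  show "g \<in> coord_prime Z"
  proof (rule ccontr)
    assume "g \<notin> coord_prime Z"
    let ?C = "\<lambda>u :: mon. ks u \<inter> Z = {}"
    define f0 g0 f1 g1 where d: "f0 = pfilter ?C f" "g0 = pfilter ?C g" "f1 = pfilter (\<lambda>u. \<not> ?C u) f" "g1 = pfilter (\<lambda>u. \<not> ?C u) g"
    have s: "f = f0 + f1" "g = g0 + g1" unfolding d by (rule pfilter_split)+
    have c: "f0 \<in> carrier Rn" "g0 \<in> carrier Rn" "f1 \<in> coord_prime Z" "g1 \<in> coord_prime Z"
      using *(1,2) by (auto simp: d carrier_iff coord_prime_def monomial_span_def keys_pfilter)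
    have "f0 \<noteq> 0" using s(1) c(3) *(4) by auto
    moreover have "g0 \<noteq> 0" using s(2) c(4) \<open>g \<notin> coord_prime Z\<close> by auto
    ultimately have "f0 * g0 \<noteq> 0" by simp
    then obtain u where u: "u \<in> ks (f0 * g0)" by (metis keys_eq_empty ex_in_conv)
    then obtain p q where pq: "u = p + q" "p \<in> ks f0" "q \<in> ks g0" using keys_mult[of f0 g0] by blast
    have "ks u \<inter> Z = {}" using pq by (auto simp: keys_add_nat d keys_pfilter)
    moreover have "f0 * g0 \<in> coord_prime Z"
    proof -
      have "f0 * g0 = f * g - (f1 * g + f0 * g1)" unfolding s by (simp add: algebra_simps)
      moreover have "f * g \<in> coord_prime Z" using *(3) by simp
      ultimately show ?thesis 
        using id_minus[OF coord_prime_ideal _ id_add[OF coord_prime_ideal id_mult'[OF coord_prime_ideal c(3) *(2)] id_mult[OF coord_prime_ideal c(4) c(1)]]] by metis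
    qed
    ultimately show False using u by (auto simp: coord_prime_def monomial_span_def)
  qed
qed

definition xvar :: "nat \<Rightarrow> (mon \<Rightarrow>\<^sub>0 'k)" where "xvar i = Poly_Mapping.single (Poly_Mapping.single i 1) 1"

lemma xvar_carr: "i \<in> {1..n} \<Longrightarrow> xvar i \<in> carrier Rn" by (simp add: xvar_def carrier_iff monomials_def)

lemma xvar_coord_prime: "i \<in> {1..n} \<Longrightarrow> xvar i \<in> coord_prime Z \<longleftrightarrow> i \<in> Z" using xvar_carr[of i] by (auto simp: xvar_def coord_prime_def monomial_span_def)

lemma coord_prime_mono: "Z \<subseteq> Y \<Longrightarrow> coord_prime Z \<subseteq> coord_prime Y" unfolding coord_prime_def monomial_span_def by blast

lemma single_split: "lk u i > 0 \<Longrightarrow> u = Poly_Mapping.single i 1 + (u - Poly_Mapping.single i 1)" for u :: mon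
  by (auto simp: poly_mapping_eq_iff fun_eq_iff lookup_add lookup_single when_def minus_poly_mapping.rep_eq)

lemma id_keys: assumes J: "ideal J Rn" and f: "f \<in> carrier Rn" and m: "\<And>u. u \<in> ks f \<Longrightarrow> Poly_Mapping.single u 1 \<in> J" shows "f \<in> J"
proof -
  have "f = (\<Sum>u\<in>ks f. Poly_Mapping.single u (lk f u))"
    by (rule poly_mapping_eqI) (auto simp: lookup_sum lookup_single when_def in_keys_iff)
  also have "\<dots> = (\<Sum>u\<in>ks f. Poly_Mapping.single 0 (lk f u) * Poly_Mapping.single u 1)" by (simp add: mult_single)
  also have "\<dots> \<in> J" using m by (intro id_sum[OF J] id_mult[OF J]) (auto simp: carrier_iff monomials_def)
  finally show ?thesis .
qed

lemma coord_prime_min: assumes J: "ideal J Rn" and "\<And>i. i \<in> Z \<Longrightarrow> i \<in> {1..n} \<Longrightarrow> xvar i \<in> J" shows "coord_prime Z \<subseteq> J"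
proof
  fix f assume f: "f \<in> coord_prime Z"
  show "f \<in> J"
  proof (rule id_keys[OF J])
    show "f \<in> carrier Rn" using f by (simp add: coord_prime_def monomial_span_def)
    fix u assume u: "u \<in> ks f"
    hence um: "u \<in> monomials n" and "ks u \<inter> Z \<noteq> {}" using f by (auto simp: coord_prime_def monomial_span_def carrier_iff)
    then obtain i where i: "i \<in> Z" "lk u i > 0" by (auto simp: in_keys_iff)
    hence "i \<in> ks u" by (simp add: in_keys_iff)
    hence ii: "i \<in> {1..n}" using um unfolding monomials_def by blast
    let ?w = "u - Poly_Mapping.single i 1"
    have "?w \<in> monomials n" using um monomials_add_iff single_split[OF i(2)] by metis
    hence "Poly_Mapping.single ?w 1 * xvar i \<in> J" using id_mult[OF J assms(2)[OF i(1) ii] carr_single] by blast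
    also have "Poly_Mapping.single ?w 1 * xvar i = Poly_Mapping.single u 1"
      unfolding xvar_def mult_single using single_split[OF i(2)] by (simp add: add.commute)
    finally show "Poly_Mapping.single u 1 \<in> J" .
  qed
qed

end

section \<open>Hilbert basis theorem and dimension of polynomial rings\<close>

lemma nat_mono_subseq: fixes s :: "nat \<Rightarrow> nat" shows "\<exists>r :: nat \<Rightarrow> nat. strict_mono r \<and> mono (\<lambda>k. s (r k))"
proof -
  obtain f where f: "strict_mono f" "monoseq (\<lambda>n. s (f n))" using seq_monosub by blast
  show ?thesis
  proof (cases "\<forall>m n. m \<le> n \<longrightarrow> s (f m) \<le> s (f n)")
    case True thus ?thesis using f(1) by (intro exI[of _ f]) (simp add: mono_def)
  next
    case False
    hence d: "\<And>m n. m \<le> n \<Longrightarrow> s (f n) \<le> s (f m)" using f(2) unfolding monoseq_def by blast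
    obtain N where N: "\<And>k. s (f N) \<le> s (f k)"
    proof -
      have "\<exists>x. \<forall>y. s (f x) \<le> s (f y)" using ex_has_least_nat[of "\<lambda>_. True" 0 "\<lambda>x. s (f x)"] by auto
      thus ?thesis using that by blast
    qed
    have c: "s (f (N + k)) = s (f N)" for k using d[of N "N + k"] N[of "N + k"] by simp
    have "strict_mono (\<lambda>k. f (N + k))" using f(1) by (simp add: strict_mono_def)
    thus ?thesis using c by (intro exI[of _ "\<lambda>k. f (N + k)"]) (simp add: mono_def)
  qed
qed

lemma dickson_subseq:
  fixes u :: "nat \<Rightarrow> mon"
  assumes "finite V" shows "\<exists>r :: nat \<Rightarrow> nat. strict_mono r \<and> (\<forall>v\<in>V. mono (\<lambda>k. lk (u (r k)) v))"
  using assms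
proof (induction V)
  case empty show ?case by (auto intro: exI[of _ id] simp: strict_mono_def)
next
  case (insert v V)
  then obtain r :: "nat \<Rightarrow> nat" where r: "strict_mono r" "\<forall>v\<in>V. mono (\<lambda>k. lk (u (r k)) v)" by blast
  obtain q :: "nat \<Rightarrow> nat" where q: "strict_mono q" "mono (\<lambda>k. lk (u (r (q k))) v)" using nat_mono_subseq[of "\<lambda>k. lk (u (r k)) v"] by blast
  have "mono (\<lambda>k. lk (u (r (q k))) w)" if "w \<in> V" for w
    using r(2) that q(1) unfolding mono_def by (meson strict_mono_less_eq)
  moreover have "strict_mono (\<lambda>k. r (q k))" using r(1) q(1) by (simp add: strict_mono_def)
  ultimately show ?case using q(2) by (intro exI[of _ "\<lambda>k. r (q k)"]) auto
qed

text \<open>Pass to a subsequence along which all exponents are nondecreasing.\<close>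

lemma dickson:
  fixes u :: "nat \<Rightarrow> mon"
  assumes "\<And>k. u k \<in> monomials n" shows "\<exists>i j w. i < j \<and> u j = w + u i \<and> w \<in> monomials n"
proof -
  obtain r :: "nat \<Rightarrow> nat" where r: "strict_mono r" "\<forall>v\<in>{1..n}. mono (\<lambda>k. lk (u (r k)) v)" using dickson_subseq[of "{1..n}" u] by auto
  have le: "lk (u (r 0)) v \<le> lk (u (r 1)) v" for v
  proof (cases "v \<in> {1..n}")
    case True thus ?thesis using r(2) by (auto simp: mono_def)
  next
    case False
    hence "v \<notin> ks (u (r 0))" using assms[of "r 0"] unfolding monomials_def by blast
    thus ?thesis by (simp add: in_keys_iff)
  qed
  let ?w = "u (r 1) - u (r 0)"
  have "u (r 1) = ?w + u (r 0)" by (rule poly_mapping_eqI) (use le in \<open>simp add: lookup_add minus_poly_mapping.rep_eq\<close>)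
  moreover from this have "?w \<in> monomials n" using assms[of "r 1"] monomials_add_iff by metis
  moreover have "r 0 < r 1" using r(1) by (simp add: strict_mono_def)
  ultimately show ?thesis by blast
qed

lemma mon_zero_le: "0 \<le> (u :: mon)"
proof (cases "u = 0")
  case False
  hence ne: "\<exists>k. lk u k \<noteq> 0" by (metis keys_eq_empty ex_in_conv in_keys_iff)
  define k where "k = (LEAST k. lk u k \<noteq> 0)"
  have k: "lk u k \<noteq> 0" unfolding k_def using ne by (rule LeastI_ex)
  have "lk u j = 0" if "j < k" for j using not_less_Least[of j "\<lambda>k. lk u k \<noteq> 0"] that unfolding k_def by blast
  hence "less_fun (lk 0) (lk u)" using k unfolding less_fun_def by (intro exI[of _ k]) auto
  thus ?thesis by (simp add: less_eq_poly_mapping.rep_eq)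
qed simp

text \<open>Divisibility is contained in the lexicographic order, so an infinite descent contradicts Dickson's lemma.\<close>

lemma wf_mon: "wf {(u, v :: mon). u < v \<and> u \<in> monomials n \<and> v \<in> monomials n}"
proof (rule ccontr)
  assume "\<not> ?thesis"
  then obtain f where f: "\<And>k. f (Suc k) < f k \<and> f (Suc k) \<in> monomials n \<and> f k \<in> monomials n" 
    unfolding wf_iff_no_infinite_down_chain by auto
  obtain i j w where w: "i < j" "f j = w + f i" using dickson[of f n] f by blast
  have "f j < f i" using w(1) f by (induction rule: less_Suc_induct) (auto intro: order.strict_trans)
  moreover have "f i \<le> f j" using add_right_mono[OF mon_zero_le[of w], of "f i"] w(2) by simp
  ultimately show False by simp
qed

context polynomials
begin

definition leading :: "(mon \<Rightarrow>\<^sub>0 'k) \<Rightarrow> mon" where "leading f = Max (ks f)"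

lemma leading_in: "f \<noteq> 0 \<Longrightarrow> leading f \<in> ks f" unfolding leading_def by (rule Max_in) auto

text \<open>Suppose that \<open>J\<close> is not finitely generated, and choose \<open>f\<^sub>0, f\<^sub>1, \<dots>\<close> in \<open>J\<close> such that \<open>f\<^sub>k\<close> has the least
  leading monomial outside the ideal of its predecessors. By Dickson's lemma some leading monomial divides a later one;
  subtracting the corresponding multiple contradicts the choice of the later polynomial.\<close>

lemma noeth_Rn: "noetherian_ring Rn"
proof (rule R.noetherian_ringI, rule ccontr)
  fix J assume J: "ideal J Rn" and nfg: "\<nexists>A. A \<subseteq> carrier Rn \<and> finite A \<and> J = Idl\<^bsub>Rn\<^esub> A"
  have Jc: "J \<subseteq> carrier Rn" using R.ideal_sub[OF J] .
  have ex: "\<exists>g\<in>J - Idl\<^bsub>Rn\<^esub> F. \<forall>h\<in>J - Idl\<^bsub>Rn\<^esub> F. \<not> leading h < leading g" if F: "finite F" "F \<subseteq> J" for F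
  proof -
    have i: "ideal (Idl\<^bsub>Rn\<^esub> F) Rn" using F Jc R.genideal_ideal by blast
    have nz: "h \<noteq> 0" if "h \<in> J - Idl\<^bsub>Rn\<^esub> F" for h using that id_zero[OF i] by auto
    have "Idl\<^bsub>Rn\<^esub> F \<subseteq> J" using R.genideal_minimal[OF J F(2)] .
    moreover have "Idl\<^bsub>Rn\<^esub> F \<noteq> J" using nfg F Jc by blast
    ultimately obtain g0 where g0: "g0 \<in> J - Idl\<^bsub>Rn\<^esub> F" by blast
    have "wf (inv_image {(u, v :: mon). u < v \<and> u \<in> monomials n \<and> v \<in> monomials n} leading)" by (rule wf_inv_image[OF wf_mon])
    from wfE_min[OF this g0] obtain g where g: "g \<in> J - Idl\<^bsub>Rn\<^esub> F" 
      "\<And>h. (h, g) \<in> inv_image {(u, v :: mon). u < v \<and> u \<in> monomials n \<and> v \<in> monomials n} leading \<Longrightarrow> h \<notin> J - Idl\<^bsub>Rn\<^esub> F" by blast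
    have mm: "leading h \<in> monomials n" if "h \<in> J - Idl\<^bsub>Rn\<^esub> F" for h
      using leading_in[OF nz[OF that]] that Jc carrier_iff[of h] by blast
    have "\<not> leading h < leading g" if "h \<in> J - Idl\<^bsub>Rn\<^esub> F" for h using g(2)[of h] mm[OF that] mm[OF g(1)] that by (auto simp: inv_image_def)
    thus ?thesis using g(1) by blast
  qed
  define ch where "ch F = (SOME g. g \<in> J - Idl\<^bsub>Rn\<^esub> F \<and> (\<forall>h\<in>J - Idl\<^bsub>Rn\<^esub> F. \<not> leading h < leading g))" for F
  have ch: "ch F \<in> J - Idl\<^bsub>Rn\<^esub> F \<and> (\<forall>h\<in>J - Idl\<^bsub>Rn\<^esub> F. \<not> leading h < leading (ch F))" if "finite F" "F \<subseteq> J" for F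
    unfolding ch_def by (rule someI_ex) (use ex[OF that] in \<open>simp only: Bex_def\<close>)
  define FF where "FF k = ((\<lambda>F. insert (ch F) F) ^^ k) {}" for k
  have FF: "finite (FF k) \<and> FF k \<subseteq> J" for k by (induction k) (use ch in \<open>auto simp: FF_def\<close>)
  define f where "f k = ch (FF k)" for k
  have f1: "f k \<in> J" "f k \<notin> Idl\<^bsub>Rn\<^esub> (FF k)" "\<And>h. h \<in> J \<Longrightarrow> h \<notin> Idl\<^bsub>Rn\<^esub> (FF k) \<Longrightarrow> \<not> leading h < leading (f k)" for k
    using ch[of "FF k"] FF[of k] unfolding f_def by auto
  have Fi: "ideal (Idl\<^bsub>Rn\<^esub> (FF k)) Rn" for k using FF Jc R.genideal_ideal by blast
  have fin: "f i \<in> Idl\<^bsub>Rn\<^esub> (FF j)" if "i < j" for i j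
  proof -
    have "f i \<in> FF j" using that
    proof (induction j)
      case (Suc j) thus ?case by (cases "i = j") (auto simp: FF_def f_def)
    qed simp
    thus ?thesis using R.genideal_self[of "FF j"] FF Jc by blast
  qed
  have nz: "f k \<noteq> 0" for k using f1(2) id_zero[OF Fi] by metis
  have "leading (f k) \<in> monomials n" for k using leading_in[OF nz[of k]] f1(1)[of k] Jc carrier_iff[of "f k"] by blast
  then obtain i j w where w: "i < j" "leading (f j) = w + leading (f i)" "w \<in> monomials n" using dickson[of "\<lambda>k. leading (f k)" n] by blast
  define c where "c = lk (f j) (leading (f j)) / lk (f i) (leading (f i))"
  define g where "g = Poly_Mapping.single w c * f i"
  define h where "h = f j - g"
  have gc: "g \<in> Idl\<^bsub>Rn\<^esub> (FF j)" unfolding g_def using w fin by (intro id_mult[OF Fi] carr_single)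
  have gJ: "g \<in> J" unfolding g_def using w f1 by (intro id_mult[OF J] carr_single)
  have hJ: "h \<in> J" unfolding h_def using f1 gJ by (intro id_minus[OF J])
  have hn: "h \<notin> Idl\<^bsub>Rn\<^esub> (FF j)" using id_add[OF Fi _ gc, of h] f1(2)[of j] by (auto simp: h_def)
  hence "h \<noteq> 0" using id_zero[OF Fi] by metis
  have "lk g (leading (f j)) = c * lk (f i) (leading (f i))" unfolding g_def w(2) lookup_mono_mult ..
  also have "\<dots> = lk (f j) (leading (f j))" unfolding c_def using leading_in[OF nz[of i]] by (simp add: in_keys_iff)
  finally have "leading (f j) \<notin> ks h" by (simp add: h_def in_keys_iff lookup_minus)
  moreover have "u \<le> leading (f j)" if "u \<in> ks h" for u
  proof -
    have "u \<in> ks (f j) \<or> u \<in> ks g" using that by (auto simp: h_def in_keys_iff lookup_minus)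
    thus ?thesis
    proof
      assume "u \<in> ks (f j)" thus ?thesis unfolding leading_def by simp
    next
      assume "u \<in> ks g"
      then obtain v where v: "u = w + v" "v \<in> ks (f i)" unfolding g_def using keys_mono_mult by blast
      hence "v \<le> leading (f i)" unfolding leading_def by simp
      thus ?thesis unfolding v w(2) by (rule add_left_mono)
    qed
  qed
  ultimately have "leading h < leading (f j)" using leading_in[OF \<open>h \<noteq> 0\<close>] by (metis order.strict_iff_order)
  thus False using f1(3)[OF hJ hn] by simp
qed

definition lists_lt :: "nat \<Rightarrow> nat \<Rightarrow> nat list set" where "lists_lt D l = {xs. set xs \<subseteq> {..<D} \<and> length xs = l}"

lemma finite_lists_lt: "finite (lists_lt D l)" unfolding lists_lt_def by (rule finite_lists_length_eq) simp

lemma card_lists_lt: "card (lists_lt D l) = D ^ l" unfolding lists_lt_def by (simp add: card_lists_length_eq)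

lemma lists_lt_Suc: "sum F (lists_lt D (Suc l)) = (\<Sum>k<D. \<Sum>xs\<in>lists_lt D l. F (k # xs))" for F :: "nat list \<Rightarrow> 'c::comm_monoid_add"
proof -
  have "lists_lt D (Suc l) = (\<lambda>(k, xs). k # xs) ` ({..<D} \<times> lists_lt D l)"
    by (auto simp: lists_lt_def image_iff length_Suc_conv)
  moreover have "inj_on (\<lambda>(k, xs). k # xs) ({..<D} \<times> lists_lt D l)" by (auto simp: inj_on_def)
  ultimately have "sum F (lists_lt D (Suc l)) = sum (F \<circ> (\<lambda>(k, xs). k # xs)) ({..<D} \<times> lists_lt D l)"
    using sum.reindex by metis
  thus ?thesis by (simp add: sum.cartesian_product case_prod_unfold)
qed

definition powers :: "(mon \<Rightarrow>\<^sub>0 'k) list \<Rightarrow> nat list \<Rightarrow> (mon \<Rightarrow>\<^sub>0 'k)" where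
  "powers as xs = prod_list (map2 (^) as xs)"

lemma powers_simps: "powers [] xs = 1" "powers (a # as) (x # xs) = a ^ x * powers as xs"
  by (auto simp: powers_def)

text \<open>Linear independence modulo \<open>P\<close> of the power products of \<open>as\<close> with all exponents below \<open>D\<close>.\<close>

definition indep_mod :: "nat \<Rightarrow> (mon \<Rightarrow>\<^sub>0 'k) set \<Rightarrow> (mon \<Rightarrow>\<^sub>0 'k) list \<Rightarrow> bool" where
  "indep_mod D P as \<longleftrightarrow> (\<forall>c. (\<Sum>xs\<in>lists_lt D (length as). Poly_Mapping.single 0 (c xs) * powers as xs) \<in> P \<longrightarrow>
     (\<forall>xs\<in>lists_lt D (length as). c xs = 0))"

lemma powers_carr: "set as \<subseteq> carrier Rn \<Longrightarrow> powers as xs \<in> carrier Rn"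
proof (induction as arbitrary: xs)
  case (Cons a as) thus ?case by (cases xs) (auto simp: powers_simps carr_mult carr_pow carr_01 powers_def)
qed (simp add: powers_simps carr_01)

lemma const_carr: "Poly_Mapping.single 0 c \<in> carrier Rn" by (simp add: carrier_iff monomials_def)

text \<open>Take the terms of a relation with the least exponent \<open>k\<close> of \<open>a\<close>. Since \<open>a\<close> is not in the prime \<open>P\<close>, the factor
  \<open>a\<^sup>k\<close> cancels; since \<open>a \<in> P'\<close>, all other terms vanish modulo \<open>P'\<close>, and these terms form a relation modulo \<open>P'\<close>.\<close>

lemma indep_mod_step:
  assumes P: "primeideal P Rn" and P': "ideal P' Rn" and sub: "P \<subseteq> P'" and a: "a \<in> P'" "a \<notin> P"
    and as: "set as \<subseteq> carrier Rn" and ind: "indep_mod D P' as"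
  shows "indep_mod D P (a # as)"
  unfolding indep_mod_def
proof (intro allI impI)
  fix c assume c: "(\<Sum>xs\<in>lists_lt D (length (a # as)). Poly_Mapping.single 0 (c xs) * powers (a # as) xs) \<in> P"
  define G where "G k = (\<Sum>xs\<in>lists_lt D (length as). Poly_Mapping.single 0 (c (k # xs)) * powers as xs)" for k
  have ac: "a \<in> carrier Rn" using a id_carr[OF P'] by blast
  have Pi: "ideal P Rn" using R.prime_ideal[OF P] .
  have Gc: "G k \<in> carrier Rn" for k unfolding G_def by (intro carr_sum carr_mult const_carr powers_carr as)
  have sumP: "(\<Sum>k<D. a ^ k * G k) \<in> P"
    using c by (simp add: lists_lt_Suc powers_simps G_def sum_distrib_left mult.left_commute)
  have "\<forall>xs\<in>lists_lt D (length as). c (k # xs) = 0" if "k < D" for k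
    using that
  proof (induction k rule: less_induct)
    case (less k)
    have z: "G j = 0" if "j < k" for j unfolding G_def using less.IH[OF that] that less.prems by simp
    have "(\<Sum>j<D. a ^ j * G j) = (\<Sum>j\<in>{k..<D}. a ^ j * G j)"
      by (rule sum.mono_neutral_right) (use z in auto)
    also have "\<dots> = a ^ k * G k + (\<Sum>j\<in>{Suc k..<D}. a ^ j * G j)" using less.prems by (simp add: sum.atLeast_Suc_lessThan)
    also have "(\<Sum>j\<in>{Suc k..<D}. a ^ j * G j) = a ^ k * (a * (\<Sum>j\<in>{Suc k..<D}. a ^ (j - Suc k) * G j))"
      unfolding sum_distrib_left 
    proof (rule sum.cong[OF refl])
      fix j assume "j \<in> {Suc k..<D}"
      hence "a ^ j = a ^ k * (a * a ^ (j - Suc k))" by (metis atLeastLessThan_iff le_add_diff_inverse power_Suc power_add Suc_eq_plus1 add.assoc add.commute plus_1_eq_Suc)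
      thus "a ^ j * G j = a ^ k * (a * (a ^ (j - Suc k) * G j))" by (simp add: mult.assoc)
    qed
    finally have "a ^ k * (G k + a * (\<Sum>j\<in>{Suc k..<D}. a ^ (j - Suc k) * G j)) \<in> P" using sumP by (simp add: distrib_left)
    moreover define E where "E = (\<Sum>j\<in>{Suc k..<D}. a ^ (j - Suc k) * G j)"
    have Ec: "E \<in> carrier Rn" unfolding E_def by (intro carr_sum carr_mult carr_pow ac Gc)
    have "a ^ k \<notin> P" using R.prime_pow[OF P ac, of k] a(2) by auto
    ultimately have "G k + a * E \<in> P" 
      using prime_mult'[OF P carr_pow[OF ac] carr_add[OF Gc carr_mult[OF ac Ec]]] unfolding E_def by blast
    hence "G k + a * E \<in> P'" using sub by blast
    hence "G k \<in> P'" by (rule id_add_cancel[OF P' _ id_mult'[OF P' a(1) Ec]])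
    thus ?case using ind unfolding indep_mod_def G_def by (elim allE[of _ "\<lambda>xs. c (k # xs)"]) blast
  qed
  thus "\<forall>xs\<in>lists_lt D (length (a # as)). c xs = 0" by (auto simp: lists_lt_def length_Suc_conv)
qed

definition poly_in :: "nat set \<Rightarrow> (mon \<Rightarrow>\<^sub>0 'k) set" where "poly_in T = {f \<in> carrier Rn. \<forall>u\<in>ks f. ks u \<subseteq> T}"

primrec mono_of :: "nat list \<Rightarrow> nat list \<Rightarrow> mon" where
  "mono_of [] xs = 0"
| "mono_of (t # ts) xs = (case xs of [] \<Rightarrow> 0 | x # xs \<Rightarrow> Poly_Mapping.single t x + mono_of ts xs)"

lemma xvar_pow: "xvar t ^ x = Poly_Mapping.single (Poly_Mapping.single t x) 1"
proof (induction x)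
  case 0
  have "(Poly_Mapping.single t 0 :: mon) = 0" by simp
  thus ?case by simp
next
  case (Suc x)
  have "Poly_Mapping.single t (1::nat) + Poly_Mapping.single t x = Poly_Mapping.single t (Suc x)"
    by (simp add: single_add[symmetric])
  thus ?case using Suc by (simp add: xvar_def mult_single)
qed

lemma powers_mono: "length xs = length ts \<Longrightarrow> powers (map xvar ts) xs = Poly_Mapping.single (mono_of ts xs) 1"
proof (induction ts arbitrary: xs)
  case (Cons t ts) thus ?case by (cases xs) (auto simp: powers_simps xvar_pow mult_single)
qed (simp add: powers_simps)

lemma keys_mono_of: "length xs = length ts \<Longrightarrow> ks (mono_of ts xs) \<subseteq> set ts"
proof (induction ts arbitrary: xs)
  case (Cons t ts) thus ?case by (cases xs) (auto simp: keys_add_nat split: if_splits)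
qed simp

lemma mono_of_inj: "distinct ts \<Longrightarrow> length xs = length ts \<Longrightarrow> length ys = length ts \<Longrightarrow> mono_of ts xs = mono_of ts ys \<Longrightarrow> xs = ys"
proof (induction ts arbitrary: xs ys)
  case (Cons t ts)
  obtain x xs' where xs: "xs = x # xs'" "length xs' = length ts" using Cons.prems by (cases xs) auto
  obtain y ys' where ys: "ys = y # ys'" "length ys' = length ts" using Cons.prems by (cases ys) auto
  have e: "Poly_Mapping.single t x + mono_of ts xs' = Poly_Mapping.single t y + mono_of ts ys'" using Cons.prems xs ys by simp
  have "lk (mono_of ts xs') t = 0" "lk (mono_of ts ys') t = 0"
    using keys_mono_of[OF xs(2)] keys_mono_of[OF ys(2)] Cons.prems(1) by (auto simp: in_keys_iff subset_iff)
  hence "x = y" using arg_cong[OF e, of "\<lambda>u. lk u t"] by (simp add: lookup_add)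
  hence "mono_of ts xs' = mono_of ts ys'" using e by simp
  thus ?case using Cons.IH[OF _ xs(2) ys(2)] Cons.prems(1) xs ys \<open>x = y\<close> by simp
qed simp

lemma indep_mod_vars:
  assumes T: "set ts \<subseteq> {1..n}" "distinct ts" and P: "\<And>f. f \<in> P \<Longrightarrow> f \<in> poly_in (set ts) \<Longrightarrow> f = 0"
  shows "indep_mod D P (map xvar ts)"
  unfolding indep_mod_def
proof (intro allI impI ballI)
  fix c xs assume c: "(\<Sum>xs\<in>lists_lt D (length (map xvar ts)). Poly_Mapping.single 0 (c xs) * powers (map xvar ts) xs) \<in> P"
    and xs: "xs \<in> lists_lt D (length (map xvar ts))"
  define S where "S = (\<Sum>xs\<in>lists_lt D (length ts). Poly_Mapping.single (mono_of ts xs) (c xs))"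
  have eq: "(\<Sum>xs\<in>lists_lt D (length (map xvar ts)). Poly_Mapping.single 0 (c xs) * powers (map xvar ts) xs) = S"
    unfolding S_def by (intro sum.cong) (auto simp: lists_lt_def powers_mono mult_single)
  have l: "lk S (mono_of ts ys) = c ys" if ys: "ys \<in> lists_lt D (length ts)" for ys
  proof -
    have "lk S (mono_of ts ys) = (\<Sum>xs\<in>lists_lt D (length ts). if xs = ys then c xs else 0)"
      unfolding S_def lookup_sum lookup_single when_def
      by (rule sum.cong) (use mono_of_inj[OF T(2)] ys in \<open>auto simp: lists_lt_def\<close>)
    thus ?thesis using ys finite_lists_lt by simp
  qed
  have k: "ks u \<subseteq> set ts" if "u \<in> ks S" for u
  proof -
    have "\<exists>ys\<in>lists_lt D (length ts). u = mono_of ts ys"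
    proof (rule ccontr)
      assume "\<not> ?thesis"
      hence "lk S u = 0" unfolding S_def lookup_sum lookup_single when_def by (intro sum.neutral) auto
      thus False using that by (simp add: in_keys_iff)
    qed
    thus ?thesis using keys_mono_of by (auto simp: lists_lt_def)
  qed
  have "S \<in> poly_in (set ts)" unfolding poly_in_def using k T(1) by (auto simp: carrier_iff monomials_def subset_iff) 
  hence "S = 0" using P c eq by simp
  thus "c xs = 0" using l xs by simp
qed

lemma vs_K: "vector_space (\<lambda>c (p :: mon \<Rightarrow>\<^sub>0 'k). Poly_Mapping.single 0 c * p)"
  by unfold_locales (auto simp: distrib_left distrib_right single_add mult_single mult.assoc[symmetric])

definition box :: "nat \<Rightarrow> mon set" where "box B = {u \<in> monomials n. \<forall>v. lk u v \<le> B}"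

lemma box_card: "finite (box B) \<and> card (box B) \<le> (B + 1) ^ n"
proof -
  define f where "f u = map (lk u) [1..<Suc n]" for u :: mon
  have "inj_on f (box B)"
  proof (rule inj_onI)
    fix u v assume uv: "u \<in> box B" "v \<in> box B" "f u = f v"
    have "lk u i = lk v i" for i
    proof (cases "i \<in> {1..n}")
      case True thus ?thesis using uv(3) unfolding f_def by auto
    next
      case False
      hence "i \<notin> ks u" "i \<notin> ks v" using uv unfolding box_def monomials_def by blast+
      thus ?thesis by (simp add: in_keys_iff)
    qed
    thus "u = v" by (rule poly_mapping_eqI)
  qed
  moreover have "f ` box B \<subseteq> lists_lt (B + 1) n" by (auto simp: f_def box_def lists_lt_def less_Suc_eq_le)
  ultimately show ?thesis using finite_lists_lt[of "B + 1" n] card_lists_lt[of "B + 1" n] 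
    by (metis card_inj_on_le finite_imageD finite_subset)
qed

lemma exp_bound: assumes "finite A" shows "\<exists>d. \<forall>p\<in>A. \<forall>u\<in>ks (p :: mon \<Rightarrow>\<^sub>0 'k). \<forall>v. lk u v \<le> d"
proof -
  define U where "U = (\<Union>p\<in>A. \<Union>u\<in>ks p. lk u ` ks u)"
  have "finite U" unfolding U_def using assms by auto
  have "lk u v \<le> Max (insert 0 U)" if "p \<in> A" "u \<in> ks p" for p u v
  proof (cases "v \<in> ks u")
    case True
    hence "lk u v \<in> U" unfolding U_def using that by blast
    thus ?thesis using \<open>finite U\<close> by (intro Max_ge) auto
  qed (simp add: in_keys_iff)
  thus ?thesis by blast
qed

lemma powers_bound:
  assumes "\<forall>p\<in>set as. \<forall>u\<in>ks p. \<forall>v. lk u v \<le> d" "xs \<in> lists_lt D (length as)" "u \<in> ks (powers as xs)"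
  shows "lk u v \<le> length as * D * d"
  using assms
proof (induction as arbitrary: xs u)
  case (Cons a as)
  obtain x xs' where xs: "xs = x # xs'" "xs' \<in> lists_lt D (length as)" "x < D" using Cons.prems(2) by (auto simp: lists_lt_def length_Suc_conv)
  have ap: "lk u v \<le> x * d" if "u \<in> ks (a ^ x)" for u x using that
  proof (induction x arbitrary: u)
    case (Suc x)
    then obtain p q where "u = p + q" "p \<in> ks a" "q \<in> ks (a ^ x)" using keys_mult[of a "a ^ x"] by auto
    thus ?case using Suc.IH[of q] Cons.prems(1) by (auto simp: lookup_add intro!: add_mono)
  qed simp
  obtain p q where pq: "u = p + q" "p \<in> ks (a ^ x)" "q \<in> ks (powers as xs')"
    using Cons.prems(3) keys_mult[of "a ^ x" "powers as xs'"] unfolding xs powers_simps by blast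
  have "lk p v \<le> D * d" using ap[OF pq(2)] xs(3) by (meson le_trans less_imp_le mult_le_mono1)
  moreover have "lk q v \<le> length as * D * d" using Cons.IH[OF _ xs(2) pq(3)] Cons.prems(1) by simp
  ultimately show ?case by (simp add: pq lookup_add algebra_simps)
qed (simp add: powers_simps)

text \<open>Counting: \<open>D^N\<close> independent power products of \<open>N\<close> polynomials lie in a space of dimension \<open>O(D^n)\<close>.\<close>

lemma indep_mod_card:
  assumes as: "set as \<subseteq> carrier Rn" and ind: "\<And>D. indep_mod D P as" and P: "0 \<in> P"
  shows "length as \<le> n"
proof (rule ccontr)
  assume N: "\<not> length as \<le> n"
  obtain d where d: "\<forall>p\<in>set as. \<forall>u\<in>ks p. \<forall>v. lk u v \<le> d" using exp_bound[of "set as"] by auto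
  \<comment> \<open>\<open>M\<close> bounds the growth of exponents; with this \<open>D\<close> the \<open>D ^ Suc n\<close> products exceed the dimension \<open>(D * M) ^ n\<close>\<close>
  define M where "M = length as * d + 1"
  define D where "D = M ^ n + 1"
  interpret vs: vector_space "\<lambda>c (p :: mon \<Rightarrow>\<^sub>0 'k). Poly_Mapping.single 0 c * p" by (rule vs_K)
  let ?L = "lists_lt D (length as)"
  have inj: "inj_on (powers as) ?L"
  proof (rule inj_onI, rule ccontr)
    fix xs ys assume *: "xs \<in> ?L" "ys \<in> ?L" "powers as xs = powers as ys" "xs \<noteq> ys"
    define c :: "nat list \<Rightarrow> 'k" where "c zs = (if zs = xs then 1 else if zs = ys then -1 else 0)" for zs
    have "(\<Sum>zs\<in>?L. Poly_Mapping.single 0 (c zs) * powers as zs) = (\<Sum>zs\<in>{xs, ys}. Poly_Mapping.single 0 (c zs) * powers as zs)"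
      by (rule sum.mono_neutral_right) (use * finite_lists_lt in \<open>auto simp: c_def\<close>)
    also have "\<dots> = 0" using *(3,4) by (simp add: c_def single_uminus)
    finally have "c xs = 0" using ind[of D] P *(1) unfolding indep_mod_def by metis
    thus False by (simp add: c_def)
  qed
  have indp: "vs.independent (powers as ` ?L)"
  proof
    assume "vs.dependent (powers as ` ?L)"
    then obtain u where u: "\<exists>v\<in>powers as ` ?L. u v \<noteq> 0" "(\<Sum>v\<in>powers as ` ?L. Poly_Mapping.single 0 (u v) * v) = 0"
      using vs.dependent_finite[of "powers as ` ?L"] finite_lists_lt by auto
    have "(\<Sum>xs\<in>?L. Poly_Mapping.single 0 (u (powers as xs)) * powers as xs) = 0" 
      using u(2) sum.reindex[OF inj, of "\<lambda>v. Poly_Mapping.single 0 (u v) * v"] by (simp add: comp_def)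
    hence "\<forall>xs\<in>?L. u (powers as xs) = 0" using ind[of D] P unfolding indep_mod_def 
      by (elim allE[of _ "\<lambda>xs. u (powers as xs)"]) auto
    thus False using u(1) by blast
  qed
  define B where "B = length as * D * d"
  let ?T = "(\<lambda>u. Poly_Mapping.single u (1::'k)) ` box B"
  have "powers as ` ?L \<subseteq> vs.span ?T"
  proof clarify
    fix xs assume xs: "xs \<in> ?L"
    let ?p = "powers as xs"
    have pc: "?p \<in> carrier Rn" using as by (rule powers_carr)
    have "?p = (\<Sum>u\<in>ks ?p. Poly_Mapping.single u (lk ?p u))"
      by (rule poly_mapping_eqI) (auto simp: lookup_sum lookup_single when_def in_keys_iff)
    also have "\<dots> = (\<Sum>u\<in>ks ?p. Poly_Mapping.single 0 (lk ?p u) * Poly_Mapping.single u 1)" by (simp add: mult_single)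
    also have "\<dots> \<in> vs.span ?T"
      using powers_bound[OF d xs] pc by (intro vs.span_sum vs.span_scale vs.span_base) (auto simp: box_def B_def carrier_iff)
    finally show "?p \<in> vs.span ?T" .
  qed
  from vs.independent_span_bound[OF _ indp this] have "card (powers as ` ?L) \<le> card ?T" using box_card by auto
  also have "\<dots> \<le> card (box B)" using box_card by (intro card_image_le) auto
  also have "\<dots> \<le> (B + 1) ^ n" using box_card by blast
  also have "\<dots> \<le> (D * M) ^ n" unfolding B_def M_def D_def by (intro power_mono) (auto simp: algebra_simps)
  finally have "D ^ length as \<le> D ^ n * M ^ n" using card_image[OF inj] card_lists_lt by (simp add: power_mult_distrib)
  moreover have "D ^ n * D \<le> D ^ length as" 
    using N power_increasing[of "Suc n" "length as" D] by (simp add: D_def mult.commute)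
  ultimately have "D ^ n * D \<le> D ^ n * M ^ n" by linarith
  thus False by (simp add: D_def)
qed

text \<open>Coquand and Lombardi's proof that \<open>dim K[x\<^sub>1, \<dots>, x\<^sub>n] \<le> n\<close>, extended by variables that are independent modulo the
  last prime: elements \<open>a\<^sub>i \<in> P\<^sub>i\<^sub>+\<^sub>1 - P\<^sub>i\<close> together with the variables in \<open>T\<close> are algebraically independent.
  A suitable \<open>T\<close> makes the bound sharp at every prime.\<close>

theorem chain_length_bound:
  assumes ps: "prime_chain Rn ps" and T: "T \<subseteq> {1..n}" and PT: "\<And>f. f \<in> last ps \<Longrightarrow> f \<in> poly_in T \<Longrightarrow> f = 0"
  shows "length ps + card T \<le> Suc n"
proof -
  have fT: "finite T" using T finite_subset by blast
  obtain ts where ts: "set ts = T" "distinct ts" using finite_distinct_list[OF fT] by blast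
  have "\<exists>as. Suc (length as) = length ps \<and> set as \<subseteq> carrier Rn \<and> (\<forall>D. indep_mod D (hd ps) (as @ map xvar ts))"
    using ps PT
  proof (induction ps)
    case (Cons P ps)
    show ?case
    proof (cases ps)
      case Nil
      have "indep_mod D P (map xvar ts)" for D using Cons.prems(2) ts T Nil by (intro indep_mod_vars) auto
      thus ?thesis using Nil by (intro exI[of _ "[]"]) auto
    next
      case (Cons Q qs)
      note ps = Cons
      have "prime_chain Rn ps" using Cons.prems(1) ps by (auto simp: prime_chain_def)
      with Cons.IH Cons.prems ps obtain as where as: "Suc (length as) = length ps" "set as \<subseteq> carrier Rn" 
        "\<forall>D. indep_mod D Q (as @ map xvar ts)" by auto
      have PQ: "P \<subset> Q" "primeideal P Rn" "primeideal Q Rn" using Cons.prems(1) ps by (auto simp: prime_chain_def)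
      then obtain a where a: "a \<in> Q" "a \<notin> P" by blast
      have vc: "set (map xvar ts) \<subseteq> carrier Rn" using ts T xvar_carr by auto
      have Qi: "ideal Q Rn" using R.prime_ideal PQ by blast
      have "indep_mod D P (a # as @ map xvar ts)" for D
        using as vc PQ(1) by (intro indep_mod_step[OF PQ(2) Qi _ a]) auto
      thus ?thesis using as a id_carr[OF Qi] by (intro exI[of _ "a # as"]) auto
    qed
  qed (simp add: prime_chain_def)
  then obtain as where as: "Suc (length as) = length ps" "set as \<subseteq> carrier Rn" "\<And>D. indep_mod D (hd ps) (as @ map xvar ts)" by blast
  have "primeideal (hd ps) Rn" using ps by (cases ps) (auto simp: prime_chain_def)
  hence "0 \<in> hd ps" using id_zero R.prime_ideal by blast
  moreover have "set (as @ map xvar ts) \<subseteq> carrier Rn" using as ts T xvar_carr by auto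
  ultimately have "length (as @ map xvar ts) \<le> n" using as(3) indep_mod_card by blast
  thus ?thesis using as(1) ts distinct_card[OF ts(2)] by simp
qed

end

section \<open>Regular sequences modulo coordinate primes\<close>

context polynomials
begin

lemma vfree_carr: assumes "f \<in> carrier Rn" shows "coef v k f \<in> carrier Rn"
proof -
  have "u \<in> monomials n" if "u \<in> ks (coef v k f)" for u
    using that assms monomials_add_iff[of u "Poly_Mapping.single v k" n] unfolding keys_coef carrier_iff by blast
  thus ?thesis unfolding carrier_iff by blast
qed

lemma poly_in_mult: assumes "f \<in> poly_in T" "g \<in> poly_in T" shows "f * g \<in> poly_in T"
proof -
  have "ks u \<subseteq> T" if u: "u \<in> ks (f * g)" for u
  proof -
    obtain p q where "u = p + q" "p \<in> ks f" "q \<in> ks g" using u keys_mult[of f g] by blast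
    thus ?thesis using assms by (auto simp: poly_in_def keys_add_nat)
  qed
  thus ?thesis using assms carr_mult by (auto simp: poly_in_def)
qed

lemma poly_in_carr: "f \<in> poly_in T \<Longrightarrow> f \<in> carrier Rn" by (simp add: poly_in_def)

lemma poly_in_one: "1 \<in> poly_in T" using carr_01 by (simp add: poly_in_def)

lemma poly_in_pfree: "f \<in> poly_in T \<Longrightarrow> v \<notin> T \<Longrightarrow> pfree v f"
  unfolding poly_in_def pfree_def by (auto simp: subset_iff in_keys_iff)

lemma poly_in_coef: assumes "p \<in> poly_in (insert v T)" "v \<notin> T" shows "coef v k p \<in> poly_in T"
proof -
  have "ks u \<subseteq> T" if u: "u \<in> ks (coef v k p)" for u
  proof -
    have 1: "lk u v = 0" "u + Poly_Mapping.single v k \<in> ks p" using u by (auto simp: keys_coef)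
    have "ks (u + Poly_Mapping.single v k) \<subseteq> insert v T" using 1(2) assms(1) by (auto simp: poly_in_def)
    moreover have "v \<notin> ks u" using 1(1) by (simp add: in_keys_iff)
    ultimately show ?thesis by (auto simp: keys_add_nat)
  qed
  thus ?thesis unfolding poly_in_def using vfree_carr[OF poly_in_carr[OF assms(1)]] by blast
qed

text \<open>The kernel of \<open>R \<rightarrow> S\<^sup>-\<^sup>1(R/J)\<close> for the set \<open>S\<close> of nonzero polynomials in the variables \<open>T\<close>.\<close>

definition upto_saturated :: "nat set \<Rightarrow> (mon \<Rightarrow>\<^sub>0 'k) set \<Rightarrow> (mon \<Rightarrow>\<^sub>0 'k) set" where
  "upto_saturated T J = {a \<in> carrier Rn. \<exists>s\<in>poly_in T. s \<noteq> 0 \<and> s * a \<in> J}"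

lemma upto_saturated_ideal: assumes J: "ideal J Rn" shows "ideal (upto_saturated T J) Rn"
proof (rule mk_ideal)
  show "0 \<in> upto_saturated T J" unfolding upto_saturated_def using poly_in_one id_zero[OF J] carr_01 by (auto intro!: bexI[of _ 1])
  fix a b assume a: "a \<in> upto_saturated T J" and b: "b \<in> upto_saturated T J"
  then obtain s t where s: "s \<in> poly_in T" "s \<noteq> 0" "s * a \<in> J" "t \<in> poly_in T" "t \<noteq> 0" "t * b \<in> J" 
    "a \<in> carrier Rn" "b \<in> carrier Rn" by (auto simp: upto_saturated_def)
  have "s * t * (a + b) = t * (s * a) + s * (t * b)" by (simp add: algebra_simps)
  also have "\<dots> \<in> J" by (rule id_add[OF J id_mult[OF J s(3) poly_in_carr[OF s(4)]] id_mult[OF J s(6) poly_in_carr[OF s(1)]]])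
  finally show "a + b \<in> upto_saturated T J" unfolding upto_saturated_def using s poly_in_mult carr_add by (auto intro!: bexI[of _ "s * t"])
next
  fix a c assume a: "a \<in> upto_saturated T J" and c: "c \<in> carrier Rn"
  then obtain s where s: "s \<in> poly_in T" "s \<noteq> 0" "s * a \<in> J" "a \<in> carrier Rn" by (auto simp: upto_saturated_def)
  have "s * (c * a) = c * (s * a)" by (simp add: algebra_simps)
  also have "\<dots> \<in> J" by (rule id_mult[OF J s(3) c])
  finally show "c * a \<in> upto_saturated T J" unfolding upto_saturated_def using s c carr_mult by auto
qed (auto simp: upto_saturated_def)

lemma upto_saturated_sup: assumes J: "ideal J Rn" shows "J \<subseteq> upto_saturated T J"
  unfolding upto_saturated_def using poly_in_one id_carr[OF J] by (auto intro!: bexI[of _ 1])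

text \<open>Read \<open>p\<close> and \<open>g\<close> as polynomials in \<open>x\<^sub>v\<close>. The leading coefficient of \<open>p\<close> is a nonzero polynomial in the variables \<open>T\<close>;
  the top coefficient of \<open>g\<close> that is not in the saturation would therefore survive in \<open>p g\<close>.\<close>

lemma nzd_upto_saturated:
  assumes J: "ideal J Rn" and Jf: "\<And>g k. g \<in> J \<Longrightarrow> coef v k g \<in> J" and v: "v \<in> {1..n}" "v \<notin> T"
    and p: "p \<in> poly_in (insert v T)" "p \<noteq> 0" and g: "g \<in> carrier Rn" "p * g \<in> J"
  shows "g \<in> upto_saturated T J"
proof -
  note S = upto_saturated_ideal[OF J, of T]
  obtain N where N: "\<forall>u\<in>ks p. lk u v \<le> N" by (rule coef_bound)
  obtain M where M: "\<forall>u\<in>ks g. lk u v \<le> M" by (rule coef_bound)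
  have exD: "\<exists>j\<le>N. coef v j p \<noteq> 0"
  proof (rule ccontr)
    assume "\<not> ?thesis"
    hence "p = 0" using coef_sum[OF N] by simp
    thus False using p by simp
  qed
  define D where "D = Max {j. j \<le> N \<and> coef v j p \<noteq> 0}"
  have "D \<in> {j. j \<le> N \<and> coef v j p \<noteq> 0}" unfolding D_def using exD by (intro Max_in) auto
  hence D: "coef v D p \<noteq> 0" by simp
  have Dmax: "coef v j p = 0" if "j > D" for j
  proof (rule ccontr)
    assume *: "coef v j p \<noteq> 0"
    hence "j \<le> N" using coef_beyond[OF N, of j] by (meson not_le)
    hence "j \<le> D" unfolding D_def using * by (intro Max_ge) auto
    thus False using that by simp
  qed
  have cg: "coef v k g \<in> upto_saturated T J" for k
  proof (induction "Suc M - k" arbitrary: k rule: less_induct)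
    case less
    show ?case
    proof (cases "k \<le> M")
      case False
      thus ?thesis using coef_beyond[OF M, of k] id_zero[OF S] by simp
    next
      case True
      have IH: "coef v j g \<in> upto_saturated T J" if "j > k" for j using that True by (intro less.hyps) auto
      have "coef v (D + k) (p * g) = (\<Sum>j\<le>D+k. coef v j p * coef v (D + k - j) g)" by (rule coef_mult)
      also have "\<dots> = coef v D p * coef v (D + k - D) g + (\<Sum>j\<in>{..D+k} - {D}. coef v j p * coef v (D + k - j) g)"
        by (rule sum.remove) auto
      finally have e: "coef v (D + k) (p * g) = coef v D p * coef v k g + (\<Sum>j\<in>{..D+k} - {D}. coef v j p * coef v (D + k - j) g)" by simp
      have r: "(\<Sum>j\<in>{..D+k} - {D}. coef v j p * coef v (D + k - j) g) \<in> upto_saturated T J"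
      proof (rule id_sum[OF S])
        fix j assume j: "j \<in> {..D+k} - {D}"
        show "coef v j p * coef v (D + k - j) g \<in> upto_saturated T J"
        proof (cases "j > D")
          case True thus ?thesis using Dmax id_zero[OF S] by simp
        next
          case False
          hence "D + k - j > k" using j by auto
          thus ?thesis using IH poly_in_carr poly_in_coef[OF p(1) v(2)] by (intro id_mult[OF S]) auto
        qed
      qed
      have "coef v (D + k) (p * g) \<in> upto_saturated T J" using Jf[OF g(2)] upto_saturated_sup[OF J] by blast
      hence "coef v D p * coef v k g \<in> upto_saturated T J" unfolding e using id_add_cancel[OF S _ r] by blast
      then obtain s where s: "s \<in> poly_in T" "s \<noteq> 0" "s * (coef v D p * coef v k g) \<in> J" by (auto simp: upto_saturated_def)
      thus ?thesis unfolding upto_saturated_def using D poly_in_mult[OF s(1) poly_in_coef[OF p(1) v(2), of D]] vfree_carr[OF g(1)]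
        by (auto intro!: bexI[of _ "s * coef v D p"] simp: mult.assoc)
    qed
  qed
  have "g = (\<Sum>k\<le>M. Poly_Mapping.single (Poly_Mapping.single v k) 1 * coef v k g)" by (rule coef_sum[OF M])
  also have "\<dots> \<in> upto_saturated T J"
    using v cg by (intro id_sum[OF S] id_mult[OF S] carr_single) (auto simp: monomials_def)
  finally show ?thesis .
qed

lemma coord_prime_free: assumes "g \<in> coord_prime Z" "v \<notin> Z" shows "coef v k g \<in> coord_prime Z"
proof -
  have "ks u \<inter> Z \<noteq> {}" if "u \<in> ks (coef v k g)" for u
  proof -
    have "u + Poly_Mapping.single v k \<in> ks g" using that by (simp add: keys_coef)
    hence "ks (u + Poly_Mapping.single v k) \<inter> Z \<noteq> {}" using assms(1) by (auto simp: coord_prime_def monomial_span_def)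
    thus ?thesis using assms(2) by (auto simp: keys_add_nat split: if_splits)
  qed
  thus ?thesis using assms(1) vfree_carr by (auto simp: coord_prime_def monomial_span_def)
qed

lemma coord_prime_strict: "z \<in> {1..n} \<Longrightarrow> z \<notin> Z \<Longrightarrow> coord_prime Z \<subset> coord_prime (insert z Z)"
  using coord_prime_mono[of Z "insert z Z"] xvar_coord_prime[of z Z] xvar_coord_prime[of z "insert z Z"] by blast

lemma coord_prime_chain: assumes "finite Z" "Z \<subseteq> {1..n}"
  shows "\<exists>qs. length qs = card Z \<and> (\<forall>P\<in>set qs. primeideal P Rn) \<and> sorted_wrt (\<subset>) (qs @ [coord_prime Z])"
  using assms
proof (induction Z)
  case (insert z F)
  then obtain qs where qs: "length qs = card F" "\<forall>P\<in>set qs. primeideal P Rn" "sorted_wrt (\<subset>) (qs @ [coord_prime F])" by auto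
  have s: "coord_prime F \<subset> coord_prime (insert z F)" using insert by (intro coord_prime_strict) auto
  have "sorted_wrt (\<subset>) ((qs @ [coord_prime F]) @ [coord_prime (insert z F)])"
    using qs(3) s by (auto simp: sorted_wrt_append)
  thus ?case using qs insert coord_prime_prime by (intro exI[of _ "qs @ [coord_prime F]"]) auto
qed simp

text \<open>A chain above \<open>coord_prime Z\<close> can be prolonged downwards by \<open>card Z\<close> coordinate primes.\<close>

theorem chain_length_above_coord_prime:
  assumes ps: "prime_chain Rn ps" and T: "T \<subseteq> {1..n}" and PT: "\<And>f. f \<in> last ps \<Longrightarrow> f \<in> poly_in T \<Longrightarrow> f = 0"
    and Z: "Z \<subseteq> {1..n}" "coord_prime Z \<subseteq> hd ps"
  shows "length ps + card Z + card T \<le> Suc n"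
proof -
  obtain qs where qs: "length qs = card Z" "\<forall>P\<in>set qs. primeideal P Rn" "sorted_wrt (\<subset>) (qs @ [coord_prime Z])"
    using coord_prime_chain[of Z] Z finite_subset by blast
  obtain p ps' where p: "ps = p # ps'" using ps by (cases ps) (auto simp: prime_chain_def)
  have "Q \<subset> P" if "Q \<in> set qs" "P \<in> set ps" for P Q
  proof -
    have "Q \<subset> coord_prime Z" using qs(3) that by (auto simp: sorted_wrt_append)
    moreover have "p \<subseteq> P" using that ps unfolding p prime_chain_def by auto
    ultimately show ?thesis using Z(2) p by auto
  qed
  hence "prime_chain Rn (qs @ ps)" using qs ps unfolding prime_chain_def by (auto simp: sorted_wrt_append)
  moreover have "last (qs @ ps) = last ps" using p by simp
  ultimately have "length (qs @ ps) + card T \<le> Suc n" using chain_length_bound[of "qs @ ps" T] T PT by simp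
  thus ?thesis using qs by simp
qed

lemma poly_in_empty: assumes "f \<in> poly_in {}" obtains c where "f = Poly_Mapping.single 0 c"
proof -
  have "ks f \<subseteq> {0}" using assms by (auto simp: poly_in_def)
  hence "f = Poly_Mapping.single 0 (lk f 0)" 
    by (intro poly_mapping_eqI) (auto simp: lookup_single when_def in_keys_iff subset_iff)
  thus ?thesis using that by blast
qed

text \<open>Take \<open>T\<close> maximal among the sets of variables that are algebraically independent modulo \<open>m\<close>.\<close>

lemma transcendence_basis_exists:
  assumes m: "ideal m Rn" "1 \<notin> m"
  shows "\<exists>T\<subseteq>{1..n}. (\<forall>f\<in>m. f \<in> poly_in T \<longrightarrow> f = 0) \<and> (\<forall>v\<in>{1..n}-T. \<exists>p\<in>m. p \<in> poly_in (insert v T) \<and> p \<noteq> 0)"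
proof -
  define S where "S = {T. T \<subseteq> {1..n} \<and> (\<forall>f\<in>m. f \<in> poly_in T \<longrightarrow> f = 0)}"
  have fS: "finite S" unfolding S_def by (rule finite_subset[of _ "Pow {1..n}"]) auto
  have eS: "{} \<in> S"
  proof -
    have "f = 0" if f: "f \<in> m" "f \<in> poly_in {}" for f
    proof (rule ccontr)
      assume "f \<noteq> 0"
      obtain c where c: "f = Poly_Mapping.single 0 c" using f poly_in_empty by blast
      with \<open>f \<noteq> 0\<close> have "c \<noteq> 0" by auto
      have "Poly_Mapping.single 0 (1 / c) * f \<in> m" using f by (intro id_mult[OF m(1)] const_carr)
      thus False using c \<open>c \<noteq> 0\<close> m(2) by (simp add: mult_single)
    qed
    thus ?thesis by (simp add: S_def)
  qed
  obtain T where T: "T \<in> S" "\<And>T'. T' \<in> S \<Longrightarrow> T \<subseteq> T' \<Longrightarrow> T' = T"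
  proof -
    from finite_has_maximal2[OF fS eS] obtain T where "T \<in> S" "\<forall>b\<in>S. T \<subseteq> b \<longrightarrow> T = b" by blast
    thus ?thesis using that by blast
  qed
  have "\<exists>p\<in>m. p \<in> poly_in (insert v T) \<and> p \<noteq> 0" if "v \<in> {1..n}-T" for v
  proof (rule ccontr)
    assume "\<not> ?thesis"
    hence "insert v T \<in> S" using T(1) that by (auto simp: S_def)
    thus False using T(2) that by blast
  qed
  thus ?thesis using T(1) unfolding S_def by blast
qed

end

locale localized_polynomials = polynomials n tk + L: localized_ring "mpoly_ring n :: (mon \<Rightarrow>\<^sub>0 'k) ring" A \<phi> m I0
  for n and tk :: "'k::field itself" and A :: "('b, 'c) ring_scheme" and \<phi> m I0

sublocale localized_polynomials \<subseteq> N: local_noeth A "L.extended m"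
  by (rule L.local_noeth_A[OF noeth_Rn])

context localized_polynomials
begin

text \<open>Each variable \<open>v\<close> outside \<open>T\<close> satisfies a polynomial in \<open>m\<close> with coefficients in \<open>K[T]\<close>. These polynomials form a
  regular sequence, because each involves a variable that \<open>J\<close> and the earlier ones do not involve, and nonzero
  elements of \<open>K[T]\<close> become units in \<open>A\<close>.\<close>

lemma regular_seq_of_algebraic_vars:
  assumes T: "T \<subseteq> {1..n}" "\<forall>f\<in>m. f \<in> poly_in T \<longrightarrow> f = 0" "\<forall>v\<in>{1..n}-T. \<exists>p\<in>m. p \<in> poly_in (insert v T) \<and> p \<noteq> 0"
    and "set vs \<subseteq> {1..n} - T" "distinct vs" "ideal J Rn" "I0 \<subseteq> J" "\<And>v g k. v \<in> set vs \<Longrightarrow> g \<in> J \<Longrightarrow> coef v k g \<in> J"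
  shows "L.A.has_regular_seq (L.extended m) (L.extended J) (length vs)"
  using assms(4-)
proof (induction vs arbitrary: J)
  case (Cons v vs)
  note J = Cons.prems(3)
  have mi: "ideal m Rn" using R.prime_ideal[OF L.m_prime] .
  have vT: "v \<in> {1..n} - T" using Cons.prems(1) by simp
  obtain p where p: "p \<in> m" "p \<in> poly_in (insert v T)" "p \<noteq> 0" using T(3) vT by blast
  have pc: "p \<in> carrier Rn" using poly_in_carr p by blast
  have ei: "ideal (L.extended J) A" using L.extended_ideal[OF J] .
  have c: "L.contracted (L.extended J) = L.saturated J" by (rule L.contracted_extended[OF J Cons.prems(4)])
  have phi: "\<phi> a \<in> L.extended J \<longleftrightarrow> a \<in> L.saturated J" if "a \<in> carrier Rn" for a using c that unfolding L.contracted_def by blast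
  have "L.A.nzd (L.extended J) (\<phi> p)" unfolding L.A.nzd_def
  proof (intro ballI impI)
    fix x assume x: "x \<in> carrier A" "\<phi> p \<otimes>\<^bsub>A\<^esub> x \<in> L.extended J"
    obtain s r where s: "r \<in> carrier Rn" "s \<in> carrier Rn - m" "\<phi> s \<otimes>\<^bsub>A\<^esub> x = \<phi> r" using L.surj[OF x(1)] by blast
    have sc: "\<phi> s \<in> carrier A" "\<phi> p \<in> carrier A" using s pc by auto
    have "\<phi> s \<otimes>\<^bsub>A\<^esub> (\<phi> p \<otimes>\<^bsub>A\<^esub> x) \<in> L.extended J" using L.A.ideal_mult[OF ei x(2) sc(1)] .
    also have "\<phi> s \<otimes>\<^bsub>A\<^esub> (\<phi> p \<otimes>\<^bsub>A\<^esub> x) = \<phi> p \<otimes>\<^bsub>A\<^esub> \<phi> r" using sc x(1) unfolding s(3)[symmetric] by (simp add: L.A.m_ac)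
    also have "\<dots> = \<phi> (p * r)" using L.phi(2)[OF pc s(1)] by simp
    finally have "p * r \<in> L.saturated J" using phi[OF carr_mult[OF pc s(1)]] by blast
    then obtain t where t: "t \<in> carrier Rn - m" "t * (p * r) \<in> J" by (auto simp: L.saturated_def)
    have tc: "t * r \<in> carrier Rn" using t s carr_mult by blast
    have "p * (t * r) \<in> J" using t(2) by (simp add: mult.left_commute)
    hence "t * r \<in> upto_saturated T J" using Cons.prems p tc by (intro nzd_upto_saturated[OF J, of v]) auto
    then obtain q where q: "q \<in> poly_in T" "q \<noteq> 0" "q * (t * r) \<in> J" by (auto simp: upto_saturated_def)
    have "q \<in> carrier Rn - m" using T(2) q poly_in_carr by blast
    hence "q * t \<in> carrier Rn - m" using L.S_mult[of q t] t(1) by simp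
    moreover have "(q * t) * r \<in> J" using q(3) by (simp add: mult.assoc)
    ultimately have "r \<in> L.saturated J" unfolding L.saturated_def mp_simps using s(1) by blast
    hence "\<phi> r \<in> L.extended J" using phi[OF s(1)] by blast
    thus "x \<in> L.extended J" using L.unit_in[OF ei s(2) x(1)] unfolding s(3) by simp
  qed
  moreover have "L.A.has_regular_seq (L.extended m) (L.A.adjoin (L.extended J) (\<phi> p)) (length vs)"
  proof -
    have "coef w k g \<in> R.adjoin J p" if w: "w \<in> set vs" and g: "g \<in> R.adjoin J p" for w k g
    proof -
      obtain j b where jb: "g = j + b * p" "j \<in> J" "b \<in> carrier Rn" using g by (auto simp: R.adjoin_def)
      have "w \<notin> insert v T" using w Cons.prems(1,2) by auto
      hence "coef w k (p * b) = p * coef w k b" using coef_mult_free[OF poly_in_pfree[OF p(2)]] by blast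
      hence "coef w k g = coef w k j + coef w k b * p" unfolding jb coef_add by (simp add: mult.commute)
      thus ?thesis unfolding R.adjoin_def using Cons.prems(5)[OF _ jb(2), of w k] w vfree_carr[OF jb(3)] by auto
    qed
    hence "L.A.has_regular_seq (L.extended m) (L.extended (R.adjoin J p)) (length vs)"
      using Cons.prems R.adjoin_sup[OF J pc] by (intro Cons.IH R.adjoin_ideal[OF J pc]) auto
    thus ?thesis unfolding L.extended_adjoin[OF J pc] .
  qed
  moreover have "\<phi> p \<in> L.extended m" using L.phi_extended[OF mi p(1)] .
  ultimately show ?case using L.A.has_regular_seq_Suc by auto
qed (simp add: L.A.has_regular_seq_0)

text \<open>If \<open>Z\<close> meets \<open>T\<close>, then a unit of \<open>A\<close> lies in the extended ideal and every sequence is weakly regular.\<close>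

lemma regular_seq_mod_coord_prime:
  assumes T: "T \<subseteq> {1..n}" "\<forall>f\<in>m. f \<in> poly_in T \<longrightarrow> f = 0" "\<forall>v\<in>{1..n}-T. \<exists>p\<in>m. p \<in> poly_in (insert v T) \<and> p \<noteq> 0"
    and Z: "Z \<subseteq> {1..n}" "I0 \<subseteq> coord_prime Z"
  shows "L.A.has_regular_seq (L.extended m) (L.extended (coord_prime Z)) (n - card Z - card T)"
proof (cases "Z \<inter> T = {}")
  case True
  obtain vs where vs: "set vs = {1..n} - T - Z" "distinct vs" using finite_distinct_list[of "{1..n} - T - Z"] by auto
  have f: "finite T" "finite Z" using T Z finite_subset by blast+
  have "length vs = card ({1..n} - T - Z)" using distinct_card[OF vs(2)] vs(1) by simp
  also have "\<dots> = n - card T - card Z" using T Z True f 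
    by (subst card_Diff_subset, force, force, subst card_Diff_subset) auto
  finally have l: "length vs = n - card Z - card T" by simp
  show ?thesis unfolding l[symmetric] using vs Z coord_prime_free by (intro regular_seq_of_algebraic_vars[OF T] coord_prime_ideal) auto
next
  case False
  then obtain t where t: "t \<in> Z" "t \<in> T" by blast
  have tn: "t \<in> {1..n}" using t T by auto
  have "xvar t \<in> poly_in T" using t xvar_carr[OF tn] by (auto simp: poly_in_def xvar_def)
  moreover have "xvar t \<noteq> 0" unfolding xvar_def by (metis lookup_single_eq lookup_zero zero_neq_one)
  ultimately have tm: "xvar t \<in> carrier Rn - m" using T(2) xvar_carr[OF tn] by blast
  note e = L.extended_ideal[OF coord_prime_ideal[of Z]]
  have "\<phi> (xvar t) \<in> L.extended (coord_prime Z)" using xvar_coord_prime[OF tn] t by (intro L.phi_extended[OF coord_prime_ideal]) auto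
  hence one: "\<one>\<^bsub>A\<^esub> \<in> L.extended (coord_prime Z)" using L.unit_in[OF e tm L.A.one_closed] tm by simp
  have whole: "L.A.has_regular_seq (L.extended m) J r" if "ideal J A" "\<one>\<^bsub>A\<^esub> \<in> J" for J r
    using that
  proof (induction r arbitrary: J)
    case (Suc r)
    have "J = carrier A" using ideal.one_imp_carrier Suc.prems by blast
    hence "L.A.nzd J \<zero>\<^bsub>A\<^esub>" by (simp add: L.A.nzd_def)
    moreover have "L.A.has_regular_seq (L.extended m) (L.A.adjoin J \<zero>\<^bsub>A\<^esub>) r"
      using Suc.prems L.A.adjoin_sup[OF Suc.prems(1), of "\<zero>\<^bsub>A\<^esub>"] by (intro Suc.IH L.A.adjoin_ideal) auto
    ultimately show ?case using L.A.has_regular_seq_Suc L.A.ideal_zero[OF N.m_ideal] by blast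
  qed (rule L.A.has_regular_seq_0)
  show ?thesis by (rule whole[OF e one])
qed

lemma chain_length_localized:
  assumes T: "T \<subseteq> {1..n}" "\<forall>f\<in>m. f \<in> poly_in T \<longrightarrow> f = 0" and ps: "prime_chain A ps" 
    and Z: "Z \<subseteq> {1..n}" "coord_prime Z \<subseteq> L.contracted (hd ps)"
  shows "length ps + card Z + card T \<le> Suc n"
proof -
  note c = L.contracted_chain[OF ps]
  have ne: "ps \<noteq> []" using ps by (auto simp: prime_chain_def)
  have "length (map L.contracted ps) + card Z + card T \<le> Suc n"
    using c(3) T(2) ne Z by (intro chain_length_above_coord_prime[OF c(1) T(1)]) (auto simp: hd_map)
  thus ?thesis by simp
qed

end

section \<open>Matroids, monomial generators and connectedness\<close>

locale matroid_bases =
  fixes E :: "'e set" and BB :: "'e set set"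
  assumes fin: "finite E" and sub: "\<And>B. B \<in> BB \<Longrightarrow> B \<subseteq> E" and ne: "BB \<noteq> {}" and cover: "\<And>x. x \<in> E \<Longrightarrow> \<exists>B\<in>BB. x \<in> B"
    and exchange: "\<And>B C i. B \<in> BB \<Longrightarrow> C \<in> BB \<Longrightarrow> i \<in> B \<Longrightarrow> i \<notin> C \<Longrightarrow> \<exists>j\<in>C - B. insert j (B - {i}) \<in> BB"
begin

lemma finB: "B \<in> BB \<Longrightarrow> finite B" using sub fin finite_subset by blast

lemma card_le: "B \<in> BB \<Longrightarrow> C \<in> BB \<Longrightarrow> card B \<le> card C"
proof (induction "card (B - C)" arbitrary: B rule: less_induct)
  case less
  show ?case
  proof (cases "B \<subseteq> C")
    case True thus ?thesis using finB less.prems by (simp add: card_mono)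
  next
    case False
    then obtain i where i: "i \<in> B" "i \<notin> C" by blast
    obtain j where j: "j \<in> C - B" "insert j (B - {i}) \<in> BB" using exchange[OF less.prems i] by blast
    have "insert j (B - {i}) - C = (B - C) - {i}" using j by blast
    hence "card (insert j (B - {i}) - C) < card (B - C)" using i finB[OF less.prems(1)] by (simp add: card_Diff1_less del: card_Diff_insert)
    from less.hyps[OF this j(2) less.prems(2)] have "card (insert j (B - {i})) \<le> card C" .
    moreover have "card (insert j (B - {i})) = card B" using j i finB[OF less.prems(1)] 
      by (metis DiffD2 Diff_iff card.insert card.remove finite_Diff)
    ultimately show ?thesis by simp
  qed
qed

definition rank where "rank = card (SOME B. B \<in> BB)"

lemma card_B: "B \<in> BB \<Longrightarrow> card B = rank"
  unfolding rank_def using card_le someI_ex[of "\<lambda>B. B \<in> BB"] by (metis le_antisym)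

lemma B_eq: "B \<in> BB \<Longrightarrow> C \<in> BB \<Longrightarrow> B \<subseteq> C \<Longrightarrow> B = C"
  using card_B finB by (metis card_subset_eq)

lemma extend_base: assumes w: "w \<in> E" "w \<notin> B1" and B1: "B1 \<in> BB"
  shows "\<exists>b\<in>B1. insert w (B1 - {b}) \<in> BB"
proof -
  obtain B where B: "B \<in> BB" "w \<in> B" "\<And>C. C \<in> BB \<Longrightarrow> w \<in> C \<Longrightarrow> card (B - B1) \<le> card (C - B1)"
    using ex_has_least_nat[of "\<lambda>B. B \<in> BB \<and> w \<in> B" _ "\<lambda>B. card (B - B1)"] cover[OF w(1)] by metis
  have sB: "B \<subseteq> insert w B1"
  proof (rule ccontr)
    assume "\<not> ?thesis"
    then obtain x where x: "x \<in> B" "x \<notin> B1" "x \<noteq> w" by blast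
    obtain y where y: "y \<in> B1 - B" "insert y (B - {x}) \<in> BB" using exchange[OF B(1) B1 x(1,2)] by blast
    have "insert y (B - {x}) - B1 = (B - B1) - {x}" using y by blast
    hence "card (insert y (B - {x}) - B1) < card (B - B1)" using x finB[OF B(1)] by (simp add: card_Diff1_less del: card_Diff_insert)
    thus False using B(3)[OF y(2)] B(2) x by auto
  qed
  have "B \<noteq> insert w B1" using card_B[OF B(1)] card_B[OF B1] w finB[OF B1] by auto
  then obtain b where b: "b \<in> insert w B1" "b \<notin> B" using sB by blast
  have bB: "b \<in> B1" using b B(2) by auto
  have "B \<subseteq> insert w (B1 - {b})" using sB b by blast
  moreover have "card (insert w (B1 - {b})) = card B1" using w bB finB[OF B1] 
    by (metis DiffD1 card.insert card.remove finite_Diff)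
  ultimately have "B = insert w (B1 - {b})" using card_B[OF B(1)] card_B[OF B1] finB[OF B1] by (metis card_subset_eq finite_Diff finite_insert)
  thus ?thesis using B(1) bB by auto
qed

text \<open>The maximal sets of this kind are the hyperplanes of the matroid.\<close>

definition nonspanning where "nonspanning G \<longleftrightarrow> G \<subseteq> E \<and> (\<forall>B\<in>BB. \<not> B \<subseteq> G)"

text \<open>Equivalently, all sets with \<open>rank\<close> elements are bases.\<close>

definition uniform where "uniform \<longleftrightarrow> (\<forall>G. nonspanning G \<longrightarrow> card G < rank)"

lemma uniform_base: assumes "uniform" "S \<subseteq> E" "card S = rank" shows "S \<in> BB"
proof -
  have "\<not> nonspanning S" using assms by (auto simp: uniform_def)
  then obtain B where B: "B \<in> BB" "B \<subseteq> S" using assms by (auto simp: nonspanning_def)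
  thus ?thesis using card_B[OF B(1)] assms finite_subset[OF assms(2) fin] by (metis card_subset_eq)
qed

definition max_nonspanning where "max_nonspanning = Max (card ` {G. nonspanning G})"

lemma max_nonspanning: 
  assumes "rank > 0"
  shows "\<exists>H. nonspanning H \<and> card H = max_nonspanning" "\<And>G. nonspanning G \<Longrightarrow> card G \<le> max_nonspanning"
proof -
  have f: "finite {G. nonspanning G}" by (rule finite_subset[of _ "Pow E"]) (auto simp: nonspanning_def fin)
  have "B \<noteq> {}" if "B \<in> BB" for B using card_B[OF that] assms by auto
  hence "nonspanning {}" by (auto simp: nonspanning_def)
  hence "card ` {G. nonspanning G} \<noteq> {}" by blast
  from Max_in[OF finite_imageI[OF f] this] show "\<exists>H. nonspanning H \<and> card H = max_nonspanning" by (auto simp: max_nonspanning_def)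
  show "\<And>G. nonspanning G \<Longrightarrow> card G \<le> max_nonspanning" unfolding max_nonspanning_def using f by (intro Max_ge) auto
qed

text \<open>Let \<open>H\<close> be a hyperplane of largest size, \<open>i0 \<notin> H\<close>, and \<open>B1\<close> a basis inside \<open>insert i0 H\<close>. Since \<open>H\<close> has at least
  \<open>rank\<close> elements, it contains some \<open>w\<close> outside \<open>B1\<close>, and as there are no loops, \<open>w\<close> can replace some \<open>b \<in> B1\<close>.
  Then \<open>B0 = B1 - {b, i0}\<close> spans a flat \<open>F\<close> in \<open>H\<close> that misses both \<open>b\<close> and \<open>w\<close>. The second hyperplane is
  represented by \<open>insert i0 F\<close>.\<close>

lemma nonuniform_configuration:
  assumes nu: "\<not> uniform" and r: "rank > 0"
  shows "\<exists>H F B0 H2. nonspanning H \<and> card H = max_nonspanning \<and> nonspanning H2 \<and> F \<subseteq> H \<and> F \<subseteq> H2 \<and> B0 \<subseteq> F \<and> card F + 2 \<le> max_nonspanning \<and>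
     H - F \<noteq> {} \<and> H2 - H \<noteq> {} \<and> (\<forall>i\<in>E-H. \<forall>j\<in>H-F. insert i (insert j B0) \<in> BB)"
proof -
  obtain H where H: "nonspanning H" "card H = max_nonspanning" using max_nonspanning[OF r] by blast
  have Hmax: "card G \<le> card H" if "nonspanning G" for G using max_nonspanning[OF r] H that by simp
  have HE: "H \<subseteq> E" "finite H" using H fin finite_subset by (auto simp: nonspanning_def)
  have Hb: "rank \<le> card H" using nu Hmax unfolding uniform_def by (meson le_trans not_le)
  have base: "\<exists>B\<in>BB. i \<in> B \<and> B \<subseteq> insert i H" if i: "i \<in> E - H" for i
  proof -
    have "\<not> nonspanning (insert i H)" using Hmax[of "insert i H"] i HE(2) by auto
    then obtain B where "B \<in> BB" "B \<subseteq> insert i H" using i HE by (auto simp: nonspanning_def)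
    moreover from this H have "i \<in> B" by (auto simp: nonspanning_def)
    ultimately show ?thesis by blast
  qed
  have "H \<noteq> E" using H(1) ne sub by (auto simp: nonspanning_def)
  then obtain i0 where i0: "i0 \<in> E - H" using HE by blast
  obtain B1 where B1: "B1 \<in> BB" "i0 \<in> B1" "B1 \<subseteq> insert i0 H" using base[OF i0] by blast
  have "\<not> H \<subseteq> B1"
  proof
    assume "H \<subseteq> B1"
    hence "insert i0 H \<subseteq> B1" using B1 by blast
    hence "card (insert i0 H) \<le> rank" using card_mono[OF finB[OF B1(1)]] card_B[OF B1(1)] by metis
    thus False using Hb i0 HE(2) by simp
  qed
  then obtain w where w: "w \<in> H" "w \<notin> B1" by blast
  obtain b where b: "b \<in> B1" "insert w (B1 - {b}) \<in> BB" using extend_base[OF _ w(2) B1(1)] w(1) HE by blast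
  have bi: "b \<noteq> i0"
  proof
    assume "b = i0"
    hence "insert w (B1 - {b}) \<subseteq> H" using B1(3) w by blast
    thus False using b(2) H(1) by (auto simp: nonspanning_def)
  qed
  have bH: "b \<in> H" using b(1) bi B1(3) by blast
  define B0 where "B0 = B1 - {b, i0}"
  define F where "F = {x \<in> H. insert i0 (insert x B0) \<notin> BB}"
  have B0H: "B0 \<subseteq> H" unfolding B0_def using B1(3) by blast
  have e1: "insert i0 (insert b B0) = B1" unfolding B0_def using b(1) B1(2) by blast
  have e2: "insert i0 (insert w B0) = insert w (B1 - {b})" unfolding B0_def using b(1) B1(2) bi by blast
  have "F \<subseteq> H - {b, w}" unfolding F_def using e1 e2 B1(1) b(2) by auto
  moreover have "card (H - {b, w}) = card H - 2" using bH w b(1) HE(2) by (subst card_Diff_subset) (auto simp: card_insert_if)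
  ultimately have cF: "card F \<le> card H - 2" using HE(2) by (metis card_mono finite_Diff)
  have "card {b, w} \<le> card H" using bH w HE(2) by (intro card_mono) auto
  hence "card H \<ge> 2" using b(1) w(2) by (auto simp: card_insert_if split: if_splits)
  hence cF2: "card F + 2 \<le> max_nonspanning" using cF H(2) by simp
  have B0F: "B0 \<subseteq> F"
  proof
    fix x assume x: "x \<in> B0"
    have "insert i0 (insert x B0) \<noteq> B1" and "insert i0 (insert x B0) \<subseteq> B1" using x b(1) bi B1(2) unfolding B0_def by auto
    hence "insert i0 (insert x B0) \<notin> BB" using B_eq[OF _ B1(1)] by blast
    thus "x \<in> F" unfolding F_def using x B0H by blast
  qed
  have ij: "insert i (insert j B0) \<in> BB" if i: "i \<in> E - H" and j: "j \<in> H - F" for i j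
  proof (cases "i = i0")
    case True thus ?thesis using j by (auto simp: F_def)
  next
    case False
    let ?B3 = "insert i0 (insert j B0)"
    have B3: "?B3 \<in> BB" using j by (auto simp: F_def)
    obtain Bi where Bi: "Bi \<in> BB" "i \<in> Bi" "Bi \<subseteq> insert i H" using base[OF i] by blast
    have "i0 \<notin> Bi" using Bi(3) i0 False by blast
    then obtain y where y: "y \<in> Bi - ?B3" "insert y (?B3 - {i0}) \<in> BB" using exchange[OF B3 Bi(1), of i0] by blast
    have i0n: "i0 \<notin> insert j B0" using i0 j B0H by blast
    have e: "insert y (?B3 - {i0}) = insert y (insert j B0)" using i0n by blast
    have "y \<notin> H"
    proof
      assume "y \<in> H"
      hence "insert y (insert j B0) \<subseteq> H" using j B0H by blast
      thus False using y(2) e H(1) by (auto simp: nonspanning_def)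
    qed
    hence "y = i" using y Bi by blast
    thus ?thesis using y(2) e by simp
  qed
  have ns: "nonspanning (insert i0 F)" unfolding nonspanning_def
  proof (intro conjI ballI notI)
    show "insert i0 F \<subseteq> E" using i0 HE unfolding F_def by blast
    fix B assume B: "B \<in> BB" "B \<subseteq> insert i0 F"
    have "b \<notin> B" using B(2) bi e1 B1(1) unfolding F_def by auto
    then obtain y where y: "y \<in> B - B1" "insert y (B1 - {b}) \<in> BB" using exchange[OF B1(1) B(1) b(1)] by blast
    have "y \<in> F" using y B(2) B1(2) by blast
    moreover have "insert y (B1 - {b}) = insert i0 (insert y B0)" unfolding B0_def using B1(2) bi by blast
    ultimately show False using y(2) unfolding F_def by auto
  qed
  have FH: "F \<subseteq> H" "H - F \<noteq> {}" using bH e1 B1(1) unfolding F_def by auto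
  have skeletal_ideal: "insert i0 F - H \<noteq> {}" "F \<subseteq> insert i0 F" using i0 by blast+
  have "\<forall>i\<in>E-H. \<forall>j\<in>H-F. insert i (insert j B0) \<in> BB" using ij by simp
  with H ns FH(1) skeletal_ideal(2) B0F cF2 FH(2) skeletal_ideal(1) show ?thesis
    by (intro exI[of _ H] exI[of _ F] exI[of _ B0] exI[of _ "insert i0 F"] conjI)
qed

end

definition mdvd :: "mon \<Rightarrow> mon \<Rightarrow> bool" where "mdvd v u \<longleftrightarrow> (\<exists>w. u = w + v)"

lemma mdvd_refl: "mdvd u u" unfolding mdvd_def by (metis add_0)
lemma mdvd_trans: "mdvd u v \<Longrightarrow> mdvd v w \<Longrightarrow> mdvd u w" unfolding mdvd_def by (metis add.assoc)

lemma mdvd_iff: "mdvd v u \<longleftrightarrow> (\<forall>i. lk v i \<le> lk u i)"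
proof
  assume "\<forall>i. lk v i \<le> lk u i"
  hence "u = (u - v) + v" by (intro poly_mapping_eqI) (simp add: lookup_add minus_poly_mapping.rep_eq)
  thus "mdvd v u" unfolding mdvd_def by blast
qed (auto simp: mdvd_def lookup_add)

context polynomials
begin

lemma monomial_span_cong: assumes "\<And>u. u \<in> monomials n \<Longrightarrow> C u = D u" shows "monomial_span C = monomial_span D"
proof -
  have "(\<forall>u\<in>ks f. C u) = (\<forall>u\<in>ks f. D u)" if "f \<in> carrier Rn" for f
    by (rule ball_cong[OF refl]) (use that carrier_iff[of f] assms in blast)
  thus ?thesis unfolding monomial_span_def by (intro Collect_cong conj_cong refl)
qed

lemma Idl_monom: assumes V: "V \<subseteq> monomials n" shows "Idl\<^bsub>Rn\<^esub> (monom_poly ` V) = monomial_span (\<lambda>u. \<exists>v\<in>V. mdvd v u)"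
proof
  have c: "monom_poly ` V \<subseteq> carrier Rn" using V carr_single by (auto simp: monom_poly_def)
  have M: "ideal (monomial_span (\<lambda>u. \<exists>v\<in>V. mdvd v u)) Rn"
    by (rule monomial_span_ideal) (metis add.commute mdvd_def mdvd_trans)
  show "Idl\<^bsub>Rn\<^esub> (monom_poly ` V) \<subseteq> monomial_span (\<lambda>u. \<exists>v\<in>V. mdvd v u)"
  proof (rule R.genideal_minimal[OF M], clarify)
    fix v assume v: "v \<in> V"
    hence "\<exists>v'\<in>V. mdvd v' v" using mdvd_refl by blast
    thus "monom_poly v \<in> monomial_span (\<lambda>u. \<exists>v\<in>V. mdvd v u)" using c v by (auto simp: monomial_span_def monom_poly_def)
  qed
  have I: "ideal (Idl\<^bsub>Rn\<^esub> (monom_poly ` V)) Rn" using R.genideal_ideal[OF c] .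
  show "monomial_span (\<lambda>u. \<exists>v\<in>V. mdvd v u) \<subseteq> Idl\<^bsub>Rn\<^esub> (monom_poly ` V)"
  proof
    fix f assume f: "f \<in> monomial_span (\<lambda>u. \<exists>v\<in>V. mdvd v u)"
    show "f \<in> Idl\<^bsub>Rn\<^esub> (monom_poly ` V)"
    proof (rule id_keys[OF I])
      show "f \<in> carrier Rn" using f by (simp add: monomial_span_def)
      fix u assume u: "u \<in> ks f"
      then obtain v w where v: "v \<in> V" "u = w + v" using f by (auto simp: monomial_span_def mdvd_def)
      have "u \<in> monomials n" using f u by (auto simp: monomial_span_def carrier_iff)
      hence w: "w \<in> monomials n" using v monomials_add_iff by blast
      have "monom_poly v \<in> Idl\<^bsub>Rn\<^esub> (monom_poly ` V)" using R.genideal_self[OF c] v by blast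
      from id_mult[OF I this carr_single[OF w, of 1]] show "Poly_Mapping.single u 1 \<in> Idl\<^bsub>Rn\<^esub> (monom_poly ` V)"
        unfolding monom_poly_def v(2) mult_single by simp
    qed
  qed
qed

lemma single_monomial_span: "u \<in> monomials n \<Longrightarrow> Poly_Mapping.single u 1 \<in> monomial_span C \<longleftrightarrow> C u"
  by (auto simp: monomial_span_def carrier_iff)

text \<open>The monomials of \<open>I\<close> that are minimal for divisibility generate \<open>I\<close> and lie in every set of monomial generators.\<close>

lemma min_gens_eq:
  fixes I :: "(mon \<Rightarrow>\<^sub>0 'k) set"
  assumes "monomial_ideal n I"
  shows "monomial_gens n I (min_gens n I)"
proof -
  obtain U0 where U0: "U0 \<subseteq> monomials n" "I = Idl\<^bsub>Rn\<^esub> (monom_poly ` U0)" using assms by (auto simp: monomial_ideal_def monomial_gens_def)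
  define W where "W = {u \<in> monomials n. Poly_Mapping.single u 1 \<in> I}"
  have W: "u \<in> W \<longleftrightarrow> u \<in> monomials n \<and> (\<exists>v\<in>V. mdvd v u)" if "monomial_gens n I V" for u V
  proof -
    have V: "V \<subseteq> monomials n" "I = monomial_span (\<lambda>u. \<exists>v\<in>V. mdvd v u)" using that Idl_monom by (auto simp: monomial_gens_def)
    have "u \<in> W \<longleftrightarrow> u \<in> monomials n \<and> Poly_Mapping.single u 1 \<in> I" by (simp add: W_def)
    also have "\<dots> \<longleftrightarrow> u \<in> monomials n \<and> (\<exists>v\<in>V. mdvd v u)"
      unfolding V(2) by (rule conj_cong[OF refl]) (rule single_monomial_span)
    finally show ?thesis .
  qed
  define M where "M = {u \<in> W. \<forall>v\<in>W. mdvd v u \<longrightarrow> v = u}"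
  have ex: "\<exists>v\<in>M. mdvd v u" if "u \<in> W" for u
    using wf_mon[of n] that
  proof (induction u rule: wf_induct_rule)
    case (less u)
    show ?case
    proof (cases "u \<in> M")
      case False
      then obtain v where v: "v \<in> W" "mdvd v u" "v \<noteq> u" using less by (auto simp: M_def)
      obtain w where w: "u = w + v" using v(2) by (auto simp: mdvd_def)
      have "v \<le> u" using add_right_mono[OF mon_zero_le[of w], of v] w by simp
      hence "v < u" using v(3) by simp
      hence "\<exists>x\<in>M. mdvd x v" using v(1) less.prems by (intro less.IH) (auto simp: W_def)
      thus ?thesis using v(2) mdvd_trans by blast
    qed (use mdvd_refl in blast)
  qed
  have g0: "monomial_gens n I U0" using U0 by (simp add: monomial_gens_def)
  have Mm: "M \<subseteq> monomials n" by (auto simp: M_def W_def)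
  have gM: "monomial_gens n I M"
  proof -
    have "monomial_span (\<lambda>u. \<exists>v\<in>U0. mdvd v u) = (monomial_span (\<lambda>u. \<exists>v\<in>M. mdvd v u) :: (mon \<Rightarrow>\<^sub>0 'k) set)"
    proof -
      have "(\<exists>v\<in>U0. mdvd v u) \<longleftrightarrow> (\<exists>v\<in>M. mdvd v u)" if "u \<in> monomials n" for u
      proof
        assume "\<exists>v\<in>U0. mdvd v u"
        hence "u \<in> W" using W[OF g0] that by blast
        thus "\<exists>v\<in>M. mdvd v u" by (rule ex)
      next
        assume "\<exists>v\<in>M. mdvd v u"
        then obtain v where v: "v \<in> W" "mdvd v u" by (auto simp: M_def)
        thus "\<exists>v\<in>U0. mdvd v u" using W[OF g0] mdvd_trans by blast
      qed
      thus ?thesis by (rule monomial_span_cong)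
    qed
    thus ?thesis unfolding monomial_gens_def using Mm U0 Idl_monom[OF Mm] Idl_monom[OF U0(1)] by simp
  qed
  have Msub: "M \<subseteq> V" if V: "monomial_gens n I V" for V
  proof
    fix u assume u: "u \<in> M"
    hence "u \<in> W" by (simp add: M_def)
    then obtain v where v: "v \<in> V" "mdvd v u" using W[OF V] by blast
    have "v \<in> W" using W[OF V, of v] v(1) mdvd_refl V by (auto simp: monomial_gens_def)
    hence "v = u" using u v(2) by (auto simp: M_def)
    thus "u \<in> V" using v by simp
  qed
  have "min_gens n I = M" unfolding min_gens_def
  proof (rule the_equality)
    show "monomial_gens n I M \<and> (\<forall>V. V \<subset> M \<longrightarrow> \<not> monomial_gens n I V)" using gM Msub by blast
    fix U assume "monomial_gens n I U \<and> (\<forall>V. V \<subset> U \<longrightarrow> \<not> monomial_gens n I V)"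
    thus "U = M" using gM Msub by blast
  qed
  thus ?thesis using gM by simp
qed

lemma matroidal_bases:
  fixes I :: "(mon \<Rightarrow>\<^sub>0 'k) set"
  assumes "n \<ge> 1" "matroidal n I" "ideal_supp n I = {1..n}"
  shows "\<exists>BB. matroid_bases {1..n} BB \<and> I = monomial_span (\<lambda>u. \<exists>B\<in>BB. B \<subseteq> ks u)"
proof -
  define U where "U = min_gens n I"
  define BB where "BB = ks ` U"
  have g: "monomial_gens n I U" unfolding U_def using assms min_gens_eq by (auto simp: matroidal_def)
  have sf: "lk u i \<le> 1" if "u \<in> U" for u i using assms(2) that by (auto simp: matroidal_def U_def)
  have ex: "\<exists>j. lk u j < lk v j \<and> Poly_Mapping.single j 1 + (u - Poly_Mapping.single i 1) \<in> U" 
    if "u \<in> U" "v \<in> U" "lk u i > lk v i" for u v i using assms(2) that by (auto simp: matroidal_def U_def)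
  have um: "U \<subseteq> monomials n" using g by (simp add: monomial_gens_def)
  have sfd: "mdvd v u \<longleftrightarrow> ks v \<subseteq> ks u" if "v \<in> U" for u v
  proof
    assume "ks v \<subseteq> ks u"
    have "lk v i \<le> lk u i" for i
    proof (cases "i \<in> ks v")
      case True
      hence "lk u i > 0" using \<open>ks v \<subseteq> ks u\<close> by (metis gr0I in_keys_iff subsetD)
      thus ?thesis using sf[OF that, of i] by simp
    qed (simp add: in_keys_iff)
    thus "mdvd v u" by (simp add: mdvd_iff)
  qed (auto simp: mdvd_def keys_add_nat)
  have "I = monomial_span (\<lambda>u. \<exists>v\<in>U. mdvd v u)" using g Idl_monom[OF um] by (simp add: monomial_gens_def)
  also have "\<dots> = monomial_span (\<lambda>u. \<exists>B\<in>BB. B \<subseteq> ks u)" unfolding BB_def using sfd by (auto simp: monomial_span_def)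
  finally have I: "I = monomial_span (\<lambda>u. \<exists>B\<in>BB. B \<subseteq> ks u)" .
  have un: "(\<Union>u\<in>U. ks u) = {1..n}" using assms(3) by (simp add: ideal_supp_def U_def)
  have "matroid_bases {1..n} BB"
  proof
    show "finite {1..n}" by simp
    show "B \<subseteq> {1..n}" if "B \<in> BB" for B using that un by (auto simp: BB_def)
    show "BB \<noteq> {}" using un assms(1) by (auto simp: BB_def)
    show "\<exists>B\<in>BB. x \<in> B" if "x \<in> {1..n}" for x using that un by (auto simp: BB_def)
    fix B C i assume B: "B \<in> BB" "C \<in> BB" "i \<in> B" "i \<notin> C"
    then obtain u v where uv: "u \<in> U" "v \<in> U" "B = ks u" "C = ks v" by (auto simp: BB_def)
    have i1: "lk u i = 1" using sf[OF uv(1), of i] B(3) uv(3) by (simp add: in_keys_iff)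
    have i0: "lk v i = 0" using B(4) uv(4) by (simp add: in_keys_iff)
    obtain j where j: "lk u j < lk v j" "Poly_Mapping.single j 1 + (u - Poly_Mapping.single i 1) \<in> U"
      using ex[OF uv(1,2), of i] i1 i0 by auto
    have uj: "lk u j = 0" using j(1) sf[OF uv(2), of j] by simp
    have "ks (Poly_Mapping.single j 1 + (u - Poly_Mapping.single i 1)) = insert j (B - {i})"
    proof -
      have "ks (u - Poly_Mapping.single i 1) = B - {i}" unfolding uv(3) using i1
        by (auto simp: in_keys_iff minus_poly_mapping.rep_eq lookup_single when_def split: if_splits)
      thus ?thesis by (simp add: keys_add_nat)
    qed
    moreover have "j \<in> C - B" using j(1) uj uv by (simp add: in_keys_iff)
    ultimately show "\<exists>j\<in>C - B. insert j (B - {i}) \<in> BB" using j(2) unfolding BB_def by (metis image_eqI)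
  qed
  thus ?thesis using I by blast
qed

end

context local_noeth
begin

text \<open>Up to the factor \<open>t C\<close> the element \<open>a1\<close> squares to zero, so \<open>(a1 + a2)\<^sup>2\<close> acts like \<open>a2\<^sup>2\<close> and kills everything
  that \<open>a2\<close> kills; but it is a nonzerodivisor.\<close>

lemma hartshorne_step:
  assumes J: "ideal J R" and c: "a1 \<in> carrier R" "a2 \<in> carrier R" "t \<in> carrier R" "C \<in> carrier R" "z \<in> carrier R"
    and n: "nzd J (a1 \<oplus> a2)" and t: "t \<otimes> (a1 \<otimes> a1) \<in> J" and C: "C \<otimes> (a1 \<otimes> a2) \<in> J" "C \<otimes> (a2 \<otimes> z) \<in> J"
  shows "t \<otimes> C \<otimes> z \<in> J"
proof -
  have "(a1 \<oplus> a2) \<otimes> ((a1 \<oplus> a2) \<otimes> (t \<otimes> C \<otimes> z)) = 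
     ((C \<otimes> z) \<otimes> (t \<otimes> (a1 \<otimes> a1)) \<oplus> (t \<otimes> z \<oplus> t \<otimes> z) \<otimes> (C \<otimes> (a1 \<otimes> a2))) \<oplus> (t \<otimes> a2) \<otimes> (C \<otimes> (a2 \<otimes> z))"
    using c by algebra
  also have "\<dots> \<in> J" using c by (intro ideal_add[OF J] ideal_mult[OF J] t C) auto
  finally have "(a1 \<oplus> a2) \<otimes> (t \<otimes> C \<otimes> z) \<in> J" using n c unfolding nzd_def by simp
  thus ?thesis using n c unfolding nzd_def by simp
qed

text \<open>Suppose that locally at \<open>P\<close>, where \<open>C\<close> is a unit, \<open>V(J)\<close> is the union of \<open>V(AA)\<close> and \<open>V(BB)\<close>. The sum \<open>AA + BB\<close>
  contains a regular sequence \<open>a1 + a2, b1 + b2\<close> modulo \<open>J\<close>. The function that is \<open>1\<close> on one part and \<open>0\<close> on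
  the other is the fraction \<open>a1 / (a1 + a2) = b1 / (b1 + b2)\<close>, and regularity makes it an element \<open>e / C\<close> of the local
  ring. It is idempotent, hence \<open>0\<close> or \<open>1\<close> at \<open>P\<close>, so one of the two parts is empty; but \<open>P1\<close> and \<open>P2\<close>
  are points of \<open>V(J)\<close> outside \<open>V(BB)\<close> and \<open>V(AA)\<close>.\<close>

lemma hartshorne:
  assumes J: "ideal J R" and aJ: "ideal AA R" "ideal BB R" and C: "C \<in> carrier R"
    and ab: "\<And>x y. x \<in> AA \<Longrightarrow> y \<in> BB \<Longrightarrow> C \<otimes> (x \<otimes> y) \<in> J"
    and a: "a1 \<in> AA" "a2 \<in> BB" "nzd J (a1 \<oplus> a2)" and b: "b1 \<in> AA" "b2 \<in> BB" "nzd (adjoin J (a1 \<oplus> a2)) (b1 \<oplus> b2)"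
    and P: "primeideal P R" "C \<notin> P" and P1: "primeideal P1 R" "J \<subseteq> P1" "P1 \<subseteq> P" "y \<in> BB" "y \<notin> P1"
    and P2: "primeideal P2 R" "J \<subseteq> P2" "P2 \<subseteq> P" "x \<in> AA" "x \<notin> P2"
  shows False
proof -
  have c: "a1 \<in> carrier R" "a2 \<in> carrier R" "b1 \<in> carrier R" "b2 \<in> carrier R" "x \<in> carrier R" "y \<in> carrier R"
    using a b P1 P2 ideal_carr aJ by blast+
  have "(b1 \<oplus> b2) \<otimes> (C \<otimes> a1) = (C \<otimes> (a1 \<otimes> b2) \<ominus> C \<otimes> (b1 \<otimes> a2)) \<oplus> (C \<otimes> b1) \<otimes> (a1 \<oplus> a2)"
    using c C by algebra
  moreover have "C \<otimes> (a1 \<otimes> b2) \<ominus> C \<otimes> (b1 \<otimes> a2) \<in> J" using a b by (intro ideal_minus[OF J] ab)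
  ultimately have "(b1 \<oplus> b2) \<otimes> (C \<otimes> a1) \<in> adjoin J (a1 \<oplus> a2)" unfolding adjoin_def using C c by blast
  hence "C \<otimes> a1 \<in> adjoin J (a1 \<oplus> a2)" using b(3) C c unfolding nzd_def by simp
  then obtain k e where k: "C \<otimes> a1 = k \<oplus> e \<otimes> (a1 \<oplus> a2)" "k \<in> J" "e \<in> carrier R" by (auto simp: adjoin_def)
  have kc: "k \<in> carrier R" using k ideal_carr[OF J] by blast
  have a12: "C \<otimes> (a1 \<otimes> a2) \<in> J" using ab a by blast
  have Pi: "ideal P R" using prime_ideal P by blast
  show False
  proof (cases "e \<in> P")
    case True
    have "C \<ominus> e \<notin> P" using ideal_minus_cancel[OF Pi C True] P(2) by simp
    hence tP: "C \<otimes> (C \<ominus> e) \<notin> P" using prime_mult[OF P(1)] P(2) C k(3) by simp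
    have "(C \<otimes> (C \<ominus> e)) \<otimes> (a1 \<otimes> a1) = (C \<otimes> a1) \<otimes> (C \<otimes> a1) \<ominus> e \<otimes> C \<otimes> (a1 \<otimes> a1)" using C c k(3) by algebra
    also have "\<dots> = (C \<otimes> a1) \<otimes> (k \<oplus> e \<otimes> (a1 \<oplus> a2)) \<ominus> e \<otimes> C \<otimes> (a1 \<otimes> a1)" unfolding k(1) ..
    also have "\<dots> = (C \<otimes> a1) \<otimes> k \<oplus> e \<otimes> (C \<otimes> (a1 \<otimes> a2))" using C c k(3) kc by algebra
    also have "\<dots> \<in> J" by (rule ideal_add[OF J ideal_mult[OF J k(2)] ideal_mult[OF J a12 k(3)]]) (use C c in simp)
    finally have t: "(C \<otimes> (C \<ominus> e)) \<otimes> (a1 \<otimes> a1) \<in> J" .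
    have "C \<otimes> (x \<otimes> a2) \<in> J" using ab P2 a by blast
    hence xa: "C \<otimes> (a2 \<otimes> x) \<in> J" using c m_comm by metis
    have "(C \<otimes> (C \<ominus> e)) \<otimes> C \<otimes> x \<in> J"
      by (rule hartshorne_step[OF J c(1,2) _ C c(5) a(3) t a12 xa]) (use C k in auto)
    hence "(C \<otimes> (C \<ominus> e)) \<otimes> C \<otimes> x \<in> P2" using P2 by blast
    thus False using prime_mult[OF P2(1)] P2 tP P(2) C k(3) c by (metis m_closed minus_closed subsetD)
  next
    case False
    hence tP: "e \<otimes> C \<notin> P" using prime_mult[OF P(1)] P(2) C k(3) by simp
    have "(e \<otimes> C) \<otimes> (a2 \<otimes> a2) = C \<otimes> a2 \<otimes> (k \<oplus> e \<otimes> (a1 \<oplus> a2)) \<ominus> ((C \<otimes> a2) \<otimes> k \<oplus> e \<otimes> (C \<otimes> (a1 \<otimes> a2)))" using C c k(3) kc by algebra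
    also have "\<dots> = C \<otimes> a2 \<otimes> (C \<otimes> a1) \<ominus> ((C \<otimes> a2) \<otimes> k \<oplus> e \<otimes> (C \<otimes> (a1 \<otimes> a2)))" unfolding k(1) ..
    also have "C \<otimes> a2 \<otimes> (C \<otimes> a1) = C \<otimes> (C \<otimes> (a1 \<otimes> a2))" using C c by algebra
    also have "C \<otimes> (C \<otimes> (a1 \<otimes> a2)) \<ominus> ((C \<otimes> a2) \<otimes> k \<oplus> e \<otimes> (C \<otimes> (a1 \<otimes> a2))) \<in> J"
      by (rule ideal_minus[OF J ideal_mult[OF J a12 C] ideal_add[OF J ideal_mult[OF J k(2)] ideal_mult[OF J a12 k(3)]]])
        (use C c in simp)
    finally have t: "(e \<otimes> C) \<otimes> (a2 \<otimes> a2) \<in> J" .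
    have a21: "C \<otimes> (a2 \<otimes> a1) \<in> J" using a12 c m_comm by metis
    have n: "nzd J (a2 \<oplus> a1)" using a(3) c a_comm by metis
    have yb: "C \<otimes> (a1 \<otimes> y) \<in> J" using ab P1 a by blast
    have "(e \<otimes> C) \<otimes> C \<otimes> y \<in> J"
      by (rule hartshorne_step[OF J c(2,1) _ C c(6) n t a21 yb]) (use C k in auto)
    hence "(e \<otimes> C) \<otimes> C \<otimes> y \<in> P1" using P1 by blast
    thus False using prime_mult[OF P1(1)] P1 tP P(2) C k(3) c by (metis m_closed subsetD)
  qed
qed

end

section \<open>Quotients, radicals and the origin\<close>

context cring
begin

lemma coset_eq: "ideal J R \<Longrightarrow> a \<in> carrier R \<Longrightarrow> b \<in> carrier R \<Longrightarrow> J +> a = J +> b \<longleftrightarrow> a \<ominus> b \<in> J"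
  using quotient_eq_iff_same_a_r_cos by blast

lemma quot_surj: "x \<in> carrier (R Quot J) \<Longrightarrow> \<exists>r\<in>carrier R. x = J +> r"
  unfolding FactRing_def A_RCOSETS_def' by auto

lemma quot_hom: assumes "ideal J R" shows "ring_hom_cring R (R Quot J) ((+>) J)"
  using ideal.rcos_ring_hom_cring[OF assms is_cring] .

lemma quot_vimage: assumes J: "ideal J R" and N: "ideal N (R Quot J)"
  shows "ideal {r \<in> carrier R. J +> r \<in> N} R" "J \<subseteq> {r \<in> carrier R. J +> r \<in> N}"
proof -
  interpret q: ring_hom_cring R "R Quot J" "(+>) J" by (rule quot_hom[OF J])
  show "ideal {r \<in> carrier R. J +> r \<in> N} R"
    by (rule make_ideal) (use q.S.ideal_zero[OF N] in \<open>auto simp: q.S.ideal_add[OF N] q.S.ideal_mult[OF N]\<close>)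
  show "J \<subseteq> {r \<in> carrier R. J +> r \<in> N}"
  proof
    fix r assume r: "r \<in> J"
    have rc: "r \<in> carrier R" using ideal_carr[OF J r] .
    have "J +> r = J +> \<zero>" using coset_eq[OF J rc zero_closed] r rc by (simp add: a_minus_def)
    thus "r \<in> {r \<in> carrier R. J +> r \<in> N}" using rc q.S.ideal_zero[OF N] by simp
  qed
qed

lemma quot_noeth: assumes J: "ideal J R" and n: "noetherian_ring R" shows "noetherian_ring (R Quot J)"
proof -
  interpret n: noetherian_ring R by fact
  interpret q: ring_hom_cring R "R Quot J" "(+>) J" by (rule quot_hom[OF J])
  show ?thesis
  proof (rule q.S.noetherian_ringI)
    fix N assume N: "ideal N (R Quot J)"
    obtain F where F: "F \<subseteq> carrier R" "finite F" "{r \<in> carrier R. J +> r \<in> N} = Idl F" 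
      using n.finetely_gen[OF quot_vimage(1)[OF J N]] by blast
    have qF: "((+>) J) ` F \<subseteq> carrier (R Quot J)" using F by auto
    have i: "ideal (Idl\<^bsub>R Quot J\<^esub> (((+>) J) ` F)) (R Quot J)" using q.S.genideal_ideal[OF qF] .
    have "F \<subseteq> {r \<in> carrier R. J +> r \<in> Idl\<^bsub>R Quot J\<^esub> (((+>) J) ` F)}" using q.S.genideal_self[OF qF] F by auto
    hence s: "{r \<in> carrier R. J +> r \<in> N} \<subseteq> {r \<in> carrier R. J +> r \<in> Idl\<^bsub>R Quot J\<^esub> (((+>) J) ` F)}"
      unfolding F(3) by (rule genideal_minimal[OF quot_vimage(1)[OF J i]])
    have "N \<subseteq> Idl\<^bsub>R Quot J\<^esub> (((+>) J) ` F)"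
    proof
      fix x assume x: "x \<in> N"
      obtain r where r: "r \<in> carrier R" "x = J +> r" using quot_surj q.S.ideal_carr[OF N x] by blast
      thus "x \<in> Idl\<^bsub>R Quot J\<^esub> (((+>) J) ` F)" using s x by blast
    qed
    moreover have "((+>) J) ` F \<subseteq> N" using F genideal_self[OF F(1)] by blast
    hence "Idl\<^bsub>R Quot J\<^esub> (((+>) J) ` F) \<subseteq> N" by (rule q.S.genideal_minimal[OF N])
    ultimately show "\<exists>A\<subseteq>carrier (R Quot J). finite A \<and> N = Idl\<^bsub>R Quot J\<^esub> A" using qF F(2) by blast
  qed
qed

lemma quot_maximal: assumes J: "ideal J R" and m: "maximalideal m R" and Jm: "J \<subseteq> m"
  shows "maximalideal (((+>) J) ` m) (R Quot J)" "{r \<in> carrier R. J +> r \<in> ((+>) J) ` m} = m"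
proof -
  interpret q: ring_hom_cring R "R Quot J" "(+>) J" by (rule quot_hom[OF J])
  interpret m: maximalideal m R by fact
  have mc: "r \<in> carrier R" if "r \<in> m" for r using ideal_carr[OF m.is_ideal that] .
  show vi: "{r \<in> carrier R. J +> r \<in> ((+>) J) ` m} = m"
  proof
    show "m \<subseteq> {r \<in> carrier R. J +> r \<in> ((+>) J) ` m}" using mc by blast
    show "{r \<in> carrier R. J +> r \<in> ((+>) J) ` m} \<subseteq> m"
    proof clarify
      fix r s assume r: "r \<in> carrier R" "s \<in> m" "J +> r = J +> s"
      hence "r \<ominus> s \<in> m" using coset_eq[OF J r(1) mc[OF r(2)]] Jm by blast
      thus "r \<in> m" using ideal_minus_cancel[OF m.is_ideal r(1,2)] by simp
    qed
  qed
  show "maximalideal (((+>) J) ` m) (R Quot J)"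
  proof (rule maximalidealI)
    show "ideal (((+>) J) ` m) (R Quot J)"
    proof (rule q.S.make_ideal)
      show "((+>) J) ` m \<subseteq> carrier (R Quot J)" using mc by auto
      have "\<zero>\<^bsub>R Quot J\<^esub> = J +> \<zero>" by simp
      thus "\<zero>\<^bsub>R Quot J\<^esub> \<in> ((+>) J) ` m" using ideal_zero[OF m.is_ideal] by blast
      fix a b assume "a \<in> ((+>) J) ` m" "b \<in> ((+>) J) ` m"
      then obtain r s where rs: "r \<in> m" "s \<in> m" "a = J +> r" "b = J +> s" by blast
      hence "a \<oplus>\<^bsub>R Quot J\<^esub> b = J +> (r \<oplus> s)" using mc by simp
      thus "a \<oplus>\<^bsub>R Quot J\<^esub> b \<in> ((+>) J) ` m" using ideal_add[OF m.is_ideal] rs by blast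
    next
      fix a c assume "a \<in> ((+>) J) ` m" and c: "c \<in> carrier (R Quot J)"
      then obtain r where r: "r \<in> m" "a = J +> r" by blast
      obtain s where s: "s \<in> carrier R" "c = J +> s" using quot_surj[OF c] by blast
      hence "c \<otimes>\<^bsub>R Quot J\<^esub> a = J +> (s \<otimes> r)" using mc r by simp
      thus "c \<otimes>\<^bsub>R Quot J\<^esub> a \<in> ((+>) J) ` m" using ideal_mult[OF m.is_ideal] r s by blast
    qed
    show "carrier (R Quot J) \<noteq> ((+>) J) ` m"
    proof
      assume "carrier (R Quot J) = ((+>) J) ` m"
      hence "{r \<in> carrier R. J +> r \<in> ((+>) J) ` m} = carrier R" using q.hom_closed by blast
      thus False using vi m.I_notcarr by simp
    qed
    fix N assume N: "ideal N (R Quot J)" "((+>) J) ` m \<subseteq> N" "N \<subseteq> carrier (R Quot J)"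
    let ?V = "{r \<in> carrier R. J +> r \<in> N}"
    have "m \<subseteq> ?V" using N(2) mc by blast
    hence "?V = m \<or> ?V = carrier R" using m.I_maximal[OF quot_vimage(1)[OF J N(1)]] by blast
    thus "N = ((+>) J) ` m \<or> N = carrier (R Quot J)"
    proof
      assume V: "?V = m"
      have "N \<subseteq> ((+>) J) ` m"
      proof
        fix x assume x: "x \<in> N"
        obtain r where r: "r \<in> carrier R" "x = J +> r" using quot_surj x N(3) by blast
        hence "r \<in> m" using V x by blast
        thus "x \<in> ((+>) J) ` m" using r by blast
      qed
      thus ?thesis using N by blast
    next
      assume V: "?V = carrier R"
      have "carrier (R Quot J) \<subseteq> N"
      proof
        fix x assume x: "x \<in> carrier (R Quot J)"
        obtain r where r: "r \<in> carrier R" "x = J +> r" using quot_surj x by blast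
        thus "x \<in> N" using V by blast
      qed
      thus ?thesis using N by blast
    qed
  qed
qed

lemma radical_prime_sub: assumes P: "primeideal P R" and I: "I \<subseteq> P" shows "radical R I \<subseteq> P"
  using prime_pow[OF P] I unfolding radical_def by blast

lemma radical_sup: assumes "I \<subseteq> carrier R" shows "I \<subseteq> radical R I"
proof
  fix a assume a: "a \<in> I"
  hence "a [^] (1::nat) \<in> I" using assms by auto
  thus "a \<in> radical R I" using a assms unfolding radical_def by blast
qed

end

context noeth_cring
begin

text \<open>Take \<open>K = J : a\<^sup>k\<close> maximal among such colons; then \<open>a\<close> is a nonzerodivisor modulo \<open>K\<close> and avoids the associated primes of \<open>K\<close>.\<close>

lemma radical_prime: assumes J: "ideal J R" and a: "a \<in> carrier R" "a \<notin> radical R J"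
  shows "\<exists>Q. primeideal Q R \<and> J \<subseteq> Q \<and> a \<notin> Q"
proof -
  define S where "S = range (\<lambda>k::nat. colon J (a [^] k))"
  have "\<exists>M\<in>S. \<forall>K\<in>S. M \<subseteq> K \<longrightarrow> K = M"
    unfolding S_def using a by (intro ideal_max) (auto intro: colon_ideal[OF J])
  then obtain k :: nat where k: "\<forall>K\<in>S. colon J (a [^] k) \<subseteq> K \<longrightarrow> K = colon J (a [^] k)" unfolding S_def by blast
  define K where "K = colon J (a [^] k)"
  have Ki: "ideal K R" unfolding K_def using a by (intro colon_ideal[OF J]) simp
  have "a [^] k \<notin> J" using a unfolding radical_def by blast
  hence "\<one> \<notin> K" using a by (simp add: K_def colon_def)
  then obtain Q where Q: "assoc_prime K Q" using assoc_prime_exists[OF Ki one_closed] by blast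
  have "K \<subseteq> colon J (a [^] Suc k)"
  proof
    fix x assume x: "x \<in> K"
    hence "x \<in> carrier R" "x \<otimes> a [^] k \<otimes> a \<in> J" using ideal_mult'[OF J _ a(1)] by (auto simp: K_def colon_def)
    thus "x \<in> colon J (a [^] Suc k)" using a by (simp add: colon_def m_assoc)
  qed
  hence e: "colon J (a [^] Suc k) = K" using k unfolding K_def S_def by blast
  have "nzd K a" unfolding nzd_def
  proof (intro ballI impI)
    fix x assume x: "x \<in> carrier R" "a \<otimes> x \<in> K"
    hence "x \<otimes> (a [^] Suc k) \<in> J" using a by (simp add: K_def colon_def m_ac)
    hence "x \<in> colon J (a [^] Suc k)" using x by (simp add: colon_def)
    thus "x \<in> K" using e by simp
  qed
  hence "a \<notin> Q" using nzd_notin_assoc_prime[OF Ki _ Q] by blast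
  moreover have "J \<subseteq> Q" using assoc_prime_sup[OF Ki Q] colon_sup[OF J, of "a [^] k"] a unfolding K_def by auto
  moreover have "primeideal Q R" using Q by (simp add: assoc_prime_def)
  ultimately show ?thesis by blast
qed

end

sublocale polynomials \<subseteq> RN: noeth_cring "mpoly_ring n :: (mon \<Rightarrow>\<^sub>0 'k) ring"
  by (intro noeth_cring.intro cring_Rn noeth_Rn)

context polynomials
begin

abbreviation "origin \<equiv> coord_prime {1..n}"

lemma origin_maximal: "maximalideal origin Rn"
proof (rule maximalidealI[OF coord_prime_ideal])
  show "carrier Rn \<noteq> origin" using prime_one'[OF coord_prime_prime] carr_01 by blast
  fix K assume K: "ideal K Rn" "origin \<subseteq> K" "K \<subseteq> carrier Rn"
  show "K = origin \<or> K = carrier Rn"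
  proof (cases "K \<subseteq> origin")
    case False
    then obtain f where f: "f \<in> K" "f \<notin> origin" by blast
    have fc: "f \<in> carrier Rn" using f K by blast
    define c where "c = lk f 0"
    have "f - Poly_Mapping.single 0 c \<in> origin"
    proof -
      have "ks u \<inter> {1..n} \<noteq> {}" if u: "u \<in> ks (f - Poly_Mapping.single 0 c)" for u
      proof -
        have "u \<noteq> 0" using u by (auto simp: in_keys_iff lookup_minus lookup_single c_def)
        have "u \<in> ks f" using u \<open>u \<noteq> 0\<close> by (auto simp: in_keys_iff lookup_minus lookup_single when_def split: if_splits)
        hence "ks u \<subseteq> {1..n}" using fc by (auto simp: carrier_iff monomials_def)
        moreover have "ks u \<noteq> {}" using \<open>u \<noteq> 0\<close> by simp
        ultimately show ?thesis by blast
      qed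
      thus ?thesis using carr_minus[OF fc const_carr] by (auto simp: coord_prime_def monomial_span_def)
    qed
    note g = this
    have "c \<noteq> 0"
    proof
      assume "c = 0"
      thus False using g f(2) by simp
    qed
    have "f - (f - Poly_Mapping.single 0 c) \<in> K" using id_minus[OF K(1) f(1)] g K(2) by blast
    hence "Poly_Mapping.single 0 (1/c) * Poly_Mapping.single 0 c \<in> K" using id_mult[OF K(1) _ const_carr] by simp
    hence "1 \<in> K" using \<open>c \<noteq> 0\<close> by (simp add: mult_single)
    thus ?thesis using ideal.one_imp_carrier[OF K(1)] by simp
  qed (use K in blast)
qed

text \<open>At the origin the empty set is a transcendence basis, each variable being its own relation.\<close>

lemma origin_algebraic: "\<forall>f\<in>origin. f \<in> poly_in {} \<longrightarrow> f = 0" "\<forall>v\<in>{1..n}-{}. \<exists>p\<in>origin. p \<in> poly_in (insert v {}) \<and> p \<noteq> 0"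
proof -
  show "\<forall>f\<in>origin. f \<in> poly_in {} \<longrightarrow> f = 0"
  proof (intro ballI impI, rule ccontr)
    fix f assume f: "f \<in> origin" "f \<in> poly_in {}" "f \<noteq> 0"
    then obtain u where u: "u \<in> ks f" by (metis keys_eq_empty ex_in_conv)
    have "ks u \<subseteq> {}" using f(2) u unfolding poly_in_def by blast
    moreover have "ks u \<inter> {1..n} \<noteq> {}" using f(1) u unfolding coord_prime_def monomial_span_def by blast
    ultimately show False by blast
  qed
  show "\<forall>v\<in>{1..n}-{}. \<exists>p\<in>origin. p \<in> poly_in (insert v {}) \<and> p \<noteq> 0"
  proof
    fix v assume v: "v \<in> {1..n}-{}"
    have "xvar v \<in> poly_in {v}" using v xvar_carr[of v] by (auto simp: poly_in_def xvar_def)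
    moreover have "xvar v \<noteq> 0" unfolding xvar_def by (metis lookup_single_eq lookup_zero zero_neq_one)
    ultimately show "\<exists>p\<in>origin. p \<in> poly_in (insert v {}) \<and> p \<noteq> 0" using xvar_coord_prime[of v "{1..n}"] v by auto
  qed
qed

definition xprod :: "nat set \<Rightarrow> (mon \<Rightarrow>\<^sub>0 'k)" where "xprod S = Poly_Mapping.single (\<Sum>i\<in>S. Poly_Mapping.single i 1) 1"

lemma xprod_insert: "finite S \<Longrightarrow> i \<notin> S \<Longrightarrow> xprod (insert i S) = xvar i * xprod S"
  by (simp add: xprod_def xvar_def mult_single)

lemma xprod_empty: "xprod {} = 1" by (simp add: xprod_def)

lemma keys_chi: fixes S :: "nat set" shows "finite S \<Longrightarrow> ks (\<Sum>i\<in>S. Poly_Mapping.single i (1::nat)) = S"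
proof (induction S rule: finite_induct)
  case (insert i S)
  show ?case unfolding sum.insert[OF insert.hyps] keys_add_nat insert.IH by simp
qed simp

lemma xprod_carr: assumes "S \<subseteq> {1..n}" shows "xprod S \<in> carrier Rn"
proof -
  have "finite S" by (rule finite_subset[OF assms]) simp
  have "(\<Sum>i\<in>S. Poly_Mapping.single i (1::nat)) \<in> monomials n"
    unfolding monomials_def mem_Collect_eq keys_chi[OF \<open>finite S\<close>] by (rule assms)
  thus ?thesis unfolding xprod_def by (rule carr_single)
qed

lemma xprod_prime: assumes Q: "primeideal Q Rn" and S: "finite S" "S \<subseteq> {1..n}"
  shows "xprod S \<in> Q \<longleftrightarrow> (\<exists>i\<in>S. xvar i \<in> Q)"
  using S
proof (induction S)
  case (insert i S)
  have "xprod (insert i S) \<in> Q \<longleftrightarrow> xvar i \<in> Q \<or> xprod S \<in> Q"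
    unfolding xprod_insert[OF insert.hyps] by (rule prime_mult'[OF Q xvar_carr xprod_carr]) (use insert.prems in blast)+
  thus ?case using insert by blast
qed (simp add: xprod_empty prime_one'[OF Q])

lemma coord_prime_chain_up: assumes "finite W" "Z \<inter> W = {}" "W \<subseteq> {1..n}"
  shows "\<exists>ps. prime_chain Rn ps \<and> length ps = Suc (card W) \<and> hd ps = coord_prime Z \<and> last ps = coord_prime (Z \<union> W)"
  using assms
proof (induction W)
  case empty
  show ?case by (intro exI[of _ "[coord_prime Z]"]) (auto simp: prime_chain_def coord_prime_prime)
next
  case (insert w W)
  then obtain ps where ps: "prime_chain Rn ps" "length ps = Suc (card W)" "hd ps = coord_prime Z" "last ps = coord_prime (Z \<union> W)" by auto
  have ne: "ps \<noteq> []" using ps by auto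
  have s: "coord_prime (Z \<union> W) \<subset> coord_prime (insert w (Z \<union> W))" using insert by (intro coord_prime_strict) auto
  have "P \<subset> coord_prime (insert w (Z \<union> W))" if "P \<in> set ps" for P
  proof -
    have "sorted_wrt (\<subseteq>) ps" by (rule sorted_wrt_mono_rel[of ps "(\<subset>)"]) (use ps(1) in \<open>auto simp: prime_chain_def\<close>)
    hence "P \<subseteq> last ps" using that
    proof (induction ps)
      case (Cons a ps) thus ?case by (cases ps) auto
    qed simp
    thus ?thesis using s ps(4) by auto
  qed
  hence "prime_chain Rn (ps @ [coord_prime (insert w (Z \<union> W))])" using ps(1) coord_prime_prime unfolding prime_chain_def by (auto simp: sorted_wrt_append)
  thus ?case using ps ne insert by (intro exI[of _ "ps @ [coord_prime (insert w (Z \<union> W))]"]) auto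
qed

lemma localized_polynomials_origin: assumes J: "ideal J Rn" "J \<subseteq> origin"
  shows "localized_polynomials n (localization (Rn Quot J) (carrier (Rn Quot J) - ((+>\<^bsub>Rn\<^esub>) J) ` origin))
    (\<lambda>r. loc_frac (Rn Quot J) (carrier (Rn Quot J) - ((+>\<^bsub>Rn\<^esub>) J) ` origin) (J +>\<^bsub>Rn\<^esub> r) \<one>\<^bsub>Rn Quot J\<^esub>) origin J"
proof -
  note q = R.quot_maximal[OF J(1) origin_maximal J(2)]
  interpret q: ring_hom_cring Rn "Rn Quot J" "(+>\<^bsub>Rn\<^esub>) J" by (rule R.quot_hom[OF J(1)])
  have p: "primeideal (((+>\<^bsub>Rn\<^esub>) J) ` origin) (Rn Quot J)" using q.S.maximalideal_prime[OF q(1)] .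
  show ?thesis using localized_ring_quotient[OF R.is_cring J(1) p] unfolding q(2) localized_polynomials_def .
qed

end

section \<open>Height, and the obstruction in the non-uniform case\<close>

text \<open>The ground set \<open>{1..n}\<close> is a parameter of the matroid constants and must not be rewritten to \<open>{Suc 0..n}\<close>.\<close>

declare One_nat_def [simp del]

locale matroid_ideal = polynomials n tk + M: matroid_bases "{1..n}" BB
  for n and tk :: "'k::field itself" and BB +
  assumes n1: "n \<ge> 1"
begin

definition basis_ideal :: "(mon \<Rightarrow>\<^sub>0 'k) set" where "basis_ideal = monomial_span (\<lambda>u. \<exists>B\<in>BB. B \<subseteq> ks u)"

lemma basis_ideal_ideal: "ideal basis_ideal Rn" unfolding basis_ideal_def by (rule monomial_span_ideal) (auto simp: keys_add_nat)

lemma rank_pos: "M.rank > 0"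
proof -
  obtain B where "B \<in> BB" "1 \<in> B" using M.cover[of 1] n1 by auto
  thus ?thesis using M.card_B[of B] M.finB[of B] by (metis card_gt_0_iff empty_iff)
qed

lemma rank_le: "M.rank \<le> n"
proof -
  obtain B where "B \<in> BB" using M.ne by blast
  thus ?thesis using M.card_B[of B] M.sub[of B] card_mono[of "{1..n}" B] by auto
qed

lemma basis_ideal_sub_coord_prime: assumes "Z \<subseteq> {1..n}" "M.nonspanning ({1..n} - Z)" shows "basis_ideal \<subseteq> coord_prime Z"
proof -
  have "ks u \<inter> Z \<noteq> {}" if "B \<in> BB" "B \<subseteq> ks u" for u B
    using assms that M.sub[OF that(1)] unfolding M.nonspanning_def by blast
  thus ?thesis unfolding basis_ideal_def coord_prime_def monomial_span_def by blast
qed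

lemma basis_monomial_mem: assumes "B \<in> BB" shows "xprod B \<in> basis_ideal"
proof -
  have "ks (\<Sum>i\<in>B. Poly_Mapping.single i (1::nat)) = B" using keys_chi M.finB[OF assms] by blast
  thus ?thesis using xprod_carr[OF M.sub[OF assms]] assms unfolding basis_ideal_def monomial_span_def xprod_def by auto
qed

lemma prime_above_basis_ideal: assumes P: "primeideal P Rn" "basis_ideal \<subseteq> P"
  shows "\<exists>Z. Z \<subseteq> {1..n} \<and> M.nonspanning ({1..n} - Z) \<and> coord_prime Z \<subseteq> P"
proof (intro exI conjI)
  let ?Z = "{i \<in> {1..n}. xvar i \<in> P}"
  show "?Z \<subseteq> {1..n}" by blast
  show "coord_prime ?Z \<subseteq> P" by (rule coord_prime_min[OF R.prime_ideal[OF P(1)]]) blast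
  show "M.nonspanning ({1..n} - ?Z)" unfolding M.nonspanning_def
  proof (intro conjI ballI notI)
    fix B assume B: "B \<in> BB" "B \<subseteq> {1..n} - ?Z"
    have "xprod B \<in> P" using basis_monomial_mem[OF B(1)] P(2) by blast
    then obtain i where "i \<in> B" "xvar i \<in> P" using xprod_prime[OF P(1) M.finB[OF B(1)] M.sub[OF B(1)]] by blast
    thus False using B(2) M.sub[OF B(1)] by blast
  qed blast
qed

lemma card_compl: "Z \<subseteq> {1..n} \<Longrightarrow> card ({1..n} - Z) = n - card Z \<and> card Z \<le> n"
  using finite_subset[of Z "{1..n}"] card_mono[of "{1..n}" Z] by (auto simp: card_Diff_subset)

lemma prime_above_basis_ideal_card: assumes "primeideal P Rn" "basis_ideal \<subseteq> P"
  obtains Z where "Z \<subseteq> {1..n}" "M.nonspanning ({1..n} - Z)" "coord_prime Z \<subseteq> P" "n \<le> card Z + M.max_nonspanning" "card Z \<le> n"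
proof -
  obtain Z where Z: "Z \<subseteq> {1..n}" "M.nonspanning ({1..n} - Z)" "coord_prime Z \<subseteq> P" using prime_above_basis_ideal[OF assms] by blast
  have "n - card Z \<le> M.max_nonspanning" "card Z \<le> n" using M.max_nonspanning(2)[OF rank_pos Z(2)] card_compl[OF Z(1)] by auto
  thus ?thesis using that Z by simp
qed

lemma max_nonspanning_le: "M.max_nonspanning \<le> n"
proof -
  obtain H where H: "M.nonspanning H" "card H = M.max_nonspanning" using M.max_nonspanning(1)[OF rank_pos] by blast
  thus ?thesis using card_mono[of "{1..n}" H] by (auto simp: M.nonspanning_def)
qed

lemma uniform_rks: assumes "M.uniform" shows "M.max_nonspanning = M.rank - 1"
proof -
  obtain H where H: "M.nonspanning H" "card H = M.max_nonspanning" using M.max_nonspanning(1)[OF rank_pos] by blast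
  hence "M.max_nonspanning < M.rank" using assms unfolding M.uniform_def by metis
  obtain B where B: "B \<in> BB" using M.ne by blast
  then obtain b where b: "b \<in> B" using rank_pos M.card_B by fastforce
  have "M.nonspanning (B - {b})"
    unfolding M.nonspanning_def using M.sub[OF B] M.B_eq[OF _ B] b by blast
  from M.max_nonspanning(2)[OF rank_pos this] have "M.rank - 1 \<le> M.max_nonspanning" using b M.card_B[OF B] by simp
  thus ?thesis using \<open>M.max_nonspanning < M.rank\<close> by linarith
qed

lemma basis_ideal_origin: "basis_ideal \<subseteq> origin"
proof -
  have "B \<noteq> {}" if "B \<in> BB" for B using M.card_B[OF that] rank_pos by auto
  hence "M.nonspanning ({1..n} - {1..n})" by (auto simp: M.nonspanning_def)
  thus ?thesis by (intro basis_ideal_sub_coord_prime) auto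
qed

text \<open>From above, a chain that ends in a coordinate prime over the ideal can be prolonged up to the origin by the
  remaining variables; from below, each prime over the ideal contains a coordinate prime.\<close>

lemma height_basis_ideal: "ideal_height Rn basis_ideal = enat (n - M.max_nonspanning)"
proof (rule antisym)
  obtain H where H: "M.nonspanning H" "card H = M.max_nonspanning" using M.max_nonspanning(1)[OF rank_pos] by blast
  have HE: "H \<subseteq> {1..n}" using H by (simp add: M.nonspanning_def)
  let ?P = "coord_prime ({1..n} - H)"
  have "{1..n} - ({1..n} - H) = H" using HE by blast
  hence IP: "basis_ideal \<subseteq> ?P" using H(1) by (intro basis_ideal_sub_coord_prime) auto
  have "prime_height Rn ?P \<le> enat (n - M.max_nonspanning)" unfolding prime_height_def
  proof (rule Sup_least, clarify)
    fix ps assume ps: "prime_chain Rn ps" "last ps = ?P"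
    obtain qs where qs: "prime_chain Rn qs" "length qs = Suc (card H)" "hd qs = ?P" "last qs = coord_prime ({1..n} - H \<union> H)"
      using coord_prime_chain_up[of H "{1..n} - H"] HE finite_subset[OF HE] by auto
    obtain q qs' where q: "qs = q # qs'" using qs(2) by (cases qs) auto
    obtain p ps' where p: "ps = ps' @ [p]" using ps(1) by (cases ps rule: rev_cases) (auto simp: prime_chain_def)
    have "prime_chain Rn (ps' @ q # qs')"
    proof -
      have pq: "p = q" using ps(2) qs(3) p q by simp
      have s1: "sorted_wrt (\<subset>) (ps' @ [q])" and s2: "sorted_wrt (\<subset>) (q # qs')" using ps(1) qs(1) p q pq by (auto simp: prime_chain_def)
      have "x \<subset> y" if "x \<in> set ps'" "y \<in> set qs'" for x y
      proof -
        have "x \<subset> q" using s1 that(1) by (auto simp: sorted_wrt_append)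
        moreover have "q \<subset> y" using s2 that(2) by auto
        ultimately show ?thesis by blast
      qed
      hence "sorted_wrt (\<subset>) (ps' @ q # qs')" using s1 s2 by (auto simp: sorted_wrt_append)
      thus ?thesis using ps(1) qs(1) unfolding prime_chain_def p q by auto
    qed
    moreover have "last (ps' @ q # qs') = origin"
    proof -
      have "last (ps' @ q # qs') = last qs" unfolding q by simp
      moreover have "{1..n} - H \<union> H = {1..n}" using HE by blast
      ultimately show ?thesis using qs(4) by simp
    qed
    ultimately have "length (ps' @ q # qs') + card ({} :: nat set) \<le> Suc n" using origin_algebraic(1) by (intro chain_length_bound) auto
    thus "enat (length ps - 1) \<le> enat (n - M.max_nonspanning)" using qs(2) q p H(2) by simp
  qed
  thus "ideal_height Rn basis_ideal \<le> enat (n - M.max_nonspanning)" unfolding ideal_height_def using coord_prime_prime IP by (auto intro: Inf_lower2)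
  show "enat (n - M.max_nonspanning) \<le> ideal_height Rn basis_ideal" unfolding ideal_height_def
  proof (rule Inf_greatest, clarify)
    fix P assume P: "primeideal P Rn" "basis_ideal \<subseteq> P"
    obtain Z where Z: "Z \<subseteq> {1..n}" "M.nonspanning ({1..n} - Z)" "coord_prime Z \<subseteq> P" "n \<le> card Z + M.max_nonspanning" by (rule prime_above_basis_ideal_card[OF P])
    obtain qs where qs: "length qs = card Z" "\<forall>P\<in>set qs. primeideal P Rn" "sorted_wrt (\<subset>) (qs @ [coord_prime Z])" 
      using coord_prime_chain[of Z] Z(1) finite_subset[OF Z(1)] by auto
    have "prime_chain Rn (qs @ [P])" using qs(2,3) P(1) Z(3) by (auto simp: prime_chain_def sorted_wrt_append)
    hence "enat (card Z) \<le> prime_height Rn P" unfolding prime_height_def using qs(1) by (intro Sup_upper) (force intro!: exI[of _ "qs @ [P]"])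
    moreover have "enat (n - M.max_nonspanning) \<le> enat (card Z)" using Z(4) by simp
    ultimately show "enat (n - M.max_nonspanning) \<le> prime_height Rn P" by (rule order_trans[rotated])
  qed
qed

text \<open>The ideals for \<open>hartshorne\<close> are generated by powers \<open>x\<^sub>i\<^sup>N\<close> with \<open>i \<notin> H\<close> and with \<open>i \<in> H - F\<close>, and \<open>C\<close> is a power of the
  monomial of \<open>B0\<close>. Their sum contains a regular sequence of length two modulo \<open>J\<close>: a prime that contains the sum
  lies over the coordinate prime of the complement of \<open>F\<close>, above which chains have at most \<open>card F + 1 < max_nonspanning\<close>
  members, whereas chains above the associated primes of \<open>J\<close> and of \<open>J + (a)\<close> are longer.\<close>

lemma nonuniform_no_regular_seq:
  fixes A :: "('b, 'c) ring_scheme"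
  assumes L: "localized_polynomials n A \<phi> origin I0" and nu: "\<not> M.uniform" and J: "ideal J A"
    and reg: "cring.has_regular_seq A (localized_ring.extended Rn A \<phi> origin origin) J M.max_nonspanning"
    and JP: "\<And>Z. Z \<subseteq> {1..n} \<Longrightarrow> M.nonspanning ({1..n} - Z) \<Longrightarrow> localized_ring.contracted Rn \<phi> J \<subseteq> coord_prime Z"
    and JI: "\<And>S. S \<in> BB \<Longrightarrow> \<exists>k::nat. \<phi> (xprod S ^ k) \<in> J"
  shows False
proof -
  interpret localized_polynomials n tk A \<phi> origin I0 by (rule L)
  obtain H F B0 H2 where H: "M.nonspanning H" "card H = M.max_nonspanning" "M.nonspanning H2" "F \<subseteq> H" "F \<subseteq> H2" "B0 \<subseteq> F" "card F + 2 \<le> M.max_nonspanning"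
     "H - F \<noteq> {}" "H2 - H \<noteq> {}" "\<forall>i\<in>{1..n}-H. \<forall>j\<in>H-F. insert i (insert j B0) \<in> BB" using M.nonuniform_configuration[OF nu rank_pos] by blast
  have HE: "H \<subseteq> {1..n}" "H2 \<subseteq> {1..n}" using H by (auto simp: M.nonspanning_def)
  have FE: "F \<subseteq> {1..n}" using HE H by blast
  have B0E: "B0 \<subseteq> {1..n}" "finite B0" using FE H finite_subset[of B0 "{1..n}"] by auto
  have finBB: "finite BB" by (rule finite_subset[of _ "Pow {1..n}"]) (use M.sub in auto)
  obtain kk where kk: "\<And>S. S \<in> BB \<Longrightarrow> \<phi> (xprod S ^ kk S) \<in> J" using JI by metis
  \<comment> \<open>one exponent for all bases at once\<close>
  define N where "N = Max (kk ` BB)"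
  have N: "\<phi> (xprod S ^ N) \<in> J" if S: "S \<in> BB" for S
  proof -
    have "kk S \<le> N" unfolding N_def using finBB S by (intro Max_ge) auto
    hence "xprod S ^ N = xprod S ^ (N - kk S) * xprod S ^ kk S" by (simp add: power_add[symmetric])
    hence "\<phi> (xprod S ^ N) = \<phi> (xprod S ^ (N - kk S)) \<otimes>\<^bsub>A\<^esub> \<phi> (xprod S ^ kk S)"
      using L.phi(2)[of "xprod S ^ (N - kk S)" "xprod S ^ kk S"] xprod_carr[OF M.sub[OF S]] carr_pow by simp
    thus ?thesis using L.A.ideal_mult[OF J kk[OF S]] L.phi(1) carr_pow xprod_carr[OF M.sub[OF S]] by simp
  qed
  define x where "x i = \<phi> (xvar i ^ N)" for i
  have xc: "x i \<in> carrier A" if "i \<in> {1..n}" for i unfolding x_def using that carr_pow xvar_carr L.phi(1) by blast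
  define C where "C = \<phi> (xprod B0 ^ N)"
  have Cc: "C \<in> carrier A" unfolding C_def using carr_pow xprod_carr[OF B0E(1)] L.phi(1) by blast
  define AA where "AA = Idl\<^bsub>A\<^esub> (x ` ({1..n} - H))"
  define DD where "DD = Idl\<^bsub>A\<^esub> (x ` (H - F))"
  have gA: "x ` ({1..n} - H) \<subseteq> carrier A" "x ` (H - F) \<subseteq> carrier A" using xc HE by auto
  have iA: "ideal AA A" "ideal DD A" unfolding AA_def DD_def using L.A.genideal_ideal gA by auto
  have sA: "x ` ({1..n} - H) \<subseteq> AA" "x ` (H - F) \<subseteq> DD" unfolding AA_def DD_def using L.A.genideal_self gA by auto
  have gen: "x j \<otimes>\<^bsub>A\<^esub> (C \<otimes>\<^bsub>A\<^esub> x i) \<in> J" if i: "i \<in> {1..n} - H" and j: "j \<in> H - F" for i j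
  proof -
    have jB: "j \<notin> B0" and iB: "i \<notin> insert j B0" using i j H by auto
    have "xprod (insert i (insert j B0)) ^ N = xvar j ^ N * (xprod B0 ^ N * xvar i ^ N)"
      using xprod_insert[OF _ iB] xprod_insert[OF B0E(2) jB] B0E(2) by (simp add: power_mult_distrib mult_ac)
    moreover have c: "xvar j ^ N \<in> carrier Rn" "xvar i ^ N \<in> carrier Rn" "xprod B0 ^ N \<in> carrier Rn"
      using i j HE B0E carr_pow xvar_carr xprod_carr by blast+
    ultimately have "\<phi> (xprod (insert i (insert j B0)) ^ N) = x j \<otimes>\<^bsub>A\<^esub> (C \<otimes>\<^bsub>A\<^esub> x i)"
      using L.phi(2)[OF c(1) carr_mult[OF c(3,2)]] L.phi(2)[OF c(3,2)] by (simp add: x_def C_def)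
    thus ?thesis using N[of "insert i (insert j B0)"] H(10) i j by auto
  qed
  have ab: "C \<otimes>\<^bsub>A\<^esub> (a \<otimes>\<^bsub>A\<^esub> d) \<in> J" if a: "a \<in> AA" and d: "d \<in> DD" for a d
  proof -
    have dc: "d \<in> carrier A" "a \<in> carrier A" using d a iA L.A.ideal_carr by blast+
    have 1: "d \<otimes>\<^bsub>A\<^esub> (C \<otimes>\<^bsub>A\<^esub> x i) \<in> J" if i: "i \<in> {1..n} - H" for i
    proof -
      have "C \<otimes>\<^bsub>A\<^esub> x i \<in> carrier A" using Cc xc i by simp
      from L.A.colon_ideal[OF J this] have "DD \<subseteq> L.A.colon J (C \<otimes>\<^bsub>A\<^esub> x i)"
        unfolding DD_def by (rule L.A.genideal_minimal) (use gen[OF i] gA in \<open>auto simp: L.A.colon_def\<close>)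
      thus ?thesis using d by (auto simp: L.A.colon_def)
    qed
    have "C \<otimes>\<^bsub>A\<^esub> d \<in> carrier A" using Cc dc by simp
    from L.A.colon_ideal[OF J this] have "AA \<subseteq> L.A.colon J (C \<otimes>\<^bsub>A\<^esub> d)"
      unfolding AA_def
    proof (rule L.A.genideal_minimal, clarify)
      fix i assume i: "i \<in> {1..n}" "i \<notin> H"
      have "x i \<otimes>\<^bsub>A\<^esub> (C \<otimes>\<^bsub>A\<^esub> d) = d \<otimes>\<^bsub>A\<^esub> (C \<otimes>\<^bsub>A\<^esub> x i)" using Cc xc[OF i(1)] dc by (simp add: L.A.m_ac)
      thus "x i \<in> L.A.colon J (C \<otimes>\<^bsub>A\<^esub> d)" using 1[of i] i xc by (simp add: L.A.colon_def)
    qed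
    hence "a \<otimes>\<^bsub>A\<^esub> (C \<otimes>\<^bsub>A\<^esub> d) \<in> J" using a by (auto simp: L.A.colon_def)
    thus ?thesis using Cc dc by (simp add: L.A.m_ac)
  qed
  define q where "q = AA <+>\<^bsub>A\<^esub> DD"
  have qi: "ideal q A" unfolding q_def using L.A.add_ideals[OF iA] .
  have qe: "\<exists>a\<in>AA. \<exists>d\<in>DD. y = a \<oplus>\<^bsub>A\<^esub> d" if "y \<in> q" for y using that unfolding q_def set_add_def' by auto
  have Aq: "AA \<subseteq> q" "DD \<subseteq> q"
  proof -
    show "AA \<subseteq> q"
    proof
      fix a assume a: "a \<in> AA"
      have "a = a \<oplus>\<^bsub>A\<^esub> \<zero>\<^bsub>A\<^esub>" using a iA L.A.ideal_carr by simp
      thus "a \<in> q" unfolding q_def set_add_def' using a L.A.ideal_zero[OF iA(2)] by blast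
    qed
    show "DD \<subseteq> q"
    proof
      fix a assume a: "a \<in> DD"
      have "a = \<zero>\<^bsub>A\<^esub> \<oplus>\<^bsub>A\<^esub> a" using a iA L.A.ideal_carr by simp
      thus "a \<in> q" unfolding q_def set_add_def' using a L.A.ideal_zero[OF iA(1)] by blast
    qed
  qed
  have noQ: "\<not> q \<subseteq> Q" if K: "ideal K A" "L.A.has_regular_seq (L.extended origin) K r" "M.max_nonspanning \<le> Suc r" and Q: "L.A.assoc_prime K Q" for K r Q
  proof
    assume qQ: "q \<subseteq> Q"
    obtain ps where ps: "prime_chain A ps" "length ps = Suc r" "hd ps = Q" using N.has_regular_seq_chain[OF K(1,2) Q] by blast
    have Qp: "primeideal Q A" using Q by (simp add: L.A.assoc_prime_def)
    have "xvar i \<in> L.contracted Q" if i: "i \<in> {1..n} - F" for i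
    proof -
      have vc: "xvar i \<in> carrier Rn" using i xvar_carr by blast
      have "x i \<in> Q" using sA Aq qQ i by blast
      hence "xvar i ^ N \<in> L.contracted Q" unfolding L.contracted_def x_def using carr_pow[OF vc] by blast
      thus ?thesis using R.prime_pow[OF L.contracted_prime[OF Qp] vc, of N] by simp
    qed
    hence "coord_prime ({1..n} - F) \<subseteq> L.contracted (hd ps)" unfolding ps(3) by (intro coord_prime_min L.contracted_ideal L.A.prime_ideal Qp) auto
    hence "length ps + card ({1..n} - F) + card ({} :: nat set) \<le> Suc n" using origin_algebraic(1) ps(1) by (intro chain_length_localized) auto
    moreover have "card ({1..n} - F) = n - card F" "card F \<le> n" using card_compl[OF FE] by blast+
    ultimately have "Suc r + (n - card F) \<le> Suc n" using ps(2) by simp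
    thus False using \<open>card F \<le> n\<close> H(7) K(3) by linarith
  qed
  have qm: "q \<subseteq> L.extended origin"
  proof -
    have "x i \<in> L.extended origin" if "N > 0" "i \<in> {1..n}" for i
    proof -
      have "xvar i ^ N = xvar i ^ (N - 1) * xvar i" using that by (simp add: power_eq_if mult.commute)
      hence "xvar i ^ N \<in> origin" using xvar_coord_prime[OF that(2), of "{1..n}"] that id_mult[OF coord_prime_ideal] carr_pow[OF xvar_carr] by metis
      thus ?thesis unfolding x_def by (rule L.phi_extended[OF coord_prime_ideal])
    qed
    moreover have "N > 0"
    proof (rule ccontr)
      assume "\<not> N > 0"
      hence "N = 0" by simp
      obtain B where "B \<in> BB" using M.ne by blast
      hence "1 \<in> L.contracted J" using N[of B] \<open>N = 0\<close> carr_01 by (simp add: L.contracted_def)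
      moreover have "L.contracted J \<subseteq> coord_prime ({1..n} - H)" using H(1) HE by (intro JP) (auto simp: double_diff)
      ultimately show False using prime_one'[OF coord_prime_prime] by blast
    qed
    ultimately have xm0: "x i \<in> L.extended origin" if "i \<in> {1..n}" for i using that by blast
    have "AA \<subseteq> L.extended origin" unfolding AA_def by (rule L.A.genideal_minimal[OF N.m_ideal]) (use xm0 in blast)
    moreover have "DD \<subseteq> L.extended origin" unfolding DD_def by (rule L.A.genideal_minimal[OF N.m_ideal]) (use xm0 HE in blast)
    ultimately have "a \<oplus>\<^bsub>A\<^esub> d \<in> L.extended origin" if "a \<in> AA" "d \<in> DD" for a d
      using L.A.ideal_add[OF N.m_ideal, of a d] that by blast
    thus ?thesis using qe by (metis subsetI)
  qed
  obtain s where s: "M.max_nonspanning = Suc s" using H(7) by (cases M.max_nonspanning) auto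
  have "\<exists>c\<in>q. \<forall>K\<in>{J}. L.A.nzd K c"
    using noQ[OF J reg] J by (intro N.nzd_avoid[OF _ _ qi]) auto
  then obtain a where a: "a \<in> q" "L.A.nzd J a" by blast
  have ac: "a \<in> carrier A" using a L.A.ideal_carr[OF qi] by blast
  have iJa: "ideal (L.A.adjoin J a) A" using L.A.adjoin_ideal[OF J ac] .
  have "L.A.has_regular_seq (L.extended origin) (L.A.adjoin J a) s"
    using N.has_regular_seq_adjoin[OF J N.m_ideal _ _ a(2)] reg s a(1) qm by auto
  hence "\<exists>c\<in>q. \<forall>K\<in>{L.A.adjoin J a}. L.A.nzd K c"
    using noQ[OF iJa] s iJa by (intro N.nzd_avoid[OF _ _ qi]) auto
  then obtain b where b: "b \<in> q" "L.A.nzd (L.A.adjoin J a) b" by blast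
  obtain a1 a2 where a12: "a1 \<in> AA" "a2 \<in> DD" "a = a1 \<oplus>\<^bsub>A\<^esub> a2" using qe a by blast
  obtain b1 b2 where b12: "b1 \<in> AA" "b2 \<in> DD" "b = b1 \<oplus>\<^bsub>A\<^esub> b2" using qe b by blast
  have I0: "I0 \<subseteq> coord_prime Z" if "Z \<subseteq> {1..n}" "M.nonspanning ({1..n} - Z)" for Z
    using JP[OF that] L.contracted_I0[OF J] by blast
  have pr: "primeideal (L.extended (coord_prime Z)) A" "L.contracted (L.extended (coord_prime Z)) = coord_prime Z" if "I0 \<subseteq> coord_prime Z" "Z \<subseteq> {1..n}" for Z
    using L.extended_prime[OF coord_prime_prime _ that(1)] L.contracted_ext_prime[OF coord_prime_prime _ that(1)] coord_prime_mono[OF that(2)] by auto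
  have ns: "M.nonspanning ({1..n} - ({1..n} - H))" "M.nonspanning ({1..n} - ({1..n} - H2))"
    using H HE by (auto simp: double_diff)
  have I0H: "I0 \<subseteq> coord_prime ({1..n} - H)" "I0 \<subseteq> coord_prime ({1..n} - H2)" using I0 ns by auto
  have mono: "coord_prime ({1..n} - H) \<subseteq> coord_prime ({1..n} - F)" "coord_prime ({1..n} - H2) \<subseteq> coord_prime ({1..n} - F)" 
    by (rule coord_prime_mono, use H(4,5) in blast)+
  have I0F: "I0 \<subseteq> coord_prime ({1..n} - F)" using I0H mono by blast
  have Jsub: "J \<subseteq> L.extended (coord_prime ({1..n} - H))" "J \<subseteq> L.extended (coord_prime ({1..n} - H2))"
  proof -
    have "J \<subseteq> L.extended (coord_prime Z)" if "Z \<subseteq> {1..n}" "M.nonspanning ({1..n} - Z)" for Z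
      using L.extended_contracted[OF J] L.extended_mono[OF JP[OF that]] by simp
    from this[OF Diff_subset ns(1)] this[OF Diff_subset ns(2)] 
    show "J \<subseteq> L.extended (coord_prime ({1..n} - H))" "J \<subseteq> L.extended (coord_prime ({1..n} - H2))" .
  qed
  have xnot: "x i \<notin> L.extended (coord_prime Z)" if "i \<in> {1..n} - Z" "I0 \<subseteq> coord_prime Z" "Z \<subseteq> {1..n}" for i Z
  proof
    assume "x i \<in> L.extended (coord_prime Z)"
    have vc: "xvar i \<in> carrier Rn" using that xvar_carr by blast
    have "xvar i ^ N \<in> L.contracted (L.extended (coord_prime Z))" using \<open>x i \<in> L.extended (coord_prime Z)\<close> carr_pow[OF vc] unfolding L.contracted_def x_def by blast
    hence "xvar i ^ N \<in> coord_prime Z" using pr that by blast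
    hence "xvar i \<in> coord_prime Z" using R.prime_pow[OF coord_prime_prime vc, of N] by simp
    thus False using xvar_coord_prime that by blast
  qed
  have CP: "C \<notin> L.extended (coord_prime ({1..n} - F))"
  proof
    assume Cin: "C \<in> L.extended (coord_prime ({1..n} - F))"
    have xc: "xprod B0 \<in> carrier Rn" using xprod_carr[OF B0E(1)] .
    have "xprod B0 ^ N \<in> L.contracted (L.extended (coord_prime ({1..n} - F)))" using Cin carr_pow[OF xc] unfolding L.contracted_def C_def by blast
    hence "xprod B0 ^ N \<in> coord_prime ({1..n} - F)" using pr[OF I0F] by blast
    hence "xprod B0 \<in> coord_prime ({1..n} - F)" using R.prime_pow[OF coord_prime_prime xc, of N] by simp
    then obtain i where i: "i \<in> B0" "xvar i \<in> coord_prime ({1..n} - F)" using xprod_prime[OF coord_prime_prime B0E(2,1)] by blast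
    hence "i \<in> {1..n} - F" using xvar_coord_prime[of i] B0E by blast
    thus False using i H(6) by blast
  qed
  obtain j0 where j0: "j0 \<in> H - F" using H(8) by blast
  obtain i0 where i0: "i0 \<in> H2 - H" using H(9) by blast
  show False
  proof (rule N.hartshorne[OF J iA Cc ab, of a1 a2 b1 b2 "L.extended (coord_prime ({1..n} - F))" "L.extended (coord_prime ({1..n} - H))" "x j0" "L.extended (coord_prime ({1..n} - H2))" "x i0"])
    show "L.A.nzd J (a1 \<oplus>\<^bsub>A\<^esub> a2)" using a a12 by simp
    show "L.A.nzd (L.A.adjoin J (a1 \<oplus>\<^bsub>A\<^esub> a2)) (b1 \<oplus>\<^bsub>A\<^esub> b2)" using b a12 b12 by simp
    show "primeideal (L.extended (coord_prime ({1..n} - F))) A" "primeideal (L.extended (coord_prime ({1..n} - H))) A" "primeideal (L.extended (coord_prime ({1..n} - H2))) A"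
      using pr I0F I0H by auto
    show "L.extended (coord_prime ({1..n} - H)) \<subseteq> L.extended (coord_prime ({1..n} - F))" "L.extended (coord_prime ({1..n} - H2)) \<subseteq> L.extended (coord_prime ({1..n} - F))"
      using L.extended_mono mono by auto
    show "x j0 \<in> DD" using j0 sA by blast
    show "x i0 \<in> AA" using i0 HE sA by blast
    show "x j0 \<notin> L.extended (coord_prime ({1..n} - H))" using j0 HE I0H by (intro xnot) auto
    show "x i0 \<notin> L.extended (coord_prime ({1..n} - H2))" using i0 HE I0H by (intro xnot) auto
  qed (use a12 b12 CP Jsub in auto)
qed

end

section \<open>Arithmetical rank and Cohen-Macaulayness\<close>

context matroid_ideal
begin

lemma rad_prime_iff:
  assumes fs: "set fs \<subseteq> carrier Rn" "radical Rn (Idl\<^bsub>Rn\<^esub> (set fs)) = radical Rn basis_ideal" and Q: "primeideal Q Rn"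
  shows "set fs \<subseteq> Q \<longleftrightarrow> basis_ideal \<subseteq> Q"
proof
  have i: "ideal (Idl\<^bsub>Rn\<^esub> (set fs)) Rn" using R.genideal_ideal[OF fs(1)] .
  assume "set fs \<subseteq> Q"
  hence "Idl\<^bsub>Rn\<^esub> (set fs) \<subseteq> Q" by (rule R.genideal_minimal[OF R.prime_ideal[OF Q]])
  thus "basis_ideal \<subseteq> Q" using R.radical_prime_sub[OF Q, of "Idl\<^bsub>Rn\<^esub> (set fs)"] fs(2) R.radical_sup[OF R.ideal_sub[OF basis_ideal_ideal]] by blast
next
  have i: "ideal (Idl\<^bsub>Rn\<^esub> (set fs)) Rn" using R.genideal_ideal[OF fs(1)] .
  assume "basis_ideal \<subseteq> Q"
  thus "set fs \<subseteq> Q" using R.radical_prime_sub[OF Q, of basis_ideal] fs(2) R.radical_sup[OF R.ideal_sub[OF i]] R.genideal_self[OF fs(1)] by blast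
qed

lemma zero_origin: "{0} \<subseteq> origin" using id_zero[OF coord_prime_ideal] by blast

lemma zero_ideal: "ideal {0} Rn" using R.zeroideal by simp

lemma coord_prime_empty: "coord_prime {} = {0}"
proof -
  have "f = 0" if "f \<in> coord_prime {}" for f
  proof -
    have "ks f = {}" using that unfolding coord_prime_def monomial_span_def by blast
    thus ?thesis by simp
  qed
  thus ?thesis using id_zero[OF coord_prime_ideal[of "{}"]] by blast
qed

text \<open>The local ring at the origin has a regular sequence of length \<open>n\<close>. By \<open>regular_generators\<close>, one of length
  \<open>n - length fs\<close> is left modulo \<open>fs\<close>, and the chains above an associated prime limit it to \<open>max_nonspanning\<close>.\<close>

lemma few_generators:
  assumes fs: "set fs \<subseteq> carrier Rn" "radical Rn (Idl\<^bsub>Rn\<^esub> (set fs)) = radical Rn basis_ideal" and len: "length fs \<le> n - M.max_nonspanning"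
  shows "length fs = n - M.max_nonspanning \<and> M.uniform"
proof -
  define A where "A = localization (Rn Quot {0}) (carrier (Rn Quot {0}) - ((+>\<^bsub>Rn\<^esub>) {0}) ` origin)"
  define \<phi> where "\<phi> = (\<lambda>r. loc_frac (Rn Quot {0}) (carrier (Rn Quot {0}) - ((+>\<^bsub>Rn\<^esub>) {0}) ` origin) ({0} +>\<^bsub>Rn\<^esub> r) \<one>\<^bsub>Rn Quot {0}\<^esub>)"
  have mA: "localized_polynomials n A \<phi> origin {0}" unfolding A_def \<phi>_def by (rule localized_polynomials_origin[OF zero_ideal zero_origin])
  then interpret localized_polynomials n tk A \<phi> origin "{0}" .
  have iff: "set fs \<subseteq> Q \<longleftrightarrow> basis_ideal \<subseteq> Q" if "primeideal Q Rn" for Q using rad_prime_iff[OF fs that] .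
  have fm: "set fs \<subseteq> origin" using iff[OF coord_prime_prime] basis_ideal_origin by blast
  let ?gs = "map \<phi> fs"
  have gm: "set ?gs \<subseteq> L.extended origin" using fm L.phi_extended[OF coord_prime_ideal] by auto
  have "L.A.has_regular_seq (L.extended origin) (L.extended (coord_prime {})) (n - card ({} :: nat set) - card ({} :: nat set))"
    using origin_algebraic coord_prime_empty by (intro regular_seq_mod_coord_prime) auto
  hence r0: "L.A.has_regular_seq (L.extended origin) {\<zero>\<^bsub>A\<^esub>} n" using L.extended_I0 coord_prime_empty by simp
  have chain: "length ps \<le> Suc M.max_nonspanning" if ps: "prime_chain A ps" "set ?gs \<subseteq> hd ps" for ps
  proof -
    have hp: "primeideal (hd ps) A" using ps(1) by (cases ps) (auto simp: prime_chain_def)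
    have cp: "primeideal (L.contracted (hd ps)) Rn" by (rule L.contracted_prime[OF hp])
    have "set fs \<subseteq> L.contracted (hd ps)" using ps(2) fs(1) by (auto simp: L.contracted_def)
    hence "basis_ideal \<subseteq> L.contracted (hd ps)" using iff[OF cp] by blast
    then obtain Z where Z: "Z \<subseteq> {1..n}" "M.nonspanning ({1..n} - Z)" "coord_prime Z \<subseteq> L.contracted (hd ps)" "n \<le> card Z + M.max_nonspanning" "card Z \<le> n"
      by (rule prime_above_basis_ideal_card[OF cp])
    have "length ps + card Z + card ({} :: nat set) \<le> Suc n" using origin_algebraic(1) ps(1) Z by (intro chain_length_localized) auto
    thus ?thesis using Z(4) by simp
  qed
  define J where "J = L.A.adjoin_list {\<zero>\<^bsub>A\<^esub>} ?gs"
  have gc: "set ?gs \<subseteq> carrier A" using gm L.A.ideal_carr[OF N.m_ideal] by blast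
  have Jp: "ideal J A" "set ?gs \<subseteq> J" unfolding J_def using L.A.adjoin_list_props[OF L.A.zeroideal gc] by auto
  have Jmin: "J \<subseteq> K" if "ideal K A" "set ?gs \<subseteq> K" for K
    unfolding J_def using that L.A.ideal_zero by (intro L.A.adjoin_list_min[OF L.A.zeroideal]) auto
  have reg: "L.A.has_regular_seq (L.extended origin) J (n - length fs)"
  proof -
    have "length ps + length ?gs \<le> Suc n" if "prime_chain A ps" "set ?gs \<subseteq> hd ps" for ps
      using chain[OF that] len max_nonspanning_le by simp
    from N.regular_generators[OF L.A.zeroideal r0 gm this] show ?thesis unfolding J_def by simp
  qed
  have "\<one>\<^bsub>A\<^esub> \<notin> J" using Jmin[OF N.m_ideal gm] N.m_proper by blast
  then obtain Q where Q: "L.A.assoc_prime J Q" using N.assoc_prime_exists[OF Jp(1) L.A.one_closed] by blast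
  obtain ps where ps: "prime_chain A ps" "length ps = Suc (n - length fs)" "hd ps = Q" using N.has_regular_seq_chain[OF Jp(1) reg Q] by blast
  have "set ?gs \<subseteq> hd ps" using L.A.assoc_prime_sup[OF Jp(1) Q] Jp(2) ps(3) by blast
  hence "n - length fs \<le> M.max_nonspanning" using chain[OF ps(1)] ps(2) by simp
  hence l: "length fs = n - M.max_nonspanning" using len max_nonspanning_le by linarith
  have "M.uniform"
  proof (rule ccontr)
    assume nu: "\<not> M.uniform"
    have "n - length fs = M.max_nonspanning" using l max_nonspanning_le by simp
    hence reg': "L.A.has_regular_seq (L.extended origin) J M.max_nonspanning" using reg by simp
    show False
    proof (rule nonuniform_no_regular_seq[OF mA nu Jp(1) reg'])
      fix Z assume Z: "Z \<subseteq> {1..n}" "M.nonspanning ({1..n} - Z)"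
      have "set fs \<subseteq> coord_prime Z" using iff[OF coord_prime_prime] basis_ideal_sub_coord_prime[OF Z] by blast
      hence "set ?gs \<subseteq> L.extended (coord_prime Z)" using L.phi_extended[OF coord_prime_ideal] by auto
      hence "J \<subseteq> L.extended (coord_prime Z)" by (rule Jmin[OF L.extended_ideal[OF coord_prime_ideal]])
      hence "L.contracted J \<subseteq> L.contracted (L.extended (coord_prime Z))" by (auto simp: L.contracted_def)
      also have "\<dots> = coord_prime Z" using coord_prime_mono[OF Z(1)] id_zero[OF coord_prime_ideal] by (intro L.contracted_ext_prime coord_prime_prime) auto
      finally show "L.contracted J \<subseteq> coord_prime Z" .
    next
      fix S assume S: "S \<in> BB"
      have "xprod S \<in> radical Rn (Idl\<^bsub>Rn\<^esub> (set fs))" using basis_monomial_mem[OF S] R.radical_sup[OF R.ideal_sub[OF basis_ideal_ideal]] fs(2) by blast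
      then obtain k where k: "xprod S ^ k \<in> Idl\<^bsub>Rn\<^esub> (set fs)" by (auto simp: radical_def)
      have "set fs \<subseteq> L.contracted J" using Jp(2) fs(1) by (auto simp: L.contracted_def)
      hence "Idl\<^bsub>Rn\<^esub> (set fs) \<subseteq> L.contracted J" by (rule R.genideal_minimal[OF L.contracted_ideal[OF Jp(1)]])
      thus "\<exists>k. \<phi> (xprod S ^ k) \<in> J" using k by (auto simp: L.contracted_def)
    qed
  qed
  thus ?thesis using l by blast
qed

definition esym :: "nat \<Rightarrow> (mon \<Rightarrow>\<^sub>0 'k)" where "esym k = (\<Sum>S\<in>{S. S \<subseteq> {1..n} \<and> card S = k}. xprod S)"

lemma esym_carr: "esym k \<in> carrier Rn" unfolding esym_def by (intro carr_sum xprod_carr) auto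

text \<open>A prime \<open>Q\<close> over the elementary symmetric polynomials omits fewer than \<open>rank\<close> variables. If it omitted the variables in
  a set \<open>C\<close> with \<open>card C \<ge> rank\<close>, then every term of \<open>esym (card C)\<close> except the product over \<open>C\<close> would contain a
  variable from \<open>Q\<close>, so that product would be in \<open>Q\<close> too.\<close>

lemma esym_radical:
  assumes u: "M.uniform"
  shows "radical Rn (Idl\<^bsub>Rn\<^esub> (set (map esym [M.rank..<Suc n]))) = radical Rn basis_ideal"
proof -
  let ?F = "set (map esym [M.rank..<Suc n])"
  have Fc: "?F \<subseteq> carrier Rn" using esym_carr by auto
  have i: "ideal (Idl\<^bsub>Rn\<^esub> ?F) Rn" using R.genideal_ideal[OF Fc] .
  have finS: "finite S" if "S \<subseteq> {1..n}" for S using finite_subset[OF that] by simp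
  have e_in: "esym k \<in> basis_ideal" if rank: "M.rank \<le> k" for k unfolding esym_def
  proof (rule id_sum[OF basis_ideal_ideal])
    fix S assume S: "S \<in> {S. S \<subseteq> {1..n} \<and> card S = k}"
    have "M.rank \<le> card S" using S rank by simp
    then obtain B where B: "B \<subseteq> S" "card B = M.rank" by (metis obtain_subset_with_card_n)
    have "B \<in> BB" using M.uniform_base[OF u _ B(2)] B(1) S by blast
    moreover have "ks (\<Sum>i\<in>S. Poly_Mapping.single i (1::nat)) = S" using keys_chi finS S by blast
    ultimately show "xprod S \<in> basis_ideal" using xprod_carr[of S] S B(1) unfolding basis_ideal_def monomial_span_def xprod_def by auto
  qed
  have 1: "Idl\<^bsub>Rn\<^esub> ?F \<subseteq> basis_ideal" using e_in by (intro R.genideal_minimal[OF basis_ideal_ideal]) auto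
  have 2: "basis_ideal \<subseteq> radical Rn (Idl\<^bsub>Rn\<^esub> ?F)"
  proof (rule ccontr)
    assume "\<not> ?thesis"
    then obtain a where a: "a \<in> basis_ideal" "a \<notin> radical Rn (Idl\<^bsub>Rn\<^esub> ?F)" by blast
    obtain Q where Q: "primeideal Q Rn" "Idl\<^bsub>Rn\<^esub> ?F \<subseteq> Q" "a \<notin> Q"
      using RN.radical_prime[OF i id_carr[OF basis_ideal_ideal a(1)] a(2)] by blast
    let ?C = "{i \<in> {1..n}. xvar i \<notin> Q}"
    have Cf: "finite ?C" by simp
    have "card ?C < M.rank"
    proof (rule ccontr)
      assume "\<not> card ?C < M.rank"
      hence c: "M.rank \<le> card ?C" by simp
      have "?C \<subseteq> {1..n}" by blast
      hence "card ?C \<le> card {1..n}" by (rule card_mono[rotated]) simp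
      hence "card ?C \<le> n" by simp
      hence "card ?C \<in> set [M.rank..<Suc n]" using c by (simp only: set_upt atLeastLessThan_iff less_Suc_eq_le)
      hence "esym (card ?C) \<in> ?F" unfolding set_map by (rule imageI)
      hence eQ: "esym (card ?C) \<in> Q" using Q(2) R.genideal_self[OF Fc] by blast
      have es: "esym (card ?C) = xprod ?C + (\<Sum>S\<in>{S. S \<subseteq> {1..n} \<and> card S = card ?C} - {?C}. xprod S)"
        unfolding esym_def by (rule sum.remove) auto
      have rest: "(\<Sum>S\<in>{S. S \<subseteq> {1..n} \<and> card S = card ?C} - {?C}. xprod S) \<in> Q"
      proof (rule id_sum[OF R.prime_ideal[OF Q(1)]])
        fix S assume S: "S \<in> {S. S \<subseteq> {1..n} \<and> card S = card ?C} - {?C}"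
        have "\<not> S \<subseteq> ?C" using card_subset_eq[OF Cf, of S] S by auto
        then obtain i where "i \<in> S" "xvar i \<in> Q" using S by blast
        thus "xprod S \<in> Q" using xprod_prime[OF Q(1), of S] finS S by blast
      qed
      have "xprod ?C \<in> Q" by (rule id_add_cancel[OF R.prime_ideal[OF Q(1)] eQ[unfolded es] rest])
      moreover have "?C \<subseteq> {1..n}" by blast
      ultimately show False using xprod_prime[OF Q(1) Cf] by blast
    qed
    have "M.nonspanning ({1..n} - ({1..n} - ?C))" unfolding M.nonspanning_def
    proof (intro conjI ballI notI)
      fix B assume B: "B \<in> BB" "B \<subseteq> {1..n} - ({1..n} - ?C)"
      hence "B \<subseteq> ?C" by blast
      hence "card B \<le> card ?C" by (intro card_mono) auto
      thus False using M.card_B[OF B(1)] \<open>card ?C < M.rank\<close> by simp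
    qed blast
    hence "basis_ideal \<subseteq> coord_prime ({1..n} - ?C)" by (intro basis_ideal_sub_coord_prime) auto
    moreover have "coord_prime ({1..n} - ?C) \<subseteq> Q" by (rule coord_prime_min[OF R.prime_ideal[OF Q(1)]]) blast
    ultimately show False using a(1) Q(3) by blast
  qed
  show ?thesis
  proof
    show "radical Rn (Idl\<^bsub>Rn\<^esub> ?F) \<subseteq> radical Rn basis_ideal" using 1 unfolding radical_def by blast
    show "radical Rn basis_ideal \<subseteq> radical Rn (Idl\<^bsub>Rn\<^esub> ?F)"
    proof
      fix a assume "a \<in> radical Rn basis_ideal"
      then obtain k where k: "a \<in> carrier Rn" "a ^ k \<in> basis_ideal" by (auto simp: radical_def)
      hence "a ^ k \<in> radical Rn (Idl\<^bsub>Rn\<^esub> ?F)" using 2 by blast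
      then obtain l where "(a ^ k) ^ l \<in> Idl\<^bsub>Rn\<^esub> ?F" by (auto simp: radical_def)
      hence "a ^ (k * l) \<in> Idl\<^bsub>Rn\<^esub> ?F" by (simp add: power_mult)
      thus "a \<in> radical Rn (Idl\<^bsub>Rn\<^esub> ?F)" using k(1) unfolding radical_def by auto
    qed
  qed
qed

lemma stci_iff: "set_theoretic_complete_intersection Rn basis_ideal \<longleftrightarrow> M.uniform"
proof -
  let ?L = "{enat (length fs) | fs. set fs \<subseteq> carrier Rn \<and> radical Rn (Idl\<^bsub>Rn\<^esub> (set fs)) = radical Rn basis_ideal}"
  have ar: "arith_rank Rn basis_ideal = Inf ?L" by (simp add: arith_rank_def)
  show ?thesis unfolding set_theoretic_complete_intersection_def height_basis_ideal
  proof
    assume eq: "arith_rank Rn basis_ideal = enat (n - M.max_nonspanning)"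
    have "?L \<noteq> {}"
    proof
      assume "?L = {}"
      hence "arith_rank Rn basis_ideal = \<infinity>" unfolding ar by (simp only: Inf_enat_def) simp
      thus False using eq by simp
    qed
    then obtain e where "e \<in> ?L" by blast
    hence "Inf ?L \<in> ?L" unfolding Inf_enat_def using LeastI[of "\<lambda>e. e \<in> ?L" e] \<open>?L \<noteq> {}\<close> by simp
    hence "enat (n - M.max_nonspanning) \<in> ?L" using ar eq by simp
    then obtain fs where "set fs \<subseteq> carrier Rn" "radical Rn (Idl\<^bsub>Rn\<^esub> (set fs)) = radical Rn basis_ideal" "length fs = n - M.max_nonspanning" by auto
    thus "M.uniform" using few_generators by simp
  next
    assume u: "M.uniform"
    show "arith_rank Rn basis_ideal = enat (n - M.max_nonspanning)"
    proof (rule antisym)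
      have "length (map esym [M.rank..<Suc n]) = n - M.max_nonspanning" using uniform_rks[OF u] rank_pos rank_le by simp
      hence "enat (n - M.max_nonspanning) \<in> ?L" using esym_radical[OF u] esym_carr by (intro CollectI exI[of _ "map esym [M.rank..<Suc n]"]) auto
      thus "arith_rank Rn basis_ideal \<le> enat (n - M.max_nonspanning)" unfolding ar by (rule Inf_lower)
      show "enat (n - M.max_nonspanning) \<le> arith_rank Rn basis_ideal" unfolding ar
      proof (rule Inf_greatest, clarify)
        fix fs assume "set fs \<subseteq> carrier Rn" "radical Rn (Idl\<^bsub>Rn\<^esub> (set fs)) = radical Rn basis_ideal"
        thus "enat (n - M.max_nonspanning) \<le> enat (length fs)" using few_generators[of fs] by (cases "length fs \<le> n - M.max_nonspanning") auto
      qed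
    qed
  qed
qed

lemma cm_uniform: assumes cm: "cohen_macaulay (Rn Quot basis_ideal)" shows "M.uniform"
proof (rule ccontr)
  assume nu: "\<not> M.uniform"
  define A where "A = localization (Rn Quot basis_ideal) (carrier (Rn Quot basis_ideal) - ((+>\<^bsub>Rn\<^esub>) basis_ideal) ` origin)"
  define \<phi> where "\<phi> = (\<lambda>r. loc_frac (Rn Quot basis_ideal) (carrier (Rn Quot basis_ideal) - ((+>\<^bsub>Rn\<^esub>) basis_ideal) ` origin) (basis_ideal +>\<^bsub>Rn\<^esub> r) \<one>\<^bsub>Rn Quot basis_ideal\<^esub>)"
  have mA: "localized_polynomials n A \<phi> origin basis_ideal" unfolding A_def \<phi>_def by (rule localized_polynomials_origin[OF basis_ideal_ideal basis_ideal_origin])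
  then interpret localized_polynomials n tk A \<phi> origin basis_ideal .
  have "local_cohen_macaulay A" unfolding A_def
    using cm R.quot_maximal(1)[OF basis_ideal_ideal origin_maximal basis_ideal_origin] unfolding cohen_macaulay_def by blast
  hence dd: "local_depth A = krull_dim A" by (simp add: local_cohen_macaulay_def)
  obtain H where H: "M.nonspanning H" "card H = M.max_nonspanning" using M.max_nonspanning(1)[OF rank_pos] by blast
  have HE: "H \<subseteq> {1..n}" using H by (simp add: M.nonspanning_def)
  have e: "{1..n} - ({1..n} - H) = H" "{1..n} - H \<union> H = {1..n}" using HE by blast+
  obtain qs where qs: "prime_chain Rn qs" "length qs = Suc (card H)" "hd qs = coord_prime ({1..n} - H)" "last qs = coord_prime ({1..n} - H \<union> H)"
    using coord_prime_chain_up[of H "{1..n} - H"] HE finite_subset[OF HE] by auto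
  have "basis_ideal \<subseteq> hd qs" unfolding qs(3) using H(1) e by (intro basis_ideal_sub_coord_prime) auto
  hence "prime_chain A (map L.extended qs)" using qs e by (intro L.extended_chain) auto
  hence "enat M.max_nonspanning \<le> krull_dim A" using qs(2) H(2) by (intro L.A.krull_dim_ge[of "map L.extended qs"]) auto
  hence reg: "L.A.has_regular_seq (L.extended origin) {\<zero>\<^bsub>A\<^esub>} M.max_nonspanning" using dd by (intro N.depth_geD) simp
  show False
  proof (rule nonuniform_no_regular_seq[OF mA nu L.A.zeroideal reg])
    fix Z assume Z: "Z \<subseteq> {1..n}" "M.nonspanning ({1..n} - Z)"
    have "L.contracted {\<zero>\<^bsub>A\<^esub>} = L.saturated basis_ideal" using L.contracted_extended[OF basis_ideal_ideal] L.extended_I0 by simp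
    also have "\<dots> \<subseteq> L.saturated (coord_prime Z)" using basis_ideal_sub_coord_prime[OF Z] by (auto simp: L.saturated_def)
    also have "\<dots> = coord_prime Z" by (rule L.saturated_prime[OF coord_prime_prime coord_prime_mono[OF Z(1)]])
    finally show "L.contracted {\<zero>\<^bsub>A\<^esub>} \<subseteq> coord_prime Z" .
  next
    fix S assume S: "S \<in> BB"
    have "\<phi> (xprod S) \<in> L.extended basis_ideal" using L.phi_extended[OF basis_ideal_ideal basis_monomial_mem[OF S]] .
    hence "\<phi> (xprod S ^ 1) \<in> {\<zero>\<^bsub>A\<^esub>}" using L.extended_I0 by simp
    thus "\<exists>k. \<phi> (xprod S ^ k) \<in> {\<zero>\<^bsub>A\<^esub>}" by blast
  qed
qed

text \<open>The intermediate ideals between the uniform ideal, which has \<open>V = {1..n}\<close> and \<open>Z = {}\<close>, and the coordinate primes: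
  all squarefree products of \<open>k\<close> variables from \<open>V\<close>, and the variables in \<open>Z\<close>.\<close>

definition skeletal_ideal :: "nat set \<Rightarrow> nat set \<Rightarrow> nat \<Rightarrow> (mon \<Rightarrow>\<^sub>0 'k) set" where
  "skeletal_ideal V Z k = monomial_span (\<lambda>u. ks u \<inter> Z \<noteq> {} \<or> k \<le> card (ks u \<inter> V))"

lemma skeletal_ideal_ideal: "ideal (skeletal_ideal V Z k) Rn" unfolding skeletal_ideal_def
proof (rule monomial_span_ideal)
  fix u v :: mon
  have "card (ks u \<inter> V) \<le> card (ks (u + v) \<inter> V)" by (intro card_mono) (auto simp: keys_add_nat)
  thus "ks u \<inter> Z \<noteq> {} \<or> k \<le> card (ks u \<inter> V) \<Longrightarrow> ks (u + v) \<inter> Z \<noteq> {} \<or> k \<le> card (ks (u + v) \<inter> V)"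
    by (auto simp: keys_add_nat)
qed

lemma skeletal_ideal_small: assumes "finite V" "card V < k" shows "skeletal_ideal V Z k = coord_prime Z"
proof -
  have "card (ks u \<inter> V) \<le> card V" for u :: mon using assms(1) by (intro card_mono) auto
  hence "\<not> k \<le> card (ks u \<inter> V)" for u :: mon using assms(2) by (meson le_trans not_le)
  thus ?thesis unfolding skeletal_ideal_def coord_prime_def by (intro monomial_span_cong) blast
qed

lemma skeletal_ideal_one: assumes "finite V" shows "skeletal_ideal V Z 1 = coord_prime (Z \<union> V)"
proof -
  have "1 \<le> card (ks u \<inter> V) \<longleftrightarrow> ks u \<inter> V \<noteq> {}" for u :: mon
    using assms card_gt_0_iff[of "ks u \<inter> V"] by (auto simp: Suc_le_eq One_nat_def)
  thus ?thesis unfolding skeletal_ideal_def coord_prime_def by (intro monomial_span_cong) auto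
qed

lemma skeletal_ideal_colon: assumes v: "v \<in> V" "v \<notin> Z" "v \<in> {1..n}" and V: "finite V" and k: "k \<ge> 1"
  shows "R.colon (skeletal_ideal V Z (Suc k)) (xvar v) = skeletal_ideal (V - {v}) Z k"
proof -
  have c: "ks (Poly_Mapping.single v 1 + u) \<inter> Z \<noteq> {} \<or> Suc k \<le> card (ks (Poly_Mapping.single v 1 + u) \<inter> V) \<longleftrightarrow>
     ks u \<inter> Z \<noteq> {} \<or> k \<le> card (ks u \<inter> (V - {v}))" for u :: mon
  proof -
    have 1: "ks (Poly_Mapping.single v 1 + u) = insert v (ks u)" by (simp add: keys_add_nat)
    have "insert v (ks u) \<inter> V = insert v (ks u \<inter> (V - {v}))" using v by blast
    hence "card (insert v (ks u) \<inter> V) = Suc (card (ks u \<inter> (V - {v})))" by simp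
    thus ?thesis unfolding 1 using v(2) by simp
  qed
  have kv: "ks (f * xvar v) = (\<lambda>u. Poly_Mapping.single v 1 + u) ` ks f" for f :: "mon \<Rightarrow>\<^sub>0 'k"
  proof
    show "ks (f * xvar v) \<subseteq> (\<lambda>u. Poly_Mapping.single v 1 + u) ` ks f"
      using keys_mono_mult[of "Poly_Mapping.single v 1" 1 f] by (simp add: xvar_def mult.commute)
    show "(\<lambda>u. Poly_Mapping.single v 1 + u) ` ks f \<subseteq> ks (f * xvar v)"
      using lookup_mono_mult[of "Poly_Mapping.single v 1" 1 f] by (auto simp: xvar_def mult.commute in_keys_iff)
  qed
  have "f \<in> R.colon (skeletal_ideal V Z (Suc k)) (xvar v) \<longleftrightarrow> f \<in> skeletal_ideal (V - {v}) Z k" for f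
  proof -
    have "f \<in> R.colon (skeletal_ideal V Z (Suc k)) (xvar v) \<longleftrightarrow> f \<in> carrier Rn \<and> f * xvar v \<in> skeletal_ideal V Z (Suc k)" by (simp add: R.colon_def)
    also have "\<dots> \<longleftrightarrow> f \<in> carrier Rn \<and> (\<forall>u\<in>ks (f * xvar v). ks u \<inter> Z \<noteq> {} \<or> Suc k \<le> card (ks u \<inter> V))"
      unfolding skeletal_ideal_def monomial_span_def using carr_mult xvar_carr[OF v(3)] by blast
    also have "\<dots> \<longleftrightarrow> f \<in> skeletal_ideal (V - {v}) Z k" unfolding kv ball_simps(9) c skeletal_ideal_def monomial_span_def by blast
    finally show ?thesis .
  qed
  thus ?thesis by blast
qed

lemma skeletal_ideal_adjoin: assumes v: "v \<in> V" "v \<notin> Z" "v \<in> {1..n}" and V: "finite V"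
  shows "R.adjoin (skeletal_ideal V Z k) (xvar v) = skeletal_ideal (V - {v}) (insert v Z) k"
proof
  note vc = xvar_carr[OF v(3)]
  have nv: "ks u \<inter> V = ks u \<inter> (V - {v})" if "v \<notin> ks u" for u :: mon using that by blast
  show "R.adjoin (skeletal_ideal V Z k) (xvar v) \<subseteq> skeletal_ideal (V - {v}) (insert v Z) k"
  proof (rule R.adjoin_min[OF skeletal_ideal_ideal])
    have "ks u \<inter> insert v Z \<noteq> {} \<or> k \<le> card (ks u \<inter> (V - {v}))" if "ks u \<inter> Z \<noteq> {} \<or> k \<le> card (ks u \<inter> V)" for u :: mon
      using that nv[of u] by (cases "v \<in> ks u") auto
    thus "skeletal_ideal V Z k \<subseteq> skeletal_ideal (V - {v}) (insert v Z) k" unfolding skeletal_ideal_def monomial_span_def by blast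
    show "xvar v \<in> skeletal_ideal (V - {v}) (insert v Z) k" using vc by (auto simp: skeletal_ideal_def monomial_span_def xvar_def)
  qed
  note ai = R.adjoin_ideal[OF skeletal_ideal_ideal vc, of V Z k]
  show "skeletal_ideal (V - {v}) (insert v Z) k \<subseteq> R.adjoin (skeletal_ideal V Z k) (xvar v)"
  proof
    fix f assume f: "f \<in> skeletal_ideal (V - {v}) (insert v Z) k"
    hence fc: "f \<in> carrier Rn" by (simp add: skeletal_ideal_def monomial_span_def)
    show "f \<in> R.adjoin (skeletal_ideal V Z k) (xvar v)"
    proof (rule id_keys[OF ai fc])
      fix u assume u: "u \<in> ks f"
      have um: "u \<in> monomials n" using fc u by (auto simp: carrier_iff)
      show "Poly_Mapping.single u 1 \<in> R.adjoin (skeletal_ideal V Z k) (xvar v)"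
      proof (cases "v \<in> ks u")
        case True
        hence "lk u v > 0" by (simp add: in_keys_iff)
        note s = single_split[OF this]
        have "u - Poly_Mapping.single v 1 \<in> monomials n" using um s monomials_add_iff by metis
        hence "Poly_Mapping.single (u - Poly_Mapping.single v 1) 1 * xvar v \<in> R.adjoin (skeletal_ideal V Z k) (xvar v)"
          using id_mult[OF ai R.adjoin_gen[OF skeletal_ideal_ideal vc] carr_single] by blast
        also have "Poly_Mapping.single (u - Poly_Mapping.single v 1) 1 * xvar v = Poly_Mapping.single u 1"
          unfolding xvar_def mult_single using s by (simp add: add.commute)
        finally show ?thesis .
      next
        case False
        have "ks u \<inter> insert v Z \<noteq> {} \<or> k \<le> card (ks u \<inter> (V - {v}))" using f u unfolding skeletal_ideal_def monomial_span_def by blast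
        hence "ks u \<inter> Z \<noteq> {} \<or> k \<le> card (ks u \<inter> V)" using False nv[OF False] by auto
        hence "Poly_Mapping.single u 1 \<in> skeletal_ideal V Z k" unfolding skeletal_ideal_def using single_monomial_span[OF um] by blast
        thus ?thesis using R.adjoin_sup[OF skeletal_ideal_ideal vc] by blast
      qed
    qed
  qed
qed

lemma skeletal_ideal_full: assumes "M.uniform" shows "skeletal_ideal {1..n} {} M.rank = basis_ideal"
  unfolding skeletal_ideal_def basis_ideal_def
proof (rule monomial_span_cong)
  fix u assume "u \<in> monomials n"
  hence ku: "ks u \<subseteq> {1..n}" by (simp add: monomials_def)
  have "M.rank \<le> card (ks u) \<longleftrightarrow> (\<exists>B\<in>BB. B \<subseteq> ks u)"
  proof
    assume "M.rank \<le> card (ks u)"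
    then obtain B where B: "B \<subseteq> ks u" "card B = M.rank" by (metis obtain_subset_with_card_n)
    thus "\<exists>B\<in>BB. B \<subseteq> ks u" using M.uniform_base[OF assms, of B] ku by blast
  next
    assume "\<exists>B\<in>BB. B \<subseteq> ks u"
    thus "M.rank \<le> card (ks u)" using M.card_B card_mono[of "ks u"] by (metis finite_keys)
  qed
  moreover have "ks u \<inter> {1..n} = ks u" using ku by blast
  ultimately show "(ks u \<inter> {} \<noteq> {} \<or> M.rank \<le> card (ks u \<inter> {1..n})) = (\<exists>B\<in>BB. B \<subseteq> ks u)" by simp
qed

text \<open>A variable \<open>v \<in> V\<close> splits \<open>skeletal_ideal V Z k\<close> into its colon and its sum with \<open>x\<^sub>v\<close>. Both are skeletal again with
  fewer variables in \<open>V\<close> and with the same value of \<open>card ({1..n} - V - Z) + k\<close>; at the end coordinate primes with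
  \<open>rank - 1\<close> free variables are left.\<close>

lemma uniform_reg:
  fixes A :: "('b, 'c) ring_scheme"
  assumes L: "localized_polynomials n A \<phi> m basis_ideal" and u: "M.uniform"
    and ys: "set ys \<subseteq> carrier A" "\<And>Z. Z \<subseteq> {1..n} \<Longrightarrow> card ({1..n} - Z) = M.rank - 1 \<Longrightarrow> cring.weakly_regular A (localized_ring.extended Rn A \<phi> m (coord_prime Z)) ys"
  shows "cring.weakly_regular A (localized_ring.extended Rn A \<phi> m basis_ideal) ys"
proof -
  interpret localized_polynomials n tk A \<phi> m basis_ideal by (rule L)
  have "L.A.weakly_regular (L.extended (skeletal_ideal V Z k)) ys" 
    if "V \<subseteq> {1..n}" "Z \<subseteq> {1..n}" "V \<inter> Z = {}" "1 \<le> k" "card ({1..n} - V - Z) + k = M.rank" "k \<le> Suc (card V)" "basis_ideal \<subseteq> skeletal_ideal V Z k" for V Z k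
    using that
  proof (induction "card V" arbitrary: V Z k)
    case 0
    hence "finite V" using finite_subset by blast
    hence "V = {}" using 0 by simp
    hence "skeletal_ideal V Z k = coord_prime Z" "card ({1..n} - Z) = M.rank - 1" using 0 skeletal_ideal_small[of V k Z] by auto
    thus ?case using ys(2) 0 by simp
  next
    case (Suc c)
    have fV: "finite V" using Suc.prems finite_subset by blast
    show ?case
    proof (cases "card V < k")
      case True
      have "{1..n} - Z = ({1..n} - V - Z) \<union> V" using Suc.prems by blast
      moreover have "card (({1..n} - V - Z) \<union> V) = card ({1..n} - V - Z) + card V" using fV by (intro card_Un_disjoint) auto
      ultimately have "card ({1..n} - Z) = M.rank - 1" using Suc.prems(5,6) True by simp
      thus ?thesis using ys(2) Suc.prems skeletal_ideal_small[OF fV True] by simp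
    next
      case False
      show ?thesis
      proof (cases "k = 1")
        case True
        have "{1..n} - (Z \<union> V) = {1..n} - V - Z" by blast
        hence "card ({1..n} - (Z \<union> V)) = M.rank - 1" using Suc.prems(5) True by simp
        thus ?thesis using ys(2)[of "Z \<union> V"] Suc.prems skeletal_ideal_one[OF fV] True by simp
      next
        case k1: False
        then obtain k' where k': "k = Suc k'" "1 \<le> k'" using Suc.prems(4) by (cases k) auto
        obtain v where v: "v \<in> V" using Suc.hyps(2) by (metis card.empty ex_in_conv nat.distinct(1))
        have vZ: "v \<notin> Z" "v \<in> {1..n}" using v Suc.prems by auto
        have cV: "card (V - {v}) = c" using v fV Suc.hyps(2) by simp
        note co = skeletal_ideal_colon[OF v vZ fV k'(2)] and ad = skeletal_ideal_adjoin[OF v vZ fV, of k]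
        have vc: "xvar v \<in> carrier Rn" using xvar_carr vZ by blast
        have i: "ideal (L.extended (skeletal_ideal V Z k)) A" by (rule L.extended_ideal[OF skeletal_ideal_ideal])
        show ?thesis
        proof (rule L.A.weakly_regular_colon[OF i L.phi(1)[OF vc] ys(1)])
          have IIk: "basis_ideal \<subseteq> skeletal_ideal (V - {v}) Z k'" using Suc.prems(7) R.colon_sup[OF skeletal_ideal_ideal vc] co k'(1) by blast
          have ck: "card ({1..n} - (V - {v}) - Z) = Suc (card ({1..n} - V - Z))"
          proof -
            have "{1..n} - (V - {v}) - Z = insert v ({1..n} - V - Z)" using v vZ by blast
            thus ?thesis using v by simp
          qed
          have "L.A.weakly_regular (L.extended (skeletal_ideal (V - {v}) Z k')) ys"
          proof (intro Suc.hyps(1))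
            show "c = card (V - {v})" using cV by simp
            show "V - {v} \<subseteq> {1..n}" "(V - {v}) \<inter> Z = {}" using Suc.prems(1,3) by blast+
            show "k' \<le> Suc (card (V - {v}))" using Suc.prems(6) Suc.hyps(2) k'(1) cV by simp
            show "card ({1..n} - (V - {v}) - Z) + k' = M.rank" using Suc.prems(5) k'(1) ck by simp
          qed (fact Suc.prems(2) k'(2) IIk)+
          thus "L.A.weakly_regular (L.A.colon (L.extended (skeletal_ideal V Z k)) (\<phi> (xvar v))) ys"
            using L.extended_colon[OF skeletal_ideal_ideal Suc.prems(7) vc] co k'(1) by simp
          have IIk': "basis_ideal \<subseteq> skeletal_ideal (V - {v}) (insert v Z) k" using Suc.prems(7) R.adjoin_sup[OF skeletal_ideal_ideal vc] ad by blast
          have ck': "{1..n} - (V - {v}) - insert v Z = {1..n} - V - Z" using v by blast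
          have "L.A.weakly_regular (L.extended (skeletal_ideal (V - {v}) (insert v Z) k)) ys"
          proof (intro Suc.hyps(1))
            show "c = card (V - {v})" using cV by simp
            show "V - {v} \<subseteq> {1..n}" "(V - {v}) \<inter> insert v Z = {}" "insert v Z \<subseteq> {1..n}" using Suc.prems(1-3) vZ by blast+
            show "k \<le> Suc (card (V - {v}))" using False Suc.hyps(2) cV by simp
            show "card ({1..n} - (V - {v}) - insert v Z) + k = M.rank" unfolding ck' by (rule Suc.prems(5))
          qed (fact Suc.prems(4) IIk')+
          thus "L.A.weakly_regular (L.A.adjoin (L.extended (skeletal_ideal V Z k)) (\<phi> (xvar v))) ys"
            unfolding L.extended_adjoin[OF skeletal_ideal_ideal vc, symmetric] ad .
        qed
      qed
    qed
  qed
  from this[of "{1..n}" "{}" M.rank] show ?thesis using skeletal_ideal_full[OF u] rank_pos rank_le by simp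
qed

text \<open>With \<open>T\<close> a transcendence basis modulo \<open>m\<close>, both the depth and the dimension at \<open>m\<close> are \<open>rank - 1 - card T\<close>.\<close>

lemma uniform_cm: assumes u: "M.uniform" shows "cohen_macaulay (Rn Quot basis_ideal)"
  unfolding cohen_macaulay_def
proof (intro conjI allI impI)
  interpret q: ring_hom_cring Rn "Rn Quot basis_ideal" "(+>\<^bsub>Rn\<^esub>) basis_ideal" by (rule R.quot_hom[OF basis_ideal_ideal])
  show "cring (Rn Quot basis_ideal)" by (rule q.S.is_cring)
  show "noetherian_ring (Rn Quot basis_ideal)" by (rule R.quot_noeth[OF basis_ideal_ideal noeth_Rn])
  fix M assume M: "maximalideal M (Rn Quot basis_ideal)"
  define A where "A = localization (Rn Quot basis_ideal) (carrier (Rn Quot basis_ideal) - M)"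
  define \<phi> where "\<phi> = (\<lambda>r. loc_frac (Rn Quot basis_ideal) (carrier (Rn Quot basis_ideal) - M) (basis_ideal +>\<^bsub>Rn\<^esub> r) \<one>\<^bsub>Rn Quot basis_ideal\<^esub>)"
  define m where "m = {r \<in> carrier Rn. basis_ideal +>\<^bsub>Rn\<^esub> r \<in> M}"
  have mA: "localized_polynomials n A \<phi> m basis_ideal" unfolding A_def \<phi>_def m_def localized_polynomials_def
    by (rule localized_ring_quotient[OF R.is_cring basis_ideal_ideal q.S.maximalideal_prime[OF M]])
  then interpret localized_polynomials n tk A \<phi> m basis_ideal .
  have mi: "ideal m Rn" using R.prime_ideal[OF L.m_prime] .
  obtain T where T: "T \<subseteq> {1..n}" "\<forall>f\<in>m. f \<in> poly_in T \<longrightarrow> f = 0" "\<forall>v\<in>{1..n}-T. \<exists>p\<in>m. p \<in> poly_in (insert v T) \<and> p \<noteq> 0"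
    using transcendence_basis_exists[OF mi prime_one'[OF L.m_prime]] by blast
  define r where "r = M.rank - 1 - card T"
  have "local_cohen_macaulay A"
  proof (rule N.cohen_macaulayI)
    show "krull_dim A \<le> enat r" unfolding krull_dim_def
    proof (rule Sup_least, clarify)
      fix ps assume ps: "prime_chain A ps"
      have hp: "primeideal (hd ps) A" using ps by (cases ps) (auto simp: prime_chain_def)
      have cp: "primeideal (L.contracted (hd ps)) Rn" by (rule L.contracted_prime[OF hp])
      have "basis_ideal \<subseteq> L.contracted (hd ps)" by (rule L.contracted_I0[OF L.A.prime_ideal[OF hp]])
      then obtain Z where Z: "Z \<subseteq> {1..n}" "M.nonspanning ({1..n} - Z)" "coord_prime Z \<subseteq> L.contracted (hd ps)" "n \<le> card Z + M.max_nonspanning" "card Z \<le> n"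
        by (rule prime_above_basis_ideal_card[OF cp])
      have "length ps + card Z + card T \<le> Suc n" using T ps Z by (intro chain_length_localized) auto
      thus "enat (length ps - 1) \<le> enat r" unfolding r_def using Z(4) uniform_rks[OF u] by simp
    qed
    define JS where "JS = (\<lambda>Z. L.extended (coord_prime Z)) ` {Z. Z \<subseteq> {1..n} \<and> card ({1..n} - Z) = M.rank - 1}"
    have "\<exists>ys. length ys = r \<and> set ys \<subseteq> L.extended m \<and> (\<forall>J\<in>JS. L.A.weakly_regular J ys)"
    proof (rule N.common_reg[OF _ _ N.m_ideal])
      show "finite JS" unfolding JS_def by (rule finite_imageI, rule finite_subset[of _ "Pow {1..n}"]) auto
      fix J assume "J \<in> JS"
      then obtain Z where Z: "J = L.extended (coord_prime Z)" "Z \<subseteq> {1..n}" "card ({1..n} - Z) = M.rank - 1" by (auto simp: JS_def)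
      have "M.nonspanning ({1..n} - Z)" unfolding M.nonspanning_def
      proof (intro conjI ballI notI)
        fix B assume B: "B \<in> BB" "B \<subseteq> {1..n} - Z"
        hence "card B \<le> M.rank - 1" using card_mono[of "{1..n} - Z" B] Z(3) by simp
        thus False using M.card_B[OF B(1)] rank_pos by linarith
      qed blast
      hence IZ: "basis_ideal \<subseteq> coord_prime Z" by (rule basis_ideal_sub_coord_prime[OF Z(2)])
      from regular_seq_mod_coord_prime[OF T Z(2) IZ] have "L.A.has_regular_seq (L.extended m) J (n - card Z - card T)" unfolding Z(1) .
      moreover have "n - card Z = M.rank - 1" using Z(3) card_compl[OF Z(2)] by metis
      moreover have "ideal J A" unfolding Z(1) by (rule L.extended_ideal[OF coord_prime_ideal])
      ultimately show "ideal J A \<and> L.A.has_regular_seq (L.extended m) J r" unfolding r_def by metis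
    qed
    then obtain ys where ys: "length ys = r" "set ys \<subseteq> L.extended m" "\<forall>J\<in>JS. L.A.weakly_regular J ys" by blast
    have "set ys \<subseteq> carrier A" using ys(2) L.A.ideal_carr[OF N.m_ideal] by blast
    hence "L.A.weakly_regular (L.extended basis_ideal) ys" using ys(3) by (intro uniform_reg[OF mA u]) (auto simp: JS_def)
    thus "L.A.has_regular_seq (L.extended m) {\<zero>\<^bsub>A\<^esub>} r" unfolding L.extended_I0 L.A.has_regular_seq_def using ys by blast
  qed
  thus "local_cohen_macaulay (localization (Rn Quot basis_ideal) (carrier (Rn Quot basis_ideal) - M))" unfolding A_def .
qed

end

theorem corollary4p5:
  fixes n :: nat and I :: "((nat \<Rightarrow>\<^sub>0 nat) \<Rightarrow>\<^sub>0 'k::field) set"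
  assumes "n \<ge> 1"
    and "matroidal n I"
    and "ideal_supp n I = {1..n}"
  shows "cohen_macaulay (mpoly_ring n Quot I) \<longleftrightarrow>
         set_theoretic_complete_intersection (mpoly_ring n) I"
proof -
  interpret polynomials n "TYPE('k)" .
  obtain BB where BB: "matroid_bases {1..n} BB" "I = monomial_span (\<lambda>u. \<exists>B\<in>BB. B \<subseteq> ks u)"
    using matroidal_bases[OF assms] by blast
  interpret matroid_ideal n "TYPE('k)" BB using BB(1) assms(1) by (intro matroid_ideal.intro matroid_ideal_axioms.intro)
  have I: "I = basis_ideal" using BB(2) by (simp add: basis_ideal_def)
  show ?thesis unfolding I using stci_iff cm_uniform uniform_cm by blast
qed

end
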